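(* Let $\lambda=(b,a)$ with integers $b\ge a\ge0$ be a Young diagram with at most two rows, and let $\mu=(v,u)$, $v\ge u\ge0$, $v\le b$, $u\le a$, be a nonempty subdiagram. (i) The Gröbner cell $G_{\mu\subset\lambda}$ is an affine space over $\mathbb F_q$ of dimension $$\dim_q(G_{\mu\subset\lambda})=\min\Bigl(\Bigl\lfloor\tfrac{v-u}{2}\Bigr\rfloor,\ a-u\Bigr);$$ it equals $\lfloor\frac{v-u}{2}\rfloor$ when $a\ge\lfloor\frac{v+u}{2}\rfloor$ and $a-u$ when $a\le\lfloor\frac{v+u}{2}\rfloor$. (ii) The $\varrho$-rank of any ideal $I$ with $I_\lambda\subset I\subsetneq\mathcal A$ is $2$ or $3$. If $u>0$, then $G^{(3)}_{\mu\subset\lambda}$ is an affine space of dimension $\min\bigl(\lceil\frac{v-u}{2}\rceil-1,\ a-u\bigr)$, where dimension $-1$ means that it is empty; if $u=0$, then $G^{(3)}_{\mu\subset\lambda}$ is empty. (iii) The superpolynomial $\mathscr H_\lambda(q,t,\mathsf a)$ is $\delta$-superdual for $\delta=|\lambda|=a+b$ if and only if $b\ge 2a-1$.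
   Context: $\mathcal A=\mathbb F_q[[x,y]]$, $\mathfrak m_{\mathcal A}=x\mathcal A+y\mathcal A$. Boxes of a Young diagram $\lambda=(\lambda_1\ge\lambda_2\ge\cdots)$ are indexed by $(i,j)$, $i\ge0$ the row and $j\ge 0$ the column. $I_\lambda\subset\mathcal A$ is the monomial ideal generated by all $x^iy^j$ with $(i,j)\notin\lambda$; e.g. for $\lambda=(b,a)$ with $a>0$ it is $(x^2,xy^a,y^b)$. Monomials are ordered by $1\prec x\prec y$, meaning $x^m\prec y$ for all $m\ge0$ (lexicographic order, first by the power of $y$, then by the power of $x$). For $f\in\mathcal A$, the leading term $f^0$ is the smallest monomial occurring in $f$; for an ideal $I$ of finite codimension, $I^0$ is the monomial ideal generated by the leading terms of all $f\in I$, so $I^0=I_\mu$ for a Young diagram $\mu$ and $\dim_{\mathbb F_q}\mathcal A/I=|\mu|$. $\varrho(I)=\dim_{\mathbb F_q}I/\mathfrak m_{\mathcal A}I$, $\deg(I)=\dim_{\mathbb F_q}\mathcal A/I$. For $\mu\subset\lambda$: $G_{\mu\subset\lambda}=\{I:\ I_\lambda\subset I\subset\mathcal A,\ I^0=I_\mu\}$ and $G^{(r)}_{\mu\subset\lambda}=\{I\in G_{\mu\subset\lambda}:\varrho(I)=r\}$. "Affine space of dimension $d$" refers to the parametrization by coefficients of the Gröbner generators, in particular the cell has $q^d$ points over $\mathbb F_q$. $\mathscr H_\lambda(q,t,\mathsf a)=\sum_{I_\lambda\subset I\subset\mathcal A}t^{\deg(I)}(1+\mathsf aq)\cdots(1+\mathsf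 aq^{\varrho(I)-1})$, a sum over ideals; it is regarded as a polynomial in $q,t,\mathsf a$. A polynomial $\mathscr H(q,t,\mathsf a)$ is $\delta$-superdual if $\mathscr H(q,t,\mathsf a)=t^{\delta}\mathscr H(qt,1/t,\mathsf a)$, i.e. it is invariant under $\mathsf a^kt^lq^m\mapsto\mathsf a^kt^{m+\delta-l}q^m$. *)

theory Defs
  imports
    "HOL-Algebra.Ideal_Product"
    "HOL-Algebra.QuotRing"
    "HOL-Algebra.Embedded_Algebras"
    "HOL-Computational_Algebra.Polynomial"
begin

section \<open>The ring of power series in two variables\<close>

definition powser :: "('a, 'm) ring_scheme \<Rightarrow> (nat \<Rightarrow> 'a) ring" where
  "powser R = \<lparr>carrier = {f. \<forall>n. f n \<in> carrier R},
     monoid.mult = (\<lambda>f g n. \<Oplus>\<^bsub>R\<^esub>k\<in>{..n}. f k \<otimes>\<^bsub>R\<^esub> g (n - k)),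
     one = (\<lambda>n. if n = 0 then \<one>\<^bsub>R\<^esub> else \<zero>\<^bsub>R\<^esub>),
     zero = (\<lambda>n. \<zero>\<^bsub>R\<^esub>),
     add = (\<lambda>f g n. f n \<oplus>\<^bsub>R\<^esub> g n)\<rparr>"

text \<open>\<open>F[[x, y]]\<close> is taken as \<open>F[[y]][[x]]\<close>: the coefficient of \<open>x\<^sup>i y\<^sup>j\<close> in \<open>f\<close> is \<open>f i j\<close>.\<close>

definition powser2 :: "('a, 'm) ring_scheme \<Rightarrow> (nat \<Rightarrow> nat \<Rightarrow> 'a) ring" where
  "powser2 F = powser (powser F)"

definition xy_mon :: "('a, 'm) ring_scheme \<Rightarrow> nat \<Rightarrow> nat \<Rightarrow> (nat \<Rightarrow> nat \<Rightarrow> 'a)" where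
  "xy_mon F i j = (\<lambda>k l. if k = i \<and> l = j then \<one>\<^bsub>F\<^esub> else \<zero>\<^bsub>F\<^esub>)"

definition constants :: "('a, 'm) ring_scheme \<Rightarrow> (nat \<Rightarrow> nat \<Rightarrow> 'a) set" where
  "constants F = {\<lambda>k l. if k = 0 \<and> l = 0 then c else \<zero>\<^bsub>F\<^esub> | c. c \<in> carrier F}"

definition max_ideal :: "('a, 'm) ring_scheme \<Rightarrow> (nat \<Rightarrow> nat \<Rightarrow> 'a) set" where
  "max_ideal F = PIdl\<^bsub>powser2 F\<^esub> (xy_mon F 1 0) <+>\<^bsub>powser2 F\<^esub> PIdl\<^bsub>powser2 F\<^esub> (xy_mon F 0 1)"

text \<open>\<open>dim\<^sub>F (V / J)\<close> for an ideal \<open>J \<subseteq> V\<close>, computed inside the quotient ring by \<open>J\<close>, in which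
  the image of the constants plays the role of \<open>F\<close>.  If \<open>J\<close> is the whole ring this gives \<open>0\<close>.\<close>

definition quot_dim ::
  "('a, 'm) ring_scheme \<Rightarrow> (nat \<Rightarrow> nat \<Rightarrow> 'a) set \<Rightarrow> (nat \<Rightarrow> nat \<Rightarrow> 'a) set \<Rightarrow> nat" where
  "quot_dim F V J =
     ring.dim (powser2 F Quot J)
       ((\<lambda>f. J +>\<^bsub>powser2 F\<^esub> f) ` constants F) ((\<lambda>f. J +>\<^bsub>powser2 F\<^esub> f) ` V)"

definition ideal_deg :: "('a, 'm) ring_scheme \<Rightarrow> (nat \<Rightarrow> nat \<Rightarrow> 'a) set \<Rightarrow> nat" where
  "ideal_deg F I = quot_dim F (carrier (powser2 F)) I"

definition rho :: "('a, 'm) ring_scheme \<Rightarrow> (nat \<Rightarrow> nat \<Rightarrow> 'a) set \<Rightarrow> nat" where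
  "rho F I = quot_dim F I (max_ideal F \<cdot>\<^bsub>powser2 F\<^esub> I)"


section \<open>Young diagrams and Groebner cells\<close>

text \<open>A Young diagram is the list of its row lengths; trailing zero rows are harmless.\<close>

definition boxes :: "nat list \<Rightarrow> (nat \<times> nat) set" where
  "boxes la = {(i, j). i < length la \<and> j < la ! i}"

definition diagram_ideal :: "('a, 'm) ring_scheme \<Rightarrow> nat list \<Rightarrow> (nat \<Rightarrow> nat \<Rightarrow> 'a) set" where
  "diagram_ideal F la = Idl\<^bsub>powser2 F\<^esub> {xy_mon F i j | i j. (i, j) \<notin> boxes la}"

definition ideals_above ::
  "('a, 'm) ring_scheme \<Rightarrow> nat list \<Rightarrow> (nat \<Rightarrow> nat \<Rightarrow> 'a) set set" where
  "ideals_above F la = {I. ideal I (powser2 F) \<and> diagram_ideal F la \<subseteq> I}"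

text \<open>The exponent \<open>(i, j)\<close> stands for \<open>x\<^sup>i y\<^sup>j\<close>; the power of \<open>y\<close> is compared first.\<close>

definition mon_less :: "nat \<times> nat \<Rightarrow> nat \<times> nat \<Rightarrow> bool" where
  "mon_less e e' \<longleftrightarrow> snd e < snd e' \<or> snd e = snd e' \<and> fst e < fst e'"

text \<open>Leading means smallest; meaningful for nonzero \<open>f\<close> only.\<close>

definition lead_exp :: "('a, 'm) ring_scheme \<Rightarrow> (nat \<Rightarrow> nat \<Rightarrow> 'a) \<Rightarrow> nat \<times> nat" where
  "lead_exp F f = (THE e. case_prod f e \<noteq> \<zero>\<^bsub>F\<^esub> \<and>
     (\<forall>e'. case_prod f e' \<noteq> \<zero>\<^bsub>F\<^esub> \<longrightarrow> e' = e \<or> mon_less e e'))"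

definition initial_ideal ::
  "('a, 'm) ring_scheme \<Rightarrow> (nat \<Rightarrow> nat \<Rightarrow> 'a) set \<Rightarrow> (nat \<Rightarrow> nat \<Rightarrow> 'a) set" where
  "initial_ideal F I =
     Idl\<^bsub>powser2 F\<^esub> ((\<lambda>f. case_prod (xy_mon F) (lead_exp F f)) ` (I - {\<zero>\<^bsub>powser2 F\<^esub>}))"

definition groebner_cell ::
  "('a, 'm) ring_scheme \<Rightarrow> nat list \<Rightarrow> nat list \<Rightarrow> (nat \<Rightarrow> nat \<Rightarrow> 'a) set set" where
  "groebner_cell F mu la = {I \<in> ideals_above F la. initial_ideal F I = diagram_ideal F mu}"

definition groebner_cell_rank ::
  "('a, 'm) ring_scheme \<Rightarrow> nat \<Rightarrow> nat list \<Rightarrow> nat list \<Rightarrow> (nat \<Rightarrow> nat \<Rightarrow> 'a) set set" where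
  "groebner_cell_rank F r mu la = {I \<in> groebner_cell F mu la. rho F I = r}"


section \<open>Affine spaces of Groebner coefficients\<close>

text \<open>The exponents of the minimal monomial generators of \<open>diagram_ideal F mu\<close>.\<close>

definition corners :: "nat list \<Rightarrow> (nat \<times> nat) set" where
  "corners mu = {(i, j). (i, j) \<notin> boxes mu \<and>
     (\<forall>k l. (k, l) \<notin> boxes mu \<and> k \<le> i \<and> l \<le> j \<longrightarrow> (k, l) = (i, j))}"

text \<open>The reduced Groebner generator of \<open>I\<close> at a corner \<open>e\<close> of \<open>mu\<close>, where the initial ideal of
  \<open>I\<close> is that of \<open>mu\<close>: monic with leading exponent \<open>e\<close>, and all its other terms lie in boxes
  of \<open>mu\<close>.\<close>

definition groebner_gen ::
  "('a, 'm) ring_scheme \<Rightarrow> nat list \<Rightarrow> (nat \<Rightarrow> nat \<Rightarrow> 'a) set \<Rightarrow> nat \<times> nat \<Rightarrow> (nat \<Rightarrow> nat \<Rightarrow> 'a)" where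
  "groebner_gen F mu I e = (THE f. f \<in> I \<and> lead_exp F f = e \<and> case_prod f e = \<one>\<^bsub>F\<^esub> \<and>
     (\<forall>e'. case_prod f e' \<noteq> \<zero>\<^bsub>F\<^esub> \<longrightarrow> e' = e \<or> e' \<in> boxes mu))"

text \<open>The positions \<open>(e, e')\<close> of the possibly nonzero coefficients: that of the monomial \<open>e'\<close> in
  the generator at the corner \<open>e\<close>.\<close>

definition coeff_positions :: "nat list \<Rightarrow> ((nat \<times> nat) \<times> (nat \<times> nat)) set" where
  "coeff_positions mu = {(e, e'). e \<in> corners mu \<and> e' \<in> boxes mu \<and> mon_less e e'}"

definition groebner_coeffs ::
  "('a, 'm) ring_scheme \<Rightarrow> nat list \<Rightarrow> (nat \<Rightarrow> nat \<Rightarrow> 'a) set \<Rightarrow> (nat \<times> nat) \<times> (nat \<times> nat) \<Rightarrow> 'a" where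
  "groebner_coeffs F mu I =
     (\<lambda>(e, e')\<in>coeff_positions mu. case_prod (groebner_gen F mu I e) e')"

text \<open>\<open>S\<close> is a \<open>d\<close>-dimensional affine subspace of \<open>F\<^sup>E\<close>: the image of \<open>F\<^sup>d\<close> under an injective
  affine-linear map \<open>s \<mapsto> c + A s\<close>.\<close>

definition affine_subspace ::
  "('a, 'm) ring_scheme \<Rightarrow> 'e set \<Rightarrow> nat \<Rightarrow> ('e \<Rightarrow> 'a) set \<Rightarrow> bool" where
  "affine_subspace F E d S \<longleftrightarrow>
     (\<exists>c A. (\<forall>e\<in>E. c e \<in> carrier F) \<and> (\<forall>e\<in>E. \<forall>i<d. A e i \<in> carrier F) \<and>
       bij_betw (\<lambda>s. \<lambda>e\<in>E. c e \<oplus>\<^bsub>F\<^esub> (\<Oplus>\<^bsub>F\<^esub>i\<in>{..<d}. A e i \<otimes>\<^bsub>F\<^esub> s i))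
         ({..<d} \<rightarrow>\<^sub>E carrier F) S)"

text \<open>A set \<open>S\<close> of ideals with initial ideal that of \<open>mu\<close> is an affine space of dimension \<open>d\<close>
  in the parametrization by Groebner coefficients.  Dimension \<open>-1\<close> means that \<open>S\<close> is empty.\<close>

definition affine_cell ::
  "('a, 'm) ring_scheme \<Rightarrow> nat list \<Rightarrow> int \<Rightarrow> (nat \<Rightarrow> nat \<Rightarrow> 'a) set set \<Rightarrow> bool" where
  "affine_cell F mu d S \<longleftrightarrow>
     (if d = -1 then S = {}
      else 0 \<le> d \<and> inj_on (groebner_coeffs F mu) S \<and>
        affine_subspace F (coeff_positions mu) (nat d) (groebner_coeffs F mu ` S))"


section \<open>Superpolynomials\<close>

text \<open>The sum over ideals for one fixed finite field, at given values of \<open>t\<close> and \<open>a\<close>.\<close>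

definition ideal_sum :: "('a, 'm) ring_scheme \<Rightarrow> nat list \<Rightarrow> real \<Rightarrow> real \<Rightarrow> real" where
  "ideal_sum F la t a =
     (\<Sum>I\<in>ideals_above F la. t ^ ideal_deg F I *
        (\<Prod>i\<in>{1..<rho F I}. 1 + a * real (card (carrier F)) ^ i))"

text \<open>Polynomials in \<open>q, t, a\<close>: the innermost variable is \<open>q\<close>, the outermost one is \<open>a\<close>.\<close>

definition eval_qta :: "real poly poly poly \<Rightarrow> real \<Rightarrow> real \<Rightarrow> real \<Rightarrow> real" where
  "eval_qta H q t a = poly (poly (poly H [:[:a:]:]) [:t:]) q"

text \<open>\<open>H\<close> gives the sum over ideals simultaneously for all finite fields.  Every finite field has
  an isomorphic copy carried by a set of natural numbers, so carriers in \<open>nat\<close> suffice.\<close>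

definition is_superpolynomial :: "nat list \<Rightarrow> real poly poly poly \<Rightarrow> bool" where
  "is_superpolynomial la H \<longleftrightarrow>
     (\<forall>K :: nat ring. field K \<and> finite (carrier K) \<longrightarrow>
       (\<forall>t a. eval_qta H (real (card (carrier K))) t a = ideal_sum K la t a))"

definition superdual :: "nat \<Rightarrow> real poly poly poly \<Rightarrow> bool" where
  "superdual \<delta> H \<longleftrightarrow>
     (\<forall>q t a. t \<noteq> 0 \<longrightarrow> eval_qta H q t a = t ^ \<delta> * eval_qta H (q * t) (1 / t) a)"

end

theory Submission
  imports Defs "HOL-Algebra.UnivPoly" "HOL-Algebra.Weak_Morphisms" "HOL-Number_Theory.Residues"
begin

text \<open>An ideal \<open>I\<close> of the cell of \<open>\<mu> = (v, u)\<close> contains \<open>x\<^sup>2\<close> and \<open>y\<^sup>v\<close>, so its only interesting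
  reduced Groebner generator is \<open>G = x y\<^sup>u + g(y)\<close>, where \<open>g\<close> has its terms in degrees strictly between
  \<open>u\<close> and \<open>v\<close>.  These three elements generate an ideal with the required initial ideal iff
  \<open>x g \<in> I\<close>, i.e. \<open>y\<^sup>u\<^sup>+\<^sup>v\<close> divides \<open>g\<^sup>2\<close>, i.e. \<open>2 ord g \<ge> u + v\<close>; and \<open>x y\<^sup>a \<in> I\<close> means
  \<open>ord g \<ge> u + v - a\<close>.  Hence the cell is a coordinate subspace, and counting the free coefficients of
  \<open>g\<close> gives (i).

  For (ii), the classes of \<open>G\<close>, \<open>y\<^sup>v\<close>, \<open>x\<^sup>2\<close> span \<open>I / m I\<close>, and the relations between them are
  multiples of one: from \<open>x G = x\<^sup>2 y\<^sup>u + x g\<close> if \<open>u < v\<close>, and from \<open>G = x y\<^sup>v\<close> if \<open>u = v\<close>.  For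
  \<open>0 < u < v\<close> it degenerates iff the coefficient of \<open>y\<^sup>u\<^sup>+\<^sup>v\<close> in \<open>g\<^sup>2\<close> vanishes as well.

  For (iii), the cells of dimension \<open>m\<close> have the degrees \<open>2 m, \<dots>, b - m + min a (b - m)\<close>, once each,
  and those cells whose rank 3 part has dimension \<open>m - 1\<close> have the same degrees shifted by 1.
  If \<open>b \<ge> 2 a - 1\<close> the upper end is always \<open>a + b - m\<close>, which makes the sum superdual; otherwise the
  cells of dimension \<open>b div 2\<close> violate superduality already in the part without the third variable.\<close>

text \<open>Membership in the span of the three generators is tested by a linear change of
  coordinates that alters row 0 only. It makes sense for every candidate \<open>g\<close>, so the
  span is available as a subspace before it is known to be an ideal: an ideal of the cell is first
  identified with it, and the condition on \<open>g\<close> is then read off from closure under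
  multiplication by x. Dimensions are counted by peeling off linear functionals, each with a vector
  of value 1, until only the ideal divided out remains. The shift of the rank 3 degrees comes from
  matching subdiagrams: for 0 < u < v the rank 3 part for (v, u) has dimension one less than the
  cell for (v, u - 1), whose degree is one less as well. Write S_m for the sum of t^l over the
  degrees l of the cells of dimension m, and c for the third variable. The superpolynomial becomes
  S_0 + c q (S_0 - 1) + (1 + c q)(1 + c q t) W, where W sums q^m S_m over m > 0, and the
  substitution q -> q t, t -> 1/t exchanges the two factors in front of W.\<close>

lemma powser_carrier: "f \<in> carrier (powser R) \<longleftrightarrow> (\<forall>n. f n \<in> carrier R)"
  and powser_mult: "(f \<otimes>\<^bsub>powser R\<^esub> g) n = (\<Oplus>\<^bsub>R\<^esub>k\<in>{..n}. f k \<otimes>\<^bsub>R\<^esub> g (n - k))"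
  and powser_one: "\<one>\<^bsub>powser R\<^esub> n = (if n = 0 then \<one>\<^bsub>R\<^esub> else \<zero>\<^bsub>R\<^esub>)"
  and powser_zero: "\<zero>\<^bsub>powser R\<^esub> n = \<zero>\<^bsub>R\<^esub>"
  and powser_add: "(f \<oplus>\<^bsub>powser R\<^esub> g) n = f n \<oplus>\<^bsub>R\<^esub> g n"
  by (simp_all add: powser_def)

lemmas powser_simps = powser_carrier powser_mult powser_one powser_zero powser_add

section \<open>Power series over a commutative ring form a commutative ring\<close>

context cring
begin

lemma powser_mult_closed:
  "\<lbrakk>f \<in> carrier (powser R); g \<in> carrier (powser R)\<rbrakk> \<Longrightarrow> f \<otimes>\<^bsub>powser R\<^esub> g \<in> carrier (powser R)"
  by (auto simp: powser_carrier powser_mult)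

text \<open>Associativity and commutativity concern finitely many coefficients at a time, hence are
  inherited from polynomials by truncation.\<close>

definition trunc_poly :: "nat \<Rightarrow> (nat \<Rightarrow> 'a) \<Rightarrow> nat \<Rightarrow> 'a" where
  "trunc_poly N f = (\<lambda>i. if i \<le> N then f i else \<zero>)"

lemma trunc_poly_closed:
  "f \<in> carrier (powser R) \<Longrightarrow> trunc_poly N f \<in> carrier (UP R)"
  by (auto simp: UP_def up_def powser_carrier trunc_poly_def bound_def intro!: exI[of _ N])

lemma coeff_trunc_poly:
  "f \<in> carrier (powser R) \<Longrightarrow> up_ring.coeff (UP R) (trunc_poly N f) n = (if n \<le> N then f n else \<zero>)"
  using trunc_poly_closed[of f N] by (simp add: UP_def trunc_poly_def)

text \<open>Agreement is asked only up to degree \<open>n\<close>, because in the proof of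
  associativity a factor is itself a product of truncations, whose coefficients beyond
  \<open>n\<close> are not those of the series.\<close>

lemma coeff_mult_trunc_poly:
  assumes "f \<in> carrier (powser R)" "g \<in> carrier (powser R)"
    and "p \<in> carrier (UP R)" "q \<in> carrier (UP R)"
    and "\<And>i. i \<le> n \<Longrightarrow> up_ring.coeff (UP R) p i = f i" "\<And>i. i \<le> n \<Longrightarrow> up_ring.coeff (UP R) q i = g i"
  shows "up_ring.coeff (UP R) (p \<otimes>\<^bsub>UP R\<^esub> q) n = (f \<otimes>\<^bsub>powser R\<^esub> g) n"
proof -
  interpret U: UP_cring R "UP R" by unfold_locales
  show ?thesis
    using assms by (auto simp: powser_mult powser_carrier intro!: finsum_cong')
qed

lemma powser_m_comm:
  assumes "f \<in> carrier (powser R)" "g \<in> carrier (powser R)"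
  shows "f \<otimes>\<^bsub>powser R\<^esub> g = g \<otimes>\<^bsub>powser R\<^esub> f"
proof
  fix n
  interpret U: UP_cring R "UP R" by unfold_locales
  let ?T = "trunc_poly n"
  note [simp] = trunc_poly_closed coeff_trunc_poly assms
  have "(f \<otimes>\<^bsub>powser R\<^esub> g) n = up_ring.coeff (UP R) (?T f \<otimes>\<^bsub>UP R\<^esub> ?T g) n"
    by (rule coeff_mult_trunc_poly[symmetric]) simp_all
  also have "\<dots> = up_ring.coeff (UP R) (?T g \<otimes>\<^bsub>UP R\<^esub> ?T f) n"
    by (subst U.UP_m_comm) simp_all
  also have "\<dots> = (g \<otimes>\<^bsub>powser R\<^esub> f) n"
    by (rule coeff_mult_trunc_poly) simp_all
  finally show "(f \<otimes>\<^bsub>powser R\<^esub> g) n = (g \<otimes>\<^bsub>powser R\<^esub> f) n" .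
qed

lemma powser_m_assoc:
  assumes "f \<in> carrier (powser R)" "g \<in> carrier (powser R)" "h \<in> carrier (powser R)"
  shows "(f \<otimes>\<^bsub>powser R\<^esub> g) \<otimes>\<^bsub>powser R\<^esub> h = f \<otimes>\<^bsub>powser R\<^esub> (g \<otimes>\<^bsub>powser R\<^esub> h)"
proof
  fix n
  interpret U: UP_cring R "UP R" by unfold_locales
  let ?T = "trunc_poly n"
  note [simp] = trunc_poly_closed coeff_trunc_poly assms powser_mult_closed
  have *: "up_ring.coeff (UP R) (?T a \<otimes>\<^bsub>UP R\<^esub> ?T b) i = (a \<otimes>\<^bsub>powser R\<^esub> b) i"
    if "i \<le> n" "a \<in> carrier (powser R)" "b \<in> carrier (powser R)" for a b i
    using that by (intro coeff_mult_trunc_poly) simp_all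
  have "((f \<otimes>\<^bsub>powser R\<^esub> g) \<otimes>\<^bsub>powser R\<^esub> h) n =
      up_ring.coeff (UP R) ((?T f \<otimes>\<^bsub>UP R\<^esub> ?T g) \<otimes>\<^bsub>UP R\<^esub> ?T h) n"
    by (rule coeff_mult_trunc_poly[symmetric]) (simp_all add: * del: U.coeff_mult)
  also have "\<dots> = up_ring.coeff (UP R) (?T f \<otimes>\<^bsub>UP R\<^esub> (?T g \<otimes>\<^bsub>UP R\<^esub> ?T h)) n"
    by (subst U.UP_m_assoc) simp_all
  also have "\<dots> = (f \<otimes>\<^bsub>powser R\<^esub> (g \<otimes>\<^bsub>powser R\<^esub> h)) n"
    by (rule coeff_mult_trunc_poly) (simp_all add: * del: U.coeff_mult)
  finally show "((f \<otimes>\<^bsub>powser R\<^esub> g) \<otimes>\<^bsub>powser R\<^esub> h) n = (f \<otimes>\<^bsub>powser R\<^esub> (g \<otimes>\<^bsub>powser R\<^esub> h)) n" .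
qed

lemma powser_cring: "cring (powser R)"
proof (rule cringI)
  show "abelian_group (powser R)"
  proof (rule abelian_groupI)
    fix f assume "f \<in> carrier (powser R)"
    then show "\<exists>g\<in>carrier (powser R). g \<oplus>\<^bsub>powser R\<^esub> f = \<zero>\<^bsub>powser R\<^esub>"
      by (intro bexI[of _ "\<lambda>n. \<ominus> f n"]) (auto simp: powser_simps l_neg)
  qed (simp_all add: fun_eq_iff powser_simps a_ac)
  show "comm_monoid (powser R)"
  proof (rule comm_monoidI)
    fix f assume f: "f \<in> carrier (powser R)"
    show "\<one>\<^bsub>powser R\<^esub> \<otimes>\<^bsub>powser R\<^esub> f = f"
    proof
      fix n
      have "(\<one>\<^bsub>powser R\<^esub> \<otimes>\<^bsub>powser R\<^esub> f) n = (\<Oplus>k\<in>{..n}. if 0 = k then f (n - k) else \<zero>)"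
        using f by (auto simp: powser_simps intro!: finsum_cong')
      then show "(\<one>\<^bsub>powser R\<^esub> \<otimes>\<^bsub>powser R\<^esub> f) n = f n"
        using f by (simp add: add.finprod_singleton_swap powser_carrier Pi_def)
    qed
  qed (rule powser_mult_closed powser_m_assoc powser_m_comm; assumption | simp add: powser_carrier powser_one)+
next
  fix f g h assume "f \<in> carrier (powser R)" "g \<in> carrier (powser R)" "h \<in> carrier (powser R)"
  then have c: "f i \<in> carrier R" "g i \<in> carrier R" "h i \<in> carrier R" for i
    by (auto simp: powser_carrier)
  show "(f \<oplus>\<^bsub>powser R\<^esub> g) \<otimes>\<^bsub>powser R\<^esub> h =
      f \<otimes>\<^bsub>powser R\<^esub> h \<oplus>\<^bsub>powser R\<^esub> g \<otimes>\<^bsub>powser R\<^esub> h"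
  proof
    fix n
    have "((f \<oplus>\<^bsub>powser R\<^esub> g) \<otimes>\<^bsub>powser R\<^esub> h) n =
        (\<Oplus>k\<in>{..n}. f k \<otimes> h (n - k) \<oplus> g k \<otimes> h (n - k))"
      using c by (auto simp: powser_simps l_distr intro!: finsum_cong')
    also have "\<dots> = (f \<otimes>\<^bsub>powser R\<^esub> h \<oplus>\<^bsub>powser R\<^esub> g \<otimes>\<^bsub>powser R\<^esub> h) n"
      using c by (simp add: powser_mult powser_add finsum_addf Pi_def)
    finally show "((f \<oplus>\<^bsub>powser R\<^esub> g) \<otimes>\<^bsub>powser R\<^esub> h) n =
        (f \<otimes>\<^bsub>powser R\<^esub> h \<oplus>\<^bsub>powser R\<^esub> g \<otimes>\<^bsub>powser R\<^esub> h) n" .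
  qed
qed

lemma powser_a_inv:
  assumes "f \<in> carrier (powser R)"
  shows "(\<ominus>\<^bsub>powser R\<^esub> f) n = \<ominus> f n"
proof -
  interpret P: cring "powser R" by (rule powser_cring)
  have "f n \<oplus> (\<ominus>\<^bsub>powser R\<^esub> f) n = \<zero>"
    using P.r_neg[OF assms] by (metis powser_add powser_zero)
  moreover have "f n \<in> carrier R" "(\<ominus>\<^bsub>powser R\<^esub> f) n \<in> carrier R"
    using assms P.a_inv_closed[OF assms] by (auto simp: powser_carrier)
  ultimately show ?thesis
    by (metis a_comm minus_equality)
qed

end

section \<open>Series in two variables over a field, handled row by row\<close>

locale field_powser = field F for F :: "('a, 'm) ring_scheme" (structure)
begin

abbreviation P where "P \<equiv> powser F"
abbreviation A where "A \<equiv> powser2 F"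

definition ypow :: "nat \<Rightarrow> nat \<Rightarrow> 'a" where
  "ypow n = (\<lambda>j. if j = n then \<one> else \<zero>)"

text \<open>Division by y^n with the low coefficients discarded. This keeps it additive and defined
  on all series, not only on the multiples of y^n.\<close>

definition shift :: "nat \<Rightarrow> (nat \<Rightarrow> 'a) \<Rightarrow> nat \<Rightarrow> 'a" where
  "shift n f = (\<lambda>j. f (n + j))"

definition cst :: "'a \<Rightarrow> nat \<Rightarrow> nat \<Rightarrow> 'a" where
  "cst c = (\<lambda>i j. if i = 0 \<and> j = 0 then c else \<zero>)"

definition y_series :: "(nat \<Rightarrow> 'a) \<Rightarrow> nat \<Rightarrow> nat \<Rightarrow> 'a" where
  "y_series p = (\<lambda>i. if i = 0 then p else \<zero>\<^bsub>P\<^esub>)"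

end

sublocale field_powser \<subseteq> P: cring "powser F"
  by (rule powser_cring)

sublocale field_powser \<subseteq> A: cring "powser2 F"
  unfolding powser2_def by (rule P.powser_cring)

context field_powser
begin

lemma ypow_closed [simp]: "ypow n \<in> carrier P"
  by (simp add: ypow_def powser_carrier)

lemma shift_closed [simp]: "f \<in> carrier P \<Longrightarrow> shift n f \<in> carrier P"
  by (simp add: shift_def powser_carrier)

lemma ypow_mult:
  assumes "f \<in> carrier P"
  shows "(ypow n \<otimes>\<^bsub>P\<^esub> f) j = (if j < n then \<zero> else f (j - n))"
proof -
  have f: "f i \<in> carrier F" for i using assms by (simp add: powser_carrier)
  have "(ypow n \<otimes>\<^bsub>P\<^esub> f) j = (\<Oplus>k\<in>{..j}. if n = k then f (j - k) else \<zero>)"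
    using f by (auto simp: powser_mult ypow_def intro!: finsum_cong')
  also have "\<dots> = (if j < n then \<zero> else f (j - n))"
  proof (cases "j < n")
    case True
    then show ?thesis by (auto intro!: add.finprod_one_eqI)
  next
    case False
    then show ?thesis using f by (simp add: finsum_singleton)
  qed
  finally show ?thesis .
qed

lemma ypow_add: "ypow m \<otimes>\<^bsub>P\<^esub> ypow n = ypow (m + n)"
  by (auto simp: fun_eq_iff ypow_mult) (auto simp: ypow_def)

lemma ypow_0: "ypow 0 = \<one>\<^bsub>P\<^esub>"
  by (auto simp: fun_eq_iff ypow_def powser_one)

lemma shift_ypow [simp]: "f \<in> carrier P \<Longrightarrow> shift n (ypow n \<otimes>\<^bsub>P\<^esub> f) = f"
  by (simp add: fun_eq_iff shift_def ypow_mult)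

lemma ypow_shift: "\<lbrakk>f \<in> carrier P; \<And>j. j < n \<Longrightarrow> f j = \<zero>\<rbrakk> \<Longrightarrow> ypow n \<otimes>\<^bsub>P\<^esub> shift n f = f"
  by (auto simp: fun_eq_iff ypow_mult) (auto simp: shift_def)

lemma powser_mult_0:
  "\<lbrakk>f \<in> carrier P; h \<in> carrier P\<rbrakk> \<Longrightarrow> (f \<otimes>\<^bsub>P\<^esub> h) 0 = f 0 \<otimes> h 0"
  by (simp add: powser_mult powser_carrier)

lemma P_carrierD [simp, dest]: "f \<in> carrier P \<Longrightarrow> f j \<in> carrier F"
  by (simp add: powser_carrier)

lemma A_carrier: "f \<in> carrier A \<longleftrightarrow> (\<forall>i j. f i j \<in> carrier F)"
  by (simp add: powser2_def powser_carrier)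

lemma A_carrier_P: "f \<in> carrier A \<longleftrightarrow> (\<forall>i. f i \<in> carrier P)"
  by (simp add: powser2_def powser_carrier)

lemma A_carrierD [simp, dest]: "f \<in> carrier A \<Longrightarrow> f i j \<in> carrier F"
  by (simp add: A_carrier)

lemma A_carrierDP [simp, dest]: "f \<in> carrier A \<Longrightarrow> f i \<in> carrier P"
  by (simp add: A_carrier_P)

lemma A_zero: "\<zero>\<^bsub>A\<^esub> = (\<lambda>i j. \<zero>)" "\<zero>\<^bsub>A\<^esub> i = \<zero>\<^bsub>P\<^esub>"
  by (simp_all add: powser2_def powser_zero fun_eq_iff)

lemma A_add: "(f \<oplus>\<^bsub>A\<^esub> h) i = f i \<oplus>\<^bsub>P\<^esub> h i"
  by (simp add: powser2_def powser_add)

lemma A_a_inv: "f \<in> carrier A \<Longrightarrow> (\<ominus>\<^bsub>A\<^esub> f) i = \<ominus>\<^bsub>P\<^esub> f i"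
  unfolding powser2_def by (rule P.powser_a_inv)

lemma A_minus: "f \<in> carrier A \<Longrightarrow> h \<in> carrier A \<Longrightarrow> (f \<ominus>\<^bsub>A\<^esub> h) i = f i \<ominus>\<^bsub>P\<^esub> h i"
  by (simp add: a_minus_def A_add A_a_inv)

lemma P_minus: "f \<in> carrier P \<Longrightarrow> h \<in> carrier P \<Longrightarrow> (f \<ominus>\<^bsub>P\<^esub> h) i = f i \<ominus> h i"
  by (simp add: a_minus_def powser_add powser_a_inv)

lemma A_mult_0:
  "\<lbrakk>f \<in> carrier A; h \<in> carrier A\<rbrakk> \<Longrightarrow> (f \<otimes>\<^bsub>A\<^esub> h) 0 = f 0 \<otimes>\<^bsub>P\<^esub> h 0"
  by (simp add: powser2_def powser_carrier[of _ "powser F"] powser_mult[of "powser F"])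

lemma A_mult_1:
  "\<lbrakk>f \<in> carrier A; h \<in> carrier A\<rbrakk> \<Longrightarrow>
    (f \<otimes>\<^bsub>A\<^esub> h) (Suc 0) = f 0 \<otimes>\<^bsub>P\<^esub> h (Suc 0) \<oplus>\<^bsub>P\<^esub> f (Suc 0) \<otimes>\<^bsub>P\<^esub> h 0"
  by (simp add: powser2_def powser_carrier[of _ "powser F"] powser_mult[of "powser F"] Pi_def P.a_comm)

lemma A_mult_2:
  "\<lbrakk>f \<in> carrier A; h \<in> carrier A\<rbrakk> \<Longrightarrow>
    (f \<otimes>\<^bsub>A\<^esub> h) 2 = f 0 \<otimes>\<^bsub>P\<^esub> h 2 \<oplus>\<^bsub>P\<^esub> f 1 \<otimes>\<^bsub>P\<^esub> h 1 \<oplus>\<^bsub>P\<^esub> f 2 \<otimes>\<^bsub>P\<^esub> h 0"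
  by (simp add: powser2_def powser_carrier[of _ "powser F"] powser_mult[of "powser F"] Pi_def P.a_ac
      numeral_2_eq_2)

lemma cst_closed [simp]: "c \<in> carrier F \<Longrightarrow> cst c \<in> carrier A"
  by (simp add: cst_def A_carrier)

lemma y_series_closed [simp]: "p \<in> carrier P \<Longrightarrow> y_series p \<in> carrier A"
  by (simp add: y_series_def A_carrier_P)

lemma xy_mon_closed [simp]: "xy_mon F i j \<in> carrier A"
  by (simp add: xy_mon_def A_carrier)

lemma y_series_mult:
  assumes "p \<in> carrier P" "f \<in> carrier A"
  shows "(y_series p \<otimes>\<^bsub>A\<^esub> f) i = p \<otimes>\<^bsub>P\<^esub> f i"
proof -
  have "(y_series p \<otimes>\<^bsub>A\<^esub> f) i = (\<Oplus>\<^bsub>P\<^esub>k\<in>{..i}. if 0 = k then p \<otimes>\<^bsub>P\<^esub> f (i - k) else \<zero>\<^bsub>P\<^esub>)"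
    using assms by (auto simp: powser2_def powser_mult[of "powser F"] y_series_def intro!: P.finsum_cong')
  also have "\<dots> = p \<otimes>\<^bsub>P\<^esub> f i"
    using assms by (subst P.finsum_singleton) auto
  finally show ?thesis .
qed

lemma cst_mult:
  assumes "c \<in> carrier F" "f \<in> carrier A"
  shows "(cst c \<otimes>\<^bsub>A\<^esub> f) i j = c \<otimes> f i j"
proof -
  let ?c = "\<lambda>j. if j = 0 then c else \<zero>"
  have c: "?c \<in> carrier P" using assms by (simp add: powser_carrier)
  have "(?c \<otimes>\<^bsub>P\<^esub> f i) j = (\<Oplus>k\<in>{..j}. if 0 = k then c \<otimes> f i (j - k) else \<zero>)"
    using assms by (auto simp: powser_mult intro!: finsum_cong')
  also have "\<dots> = c \<otimes> f i j"
    using assms by (subst finsum_singleton) auto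
  finally have "(?c \<otimes>\<^bsub>P\<^esub> f i) j = c \<otimes> f i j" .
  moreover have "cst c = y_series ?c" by (auto simp: cst_def y_series_def fun_eq_iff powser_zero)
  ultimately show ?thesis using c assms by (simp add: y_series_mult)
qed

lemma xy_mon_mult:
  assumes "f \<in> carrier A"
  shows "(xy_mon F i j \<otimes>\<^bsub>A\<^esub> f) k = (if k < i then \<zero>\<^bsub>P\<^esub> else ypow j \<otimes>\<^bsub>P\<^esub> f (k - i))"
proof -
  have x: "xy_mon F i j = (\<lambda>k. if k = i then ypow j else \<zero>\<^bsub>P\<^esub>)"
    by (auto simp: xy_mon_def ypow_def fun_eq_iff powser_zero)
  have "(xy_mon F i j \<otimes>\<^bsub>A\<^esub> f) k =
      (\<Oplus>\<^bsub>P\<^esub>l\<in>{..k}. if i = l then ypow j \<otimes>\<^bsub>P\<^esub> f (k - l) else \<zero>\<^bsub>P\<^esub>)"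
    using assms unfolding x
    by (auto simp: powser2_def powser_mult[of "powser F"] intro!: P.finsum_cong')
  also have "\<dots> = (if k < i then \<zero>\<^bsub>P\<^esub> else ypow j \<otimes>\<^bsub>P\<^esub> f (k - i))"
  proof (cases "k < i")
    case True
    then show ?thesis by (auto intro!: P.add.finprod_one_eqI)
  next
    case False
    then show ?thesis using assms by (subst P.finsum_singleton) auto
  qed
  finally show ?thesis .
qed

lemma xy_mon_mult_coeff:
  assumes "f \<in> carrier A"
  shows "(xy_mon F i j \<otimes>\<^bsub>A\<^esub> f) k l = (if k < i \<or> l < j then \<zero> else f (k - i) (l - j))"
  using assms by (simp add: xy_mon_mult ypow_mult powser_zero)

lemma xy_mon_mult_xy_mon: "xy_mon F i j \<otimes>\<^bsub>A\<^esub> xy_mon F k l = xy_mon F (i + k) (j + l)"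
  by (auto simp: fun_eq_iff xy_mon_mult_coeff) (auto simp: xy_mon_def)

lemma constants_eq: "constants F = cst ` carrier F"
  unfolding constants_def cst_def by auto

lemma cst_ring_hom: "cst \<in> ring_hom F A"
proof (rule ring_hom_memI)
  fix c d assume "c \<in> carrier F" "d \<in> carrier F"
  then show "cst (c \<otimes> d) = cst c \<otimes>\<^bsub>A\<^esub> cst d"
    by (auto simp: fun_eq_iff cst_mult) (auto simp: cst_def)
next
  fix c d assume "c \<in> carrier F" "d \<in> carrier F"
  then show "cst (c \<oplus> d) = cst c \<oplus>\<^bsub>A\<^esub> cst d"
    by (auto simp: fun_eq_iff A_add powser_add cst_def)
next
  show "cst \<one> = \<one>\<^bsub>A\<^esub>"
    by (auto simp: fun_eq_iff powser2_def powser_one powser_zero cst_def)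
qed simp

lemma constants_subfield: "subfield (constants F) A"
proof -
  interpret ring_hom_ring F A cst
    by (rule ring_hom_ringI2) (auto simp: ring_axioms A.ring_axioms cst_ring_hom)
  have "\<one>\<^bsub>A\<^esub> \<noteq> \<zero>\<^bsub>A\<^esub>"
    by (auto simp: fun_eq_iff powser2_def powser_one powser_zero)
  then show ?thesis
    unfolding constants_eq using img_is_subfield[OF carrier_is_subfield] by simp
qed

end

context field_powser
begin

lemma A_idealI:
  assumes "I \<subseteq> carrier A" "\<zero>\<^bsub>A\<^esub> \<in> I"
    and "\<And>f h. \<lbrakk>f \<in> I; h \<in> I\<rbrakk> \<Longrightarrow> f \<oplus>\<^bsub>A\<^esub> h \<in> I"
    and "\<And>f h. \<lbrakk>f \<in> I; h \<in> carrier A\<rbrakk> \<Longrightarrow> h \<otimes>\<^bsub>A\<^esub> f \<in> I"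
  shows "ideal I A"
proof (rule idealI)
  show "subgroup I (add_monoid A)"
  proof (rule A.add.subgroupI)
    fix f assume f: "f \<in> I"
    then have "\<ominus>\<^bsub>A\<^esub> f = (\<ominus>\<^bsub>A\<^esub> \<one>\<^bsub>A\<^esub>) \<otimes>\<^bsub>A\<^esub> f"
      using assms(1) by (simp add: A.l_minus subset_iff)
    then show "\<ominus>\<^bsub>A\<^esub> f \<in> I"
      using assms(4)[OF f, of "\<ominus>\<^bsub>A\<^esub> \<one>\<^bsub>A\<^esub>"] by simp
  qed (use assms in auto)
  show "f \<otimes>\<^bsub>A\<^esub> h \<in> I" if "f \<in> I" "h \<in> carrier A" for f h
    using that assms(1) assms(4)[OF that] by (subst A.m_comm) auto
qed (use assms A.ring_axioms in auto)

lemma A_idealD: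
  assumes "ideal I A"
  shows "f \<in> I \<Longrightarrow> f \<in> carrier A" "\<zero>\<^bsub>A\<^esub> \<in> I"
    "\<lbrakk>f \<in> I; h \<in> I\<rbrakk> \<Longrightarrow> f \<oplus>\<^bsub>A\<^esub> h \<in> I" "\<lbrakk>f \<in> I; h \<in> I\<rbrakk> \<Longrightarrow> f \<ominus>\<^bsub>A\<^esub> h \<in> I"
    "\<lbrakk>f \<in> I; h \<in> carrier A\<rbrakk> \<Longrightarrow> h \<otimes>\<^bsub>A\<^esub> f \<in> I" "\<lbrakk>f \<in> I; h \<in> carrier A\<rbrakk> \<Longrightarrow> f \<otimes>\<^bsub>A\<^esub> h \<in> I"
proof -
  interpret I: ideal I A by fact
  show "f \<in> I \<Longrightarrow> f \<in> carrier A" "\<zero>\<^bsub>A\<^esub> \<in> I"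
    "\<lbrakk>f \<in> I; h \<in> I\<rbrakk> \<Longrightarrow> f \<oplus>\<^bsub>A\<^esub> h \<in> I" "\<lbrakk>f \<in> I; h \<in> I\<rbrakk> \<Longrightarrow> f \<ominus>\<^bsub>A\<^esub> h \<in> I"
    "\<lbrakk>f \<in> I; h \<in> carrier A\<rbrakk> \<Longrightarrow> h \<otimes>\<^bsub>A\<^esub> f \<in> I" "\<lbrakk>f \<in> I; h \<in> carrier A\<rbrakk> \<Longrightarrow> f \<otimes>\<^bsub>A\<^esub> h \<in> I"
    by (auto simp: I.I_l_closed I.I_r_closed a_minus_def)
qed

subsection \<open>Dimensions of quotients\<close>

definition linear_functional :: "((nat \<Rightarrow> nat \<Rightarrow> 'a) \<Rightarrow> 'a) \<Rightarrow> bool" where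
  "linear_functional \<phi> \<longleftrightarrow> (\<forall>f\<in>carrier A. \<phi> f \<in> carrier F) \<and>
     (\<forall>f\<in>carrier A. \<forall>h\<in>carrier A. \<phi> (f \<oplus>\<^bsub>A\<^esub> h) = \<phi> f \<oplus> \<phi> h) \<and>
     (\<forall>c\<in>carrier F. \<forall>f\<in>carrier A. \<phi> (cst c \<otimes>\<^bsub>A\<^esub> f) = c \<otimes> \<phi> f)"

lemma linear_functional_minus:
  assumes "linear_functional \<phi>" "f \<in> carrier A" "h \<in> carrier A"
  shows "\<phi> (f \<ominus>\<^bsub>A\<^esub> h) = \<phi> f \<ominus> \<phi> h"
proof -
  have "\<phi> f = \<phi> (f \<ominus>\<^bsub>A\<^esub> h \<oplus>\<^bsub>A\<^esub> h)"
    using assms(2,3) by (simp add: a_minus_def A.a_assoc A.l_neg)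
  also have "\<dots> = \<phi> (f \<ominus>\<^bsub>A\<^esub> h) \<oplus> \<phi> h"
    using assms by (simp add: linear_functional_def)
  finally have e: "\<phi> f = \<phi> (f \<ominus>\<^bsub>A\<^esub> h) \<oplus> \<phi> h" .
  have "\<phi> (f \<ominus>\<^bsub>A\<^esub> h) \<in> carrier F" "\<phi> h \<in> carrier F"
    using assms by (auto simp: linear_functional_def)
  then have "\<phi> (f \<ominus>\<^bsub>A\<^esub> h) = (\<phi> (f \<ominus>\<^bsub>A\<^esub> h) \<oplus> \<phi> h) \<ominus> \<phi> h"
    by algebra
  then show ?thesis by (simp only: e[symmetric])
qed

text \<open>Relational form of \<open>quot_dim\<close>: the inductive predicate can be built up one
  dimension at a time, whereas \<open>quot_dim\<close> is a definite description that is evaluated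
  only at the end.\<close>

definition qdim :: "(nat \<Rightarrow> nat \<Rightarrow> 'a) set \<Rightarrow> nat \<Rightarrow> (nat \<Rightarrow> nat \<Rightarrow> 'a) set \<Rightarrow> bool" where
  "qdim J n V \<longleftrightarrow> ring.dimension (A Quot J) n ((\<lambda>f. J +>\<^bsub>A\<^esub> f) ` constants F) ((\<lambda>f. J +>\<^bsub>A\<^esub> f) ` V)"

definition is_subspace :: "(nat \<Rightarrow> nat \<Rightarrow> 'a) set \<Rightarrow> bool" where
  "is_subspace V \<longleftrightarrow> V \<subseteq> carrier A \<and> (\<forall>f\<in>V. \<forall>h\<in>V. f \<oplus>\<^bsub>A\<^esub> h \<in> V) \<and>
     (\<forall>c\<in>carrier F. \<forall>f\<in>V. cst c \<otimes>\<^bsub>A\<^esub> f \<in> V)"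

lemma is_subspace_ideal: "ideal I A \<Longrightarrow> is_subspace I"
  using A_idealD[of I] by (auto simp: is_subspace_def)

lemma is_subspace_ker:
  "\<lbrakk>is_subspace V; linear_functional \<phi>\<rbrakk> \<Longrightarrow> is_subspace {f \<in> V. \<phi> f = \<zero>}"
  by (auto simp: is_subspace_def linear_functional_def subset_iff)

lemma qdim_0:
  assumes "ideal J A"
  shows "qdim J 0 J"
proof -
  interpret J: ideal J A by fact
  interpret Q: ring "A Quot J" by (rule J.quotient_is_ring)
  have "J \<noteq> {}"
    using J.zero_closed by blast
  then have "(\<lambda>f. J +>\<^bsub>A\<^esub> f) ` J = {\<zero>\<^bsub>A Quot J\<^esub>}"
    by (auto simp: J.a_rcos_const FactRing_def)
  then show ?thesis unfolding qdim_def by simp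
qed

text \<open>Every f in V is the multiple of w by \<phi>(f) plus an element of the kernel of \<phi>,
  so V is a line extension of that kernel. The class of w is new because \<phi> vanishes on J and is
  therefore constant on cosets of J.\<close>

lemma qdim_Suc:
  assumes J: "ideal J A" and V: "is_subspace V" and \<phi>: "linear_functional \<phi>"
    and w: "w \<in> V" "\<phi> w = \<one>" and W: "qdim J n {f \<in> V. \<phi> f = \<zero>}"
    and JW: "J \<subseteq> {f \<in> V. \<phi> f = \<zero>}"
  shows "qdim J (Suc n) V"
proof -
  interpret J: ideal J A by fact
  interpret Q: ring "A Quot J" by (rule J.quotient_is_ring)
  interpret h: ring_hom_ring A "A Quot J" "(+>\<^bsub>A\<^esub>) J" by (rule J.rcos_ring_hom_ring)
  let ?h = "\<lambda>f. J +>\<^bsub>A\<^esub> f" and ?W = "{f \<in> V. \<phi> f = \<zero>}"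
  have VA: "\<And>f. f \<in> V \<Longrightarrow> f \<in> carrier A" using V by (auto simp: is_subspace_def)
  have "?h w \<notin> ?h ` ?W"
  proof
    assume "?h w \<in> ?h ` ?W"
    then obtain f where f: "f \<in> V" "\<phi> f = \<zero>" "?h w = ?h f" by auto
    then have "w \<in> ?h f" using J.a_rcos_self[OF VA[OF w(1)]] by simp
    then obtain j where "j \<in> J" "w = j \<oplus>\<^bsub>A\<^esub> f" by (auto simp: a_r_coset_def r_coset_def)
    then have "\<phi> w = \<zero>" using JW f \<phi> VA by (auto simp: linear_functional_def)
    then show False using w by simp
  qed
  then have "Q.dimension (Suc n) (?h ` constants F)
      (Q.line_extension (?h ` constants F) (?h w) (?h ` ?W))"
    using W w VA unfolding qdim_def by (intro Q.Suc_dim) auto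
  moreover have "Q.line_extension (?h ` constants F) (?h w) (?h ` ?W) = ?h ` V"
  proof (intro equalityI subsetI)
    fix x assume "x \<in> Q.line_extension (?h ` constants F) (?h w) (?h ` ?W)"
    then obtain c f where c: "c \<in> carrier F" and f: "f \<in> V"
      and x: "x = ?h (cst c) \<otimes>\<^bsub>A Quot J\<^esub> ?h w \<oplus>\<^bsub>A Quot J\<^esub> ?h f"
      unfolding Q.line_extension_mem_iff constants_eq by auto
    have "x = ?h (cst c \<otimes>\<^bsub>A\<^esub> w \<oplus>\<^bsub>A\<^esub> f)"
      using c f w VA x by simp
    moreover have "cst c \<otimes>\<^bsub>A\<^esub> w \<oplus>\<^bsub>A\<^esub> f \<in> V"
      using V w f c by (auto simp: is_subspace_def)
    ultimately show "x \<in> ?h ` V" by auto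
  next
    fix x assume "x \<in> ?h ` V"
    then obtain f where f: "f \<in> V" "x = ?h f" by auto
    let ?c = "\<phi> f" and ?f = "cst (\<ominus> \<phi> f) \<otimes>\<^bsub>A\<^esub> w \<oplus>\<^bsub>A\<^esub> f"
    have c: "?c \<in> carrier F" using \<phi> f VA by (auto simp: linear_functional_def)
    have "?f \<in> ?W"
      using V w f c \<phi> VA by (auto simp: is_subspace_def linear_functional_def l_neg)
    moreover have "f = cst ?c \<otimes>\<^bsub>A\<^esub> w \<oplus>\<^bsub>A\<^esub> ?f"
      using c w(1) f(1) VA
      by (auto simp: fun_eq_iff A_add powser_add cst_mult l_minus a_assoc[symmetric] r_neg)
    then have "x = ?h (cst ?c) \<otimes>\<^bsub>A Quot J\<^esub> ?h w \<oplus>\<^bsub>A Quot J\<^esub> ?h ?f"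
      using c w(1) f VA by (metis A.m_closed A.a_closed cst_closed a_inv_closed h.hom_add h.hom_mult)
    ultimately show "x \<in> Q.line_extension (?h ` constants F) (?h w) (?h ` ?W)"
      unfolding Q.line_extension_mem_iff constants_eq using c by blast
  qed
  ultimately show ?thesis by (simp add: qdim_def)
qed

text \<open>Properness of J keeps 1 and 0 apart in the quotient. Hence the image of the constants is
  a field there, over which the dimension is unique.\<close>

lemma quot_dim_eq:
  assumes J: "ideal J A" and "J \<noteq> carrier A" and d: "qdim J n V"
  shows "quot_dim F V J = n"
proof -
  interpret J: ideal J A by fact
  have quot: "\<one>\<^bsub>A Quot J\<^esub> = J +>\<^bsub>A\<^esub> \<one>\<^bsub>A\<^esub>" "\<zero>\<^bsub>A Quot J\<^esub> = J"
    by (simp_all add: FactRing_def)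
  interpret Q: ring "A Quot J" by (rule J.quotient_is_ring)
  interpret h: ring_hom_ring A "A Quot J" "(+>\<^bsub>A\<^esub>) J" by (rule J.rcos_ring_hom_ring)
  have "\<one>\<^bsub>A Quot J\<^esub> \<noteq> \<zero>\<^bsub>A Quot J\<^esub>"
  proof
    assume "\<one>\<^bsub>A Quot J\<^esub> = \<zero>\<^bsub>A Quot J\<^esub>"
    then have "J +>\<^bsub>A\<^esub> \<one>\<^bsub>A\<^esub> = J" by (simp only: quot)
    then have "\<one>\<^bsub>A\<^esub> \<in> J" using J.rcos_const_imp_mem by blast
    then show False using assms(2) J.one_imp_carrier by blast
  qed
  from h.img_is_subfield(2)[OF constants_subfield this]
  show ?thesis
    using Q.dimI[of _ n] d unfolding quot_dim_def qdim_def over_def by simp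
qed

text \<open>Modulo the whole ring the image of the constants is not a field, so uniqueness of the
  dimension needs another reason: a line extension requires a vector outside the space reached so
  far, and the zero ring has none.\<close>

lemma ideal_deg_carrier: "ideal_deg F (carrier A) = 0"
proof -
  have J: "ideal (carrier A) A" by (rule A.oneideal)
  interpret J: ideal "carrier A" A by fact
  interpret Q: ring "A Quot carrier A" by (rule J.quotient_is_ring)
  let ?K = "(\<lambda>f. carrier A +>\<^bsub>A\<^esub> f) ` constants F"
  have z: "carrier (A Quot carrier A) = {\<zero>\<^bsub>A Quot carrier A\<^esub>}"
  proof -
    have "carrier (A Quot carrier A) = (\<lambda>f. carrier A +>\<^bsub>A\<^esub> f) ` carrier A"
      by (auto simp: FactRing_def A_RCOSETS_def')
    also have "\<dots> = {carrier A}"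
      using A.zero_closed by (auto simp: J.a_rcos_const simp del: A.zero_closed)
    finally show ?thesis by (simp add: FactRing_def)
  qed
  have "n = 0 \<and> E = {\<zero>\<^bsub>A Quot carrier A\<^esub>}" if "Q.dimension n ?K E" for n E
    using that by (induction n ?K E rule: Q.dimension.induct) (auto simp: z)
  moreover have "Q.dimension 0 ?K ((\<lambda>f. carrier A +>\<^bsub>A\<^esub> f) ` carrier A)"
    using qdim_0[OF J] by (simp add: qdim_def)
  ultimately have "Q.dim ?K ((\<lambda>f. carrier A +>\<^bsub>A\<^esub> f) ` carrier A) = 0"
    unfolding Q.dim_def by (intro the_equality) auto
  then show ?thesis by (simp add: ideal_deg_def quot_dim_def)
qed

subsection \<open>Monomial ideals\<close>

lemma P_finsum_coeff:
  assumes "finite S" "\<And>k. k \<in> S \<Longrightarrow> p k \<in> carrier P"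
  shows "(\<Oplus>\<^bsub>P\<^esub>k\<in>S. p k) j = (\<Oplus>k\<in>S. p k j)"
  using assms by (induction S rule: finite_induct) (auto simp: powser_zero powser_add Pi_def)

lemma A_mult_coeff_zero:
  assumes "f \<in> carrier A" "h \<in> carrier A"
    and "\<And>k l. \<lbrakk>k \<le> i; l \<le> j\<rbrakk> \<Longrightarrow> f k l = \<zero> \<or> h (i - k) (j - l) = \<zero>"
  shows "(f \<otimes>\<^bsub>A\<^esub> h) i j = \<zero>"
proof -
  have "(f k \<otimes>\<^bsub>P\<^esub> h (i - k)) j = \<zero>" if "k \<le> i" for k
    unfolding powser_mult
  proof (intro add.finprod_one_eqI)
    fix l assume "l \<in> {..j}"
    then show "f k l \<otimes> h (i - k) (j - l) = \<zero>"
      using assms(1,2) assms(3)[OF that, of l] by auto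
  qed
  moreover have "(f \<otimes>\<^bsub>A\<^esub> h) i j = (\<Oplus>k\<in>{..i}. (f k \<otimes>\<^bsub>P\<^esub> h (i - k)) j)"
    using assms by (simp add: powser2_def powser_mult[of "powser F"] P_finsum_coeff
        powser_carrier[of _ "powser F"])
  ultimately show ?thesis by (auto intro!: add.finprod_one_eqI)
qed

definition up_closed :: "(nat \<times> nat) set \<Rightarrow> bool" where
  "up_closed L \<longleftrightarrow> (\<forall>i j k l. (i, j) \<in> L \<and> i \<le> k \<and> j \<le> l \<longrightarrow> (k, l) \<in> L)"

definition supported_on :: "(nat \<times> nat) set \<Rightarrow> (nat \<Rightarrow> nat \<Rightarrow> 'a) set" where
  "supported_on L = {f \<in> carrier A. \<forall>i j. f i j \<noteq> \<zero> \<longrightarrow> (i, j) \<in> L}"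

lemma xy_mon_supported: "xy_mon F i j \<in> supported_on L \<longleftrightarrow> (i, j) \<in> L"
  by (auto simp: supported_on_def) (auto simp: xy_mon_def split: if_splits)

lemma supported_on_ideal:
  assumes "up_closed L"
  shows "ideal (supported_on L) A"
proof (rule A_idealI)
  fix f h assume f: "f \<in> supported_on L" and h: "h \<in> carrier A"
  have "(h \<otimes>\<^bsub>A\<^esub> f) i j = \<zero>" if "(i, j) \<notin> L" for i j
    using f h that assms
    by (intro A_mult_coeff_zero) (auto simp: supported_on_def up_closed_def, metis diff_le_self)
  then show "h \<otimes>\<^bsub>A\<^esub> f \<in> supported_on L"
    using f h by (auto simp: supported_on_def)
next
  fix f h assume f: "f \<in> supported_on L" and h: "h \<in> supported_on L"
  have "(f \<oplus>\<^bsub>A\<^esub> h) i j = \<zero>" if "(i, j) \<notin> L" for i j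
  proof -
    have "f i j = \<zero>" "h i j = \<zero>" using f h that by (auto simp: supported_on_def)
    then show ?thesis by (simp add: A_add powser_add)
  qed
  then show "f \<oplus>\<^bsub>A\<^esub> h \<in> supported_on L"
    using f h by (auto simp: supported_on_def)
qed (auto simp: supported_on_def A_zero(1)[THEN fun_cong, THEN fun_cong])

lemma mem_boxes2: "(i, j) \<in> boxes [v, u] \<longleftrightarrow> i = 0 \<and> j < v \<or> i = 1 \<and> j < u"
  by (auto simp: boxes_def less_Suc_eq numeral_2_eq_2)

lemma up_closed_boxes: "u \<le> v \<Longrightarrow> up_closed (- boxes [v, u])"
  by (auto simp: up_closed_def mem_boxes2)

lemma y_series_app: "y_series p i = (if i = 0 then p else \<zero>\<^bsub>P\<^esub>)"
  by (simp add: y_series_def)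

lemma split_two_rows:
  assumes "f \<in> carrier A"
  shows "f = xy_mon F 2 0 \<otimes>\<^bsub>A\<^esub> (\<lambda>i. f (i + 2)) \<oplus>\<^bsub>A\<^esub> (xy_mon F 1 0 \<otimes>\<^bsub>A\<^esub> y_series (f 1) \<oplus>\<^bsub>A\<^esub> y_series (f 0))"
proof -
  have s: "(\<lambda>i. f (i + 2)) \<in> carrier A" using assms unfolding A_carrier by blast
  show ?thesis
  proof
    fix i :: nat
    consider "i = 0" | "i = Suc 0" | k where "i = Suc (Suc k)" by (metis not0_implies_Suc)
    then show "f i = (xy_mon F 2 0 \<otimes>\<^bsub>A\<^esub> (\<lambda>i. f (i + 2)) \<oplus>\<^bsub>A\<^esub>
        (xy_mon F 1 0 \<otimes>\<^bsub>A\<^esub> y_series (f 1) \<oplus>\<^bsub>A\<^esub> y_series (f 0))) i"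
      using assms s by cases (simp_all add: A_add xy_mon_mult ypow_0 y_series_app)
  qed
qed

lemma y_series_eq_ypow_mult:
  assumes "p \<in> carrier P" "\<And>j. j < n \<Longrightarrow> p j = \<zero>"
  shows "y_series p = y_series (shift n p) \<otimes>\<^bsub>A\<^esub> xy_mon F 0 n"
proof -
  have "y_series (shift n p) \<otimes>\<^bsub>A\<^esub> xy_mon F 0 n = xy_mon F 0 n \<otimes>\<^bsub>A\<^esub> y_series (shift n p)"
    using assms by (simp add: A.m_comm)
  also have "\<dots> = y_series p"
  proof
    fix i
    show "(xy_mon F 0 n \<otimes>\<^bsub>A\<^esub> y_series (shift n p)) i = y_series p i"
      using assms by (simp add: xy_mon_mult y_series_app ypow_shift)
  qed
  finally show ?thesis by simp
qed

text \<open>A series is an infinite sum of monomials, while generation of ideals allows finite sums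
  only. The terms are therefore collected into one multiple each of x^2, x y^u and y^v.\<close>

lemma diagram_ideal_eq:
  assumes "u \<le> v"
  shows "diagram_ideal F [v, u] = supported_on (- boxes [v, u])"
proof (rule equalityI)
  let ?S = "{xy_mon F i j | i j. (i, j) \<notin> boxes [v, u]}"
  have S: "?S \<subseteq> carrier A" by auto
  show "diagram_ideal F [v, u] \<subseteq> supported_on (- boxes [v, u])"
    unfolding diagram_ideal_def using supported_on_ideal[OF up_closed_boxes[OF assms]]
    by (rule A.genideal_minimal) (auto simp: xy_mon_supported)
  have I: "ideal (diagram_ideal F [v, u]) A"
    unfolding diagram_ideal_def using S by (rule A.genideal_ideal)
  note D = A_idealD[OF I]
  have mon: "xy_mon F i j \<in> diagram_ideal F [v, u]" if "(i, j) \<notin> boxes [v, u]" for i j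
    unfolding diagram_ideal_def using A.genideal_self[OF S] that by auto
  show "supported_on (- boxes [v, u]) \<subseteq> diagram_ideal F [v, u]"
  proof
    fix f assume "f \<in> supported_on (- boxes [v, u])"
    then have f: "f \<in> carrier A" and z: "\<And>i j. (i, j) \<in> boxes [v, u] \<Longrightarrow> f i j = \<zero>"
      by (auto simp: supported_on_def)
    have s: "(\<lambda>i. f (i + 2)) \<in> carrier A" using f unfolding A_carrier by blast
    have "y_series (f 1) = y_series (shift u (f 1)) \<otimes>\<^bsub>A\<^esub> xy_mon F 0 u" "y_series (f 0) = y_series (shift v (f 0)) \<otimes>\<^bsub>A\<^esub> xy_mon F 0 v"
      using f z by (auto intro!: y_series_eq_ypow_mult simp: mem_boxes2)
    then have "f = xy_mon F 2 0 \<otimes>\<^bsub>A\<^esub> (\<lambda>i. f (i + 2)) \<oplus>\<^bsub>A\<^esub>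
        (xy_mon F 1 0 \<otimes>\<^bsub>A\<^esub> (y_series (shift u (f 1)) \<otimes>\<^bsub>A\<^esub> xy_mon F 0 u) \<oplus>\<^bsub>A\<^esub> y_series (shift v (f 0)) \<otimes>\<^bsub>A\<^esub> xy_mon F 0 v)"
      using split_two_rows[OF f] by simp
    also have "xy_mon F 1 0 \<otimes>\<^bsub>A\<^esub> (y_series (shift u (f 1)) \<otimes>\<^bsub>A\<^esub> xy_mon F 0 u) = y_series (shift u (f 1)) \<otimes>\<^bsub>A\<^esub> xy_mon F 1 u"
      using f xy_mon_mult_xy_mon[of 1 0 0 u] A.m_lcomm[of "xy_mon F 1 0" "y_series (shift u (f 1))" "xy_mon F 0 u"] by simp
    finally show "f \<in> diagram_ideal F [v, u]"
      by (metis (no_types, lifting) D(3,5,6) mon mem_boxes2 s f A_carrierDP y_series_closed shift_closed less_irrefl one_neq_zero zero_neq_numeral numeral_eq_one_iff num.distinct(1))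
  qed
qed

subsection \<open>Leading exponents\<close>

definition is_lead :: "(nat \<Rightarrow> nat \<Rightarrow> 'a) \<Rightarrow> nat \<times> nat \<Rightarrow> bool" where
  "is_lead f e \<longleftrightarrow> case_prod f e \<noteq> \<zero> \<and> (\<forall>e'. case_prod f e' \<noteq> \<zero> \<longrightarrow> e' = e \<or> mon_less e e')"

lemma mon_less_asym: "mon_less e e' \<Longrightarrow> \<not> mon_less e' e"
  by (auto simp: mon_less_def)

lemma is_lead_unique: "\<lbrakk>is_lead f e; is_lead f e'\<rbrakk> \<Longrightarrow> e = e'"
  unfolding is_lead_def using mon_less_asym by blast

lemma lead_exp_eq: "is_lead f e \<Longrightarrow> lead_exp F f = e"
  unfolding lead_exp_def is_lead_def[symmetric] by (blast intro: the_equality is_lead_unique)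

lemma ex_is_lead:
  assumes "f \<in> carrier A" "f \<noteq> \<zero>\<^bsub>A\<^esub>"
  shows "is_lead f (lead_exp F f)"
proof -
  have ex: "\<exists>j i. f i j \<noteq> \<zero>" using assms by (auto simp: fun_eq_iff A_zero(1))
  define j where "j = (LEAST j. \<exists>i. f i j \<noteq> \<zero>)"
  have j: "\<exists>i. f i j \<noteq> \<zero>" unfolding j_def by (rule LeastI_ex) (rule ex)
  define i where "i = (LEAST i. f i j \<noteq> \<zero>)"
  have i: "f i j \<noteq> \<zero>" unfolding i_def by (rule LeastI_ex) (rule j)
  have "is_lead f (i, j)"
    unfolding is_lead_def
  proof (intro conjI allI impI)
    show "case_prod f (i, j) \<noteq> \<zero>" using i by simp
    fix e' assume *: "case_prod f e' \<noteq> \<zero>"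
    obtain k l where e': "e' = (k, l)" by (cases e')
    have "j \<le> l" unfolding j_def by (rule Least_le) (use * e' in auto)
    moreover have "i \<le> k" if "l = j" unfolding i_def by (rule Least_le) (use * e' that in auto)
    ultimately show "e' = (i, j) \<or> mon_less (i, j) e'" by (auto simp: e' mon_less_def)
  qed
  then show ?thesis by (simp add: lead_exp_eq)
qed

definition leads :: "(nat \<Rightarrow> nat \<Rightarrow> 'a) set \<Rightarrow> (nat \<times> nat) set" where
  "leads I = {e. \<exists>f\<in>I. is_lead f e}"

lemma lead_exp_image:
  assumes "I \<subseteq> carrier A"
  shows "lead_exp F ` (I - {\<zero>\<^bsub>A\<^esub>}) = leads I"
proof (intro equalityI subsetI)
  fix e assume "e \<in> lead_exp F ` (I - {\<zero>\<^bsub>A\<^esub>})"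
  then show "e \<in> leads I" using ex_is_lead assms by (auto simp: leads_def)
next
  fix e assume "e \<in> leads I"
  then obtain f where "f \<in> I" "is_lead f e" by (auto simp: leads_def)
  moreover from this have "f \<noteq> \<zero>\<^bsub>A\<^esub>" by (auto simp: is_lead_def A_zero(1) split_beta)
  ultimately show "e \<in> lead_exp F ` (I - {\<zero>\<^bsub>A\<^esub>})"
    by (auto simp: lead_exp_eq image_iff intro!: bexI[of _ f])
qed

lemma up_closed_leads:
  assumes "ideal I A"
  shows "up_closed (leads I)"
  unfolding up_closed_def
proof (intro allI impI, elim conjE)
  fix i j k l assume "(i, j) \<in> leads I" and le: "i \<le> k" "j \<le> l"
  then obtain f where f: "f \<in> I" "is_lead f (i, j)" by (auto simp: leads_def)
  have fA: "f \<in> carrier A" using f A_idealD[OF assms] by auto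
  have "is_lead (xy_mon F (k - i) (l - j) \<otimes>\<^bsub>A\<^esub> f) (k, l)"
    unfolding is_lead_def
  proof (intro conjI allI impI)
    show "case_prod (xy_mon F (k - i) (l - j) \<otimes>\<^bsub>A\<^esub> f) (k, l) \<noteq> \<zero>"
      using f(2) le by (auto simp: is_lead_def xy_mon_mult_coeff[OF fA])
    fix e' assume *: "case_prod (xy_mon F (k - i) (l - j) \<otimes>\<^bsub>A\<^esub> f) e' \<noteq> \<zero>"
    obtain a b where e': "e' = (a, b)" by (cases e')
    have ab: "k - i \<le> a" "l - j \<le> b" "f (a - (k - i)) (b - (l - j)) \<noteq> \<zero>"
      using * by (auto simp: e' xy_mon_mult_coeff[OF fA] split: if_splits)
    from f(2) ab(3) have "(a - (k - i), b - (l - j)) = (i, j) \<or> mon_less (i, j) (a - (k - i), b - (l - j))"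
      unfolding is_lead_def by (metis case_prod_conv)
    then show "e' = (k, l) \<or> mon_less (k, l) e'"
      using ab(1,2) le by (auto simp: e' mon_less_def)
  qed
  moreover have "xy_mon F (k - i) (l - j) \<otimes>\<^bsub>A\<^esub> f \<in> I"
    using f A_idealD[OF assms] by auto
  ultimately show "(k, l) \<in> leads I" by (auto simp: leads_def)
qed

text \<open>The leading exponents are closed upwards, so the series supported on them form an ideal.
  It contains the initial ideal, which thus has no monomials other than the leading ones, and
  comparing ideals amounts to comparing sets of exponents.\<close>

lemma initial_ideal_eq_iff:
  assumes "ideal I A" "u \<le> v"
  shows "initial_ideal F I = diagram_ideal F [v, u] \<longleftrightarrow> leads I = - boxes [v, u]"
proof -
  have IA: "I \<subseteq> carrier A" using A_idealD[OF assms(1)] by auto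
  let ?S = "\<lambda>L. {xy_mon F i j | i j. (i, j) \<in> L}"
  have init: "initial_ideal F I = genideal A (?S (leads I))"
  proof -
    have "(\<lambda>f. case_prod (xy_mon F) (lead_exp F f)) ` (I - {\<zero>\<^bsub>A\<^esub>}) = case_prod (xy_mon F) ` leads I"
      by (simp add: image_image lead_exp_image[OF IA, symmetric])
    also have "\<dots> = ?S (leads I)" by auto
    finally show ?thesis unfolding initial_ideal_def by (rule arg_cong)
  qed
  have S: "?S L \<subseteq> carrier A" for L by auto
  show ?thesis
  proof
    assume "leads I = - boxes [v, u]"
    then show "initial_ideal F I = diagram_ideal F [v, u]"
      unfolding init diagram_ideal_def by simp
  next
    assume eq: "initial_ideal F I = diagram_ideal F [v, u]"
    show "leads I = - boxes [v, u]"
    proof (intro equalityI subrelI)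
      fix i j assume "(i, j) \<in> leads I"
      then have "xy_mon F i j \<in> initial_ideal F I"
        unfolding init using A.genideal_self[OF S] by blast
      then show "(i, j) \<in> - boxes [v, u]"
        unfolding eq diagram_ideal_eq[OF assms(2)] by (simp add: xy_mon_supported)
    next
      fix i j assume "(i, j) \<in> - boxes [v, u]"
      then have "xy_mon F i j \<in> initial_ideal F I"
        unfolding eq diagram_ideal_eq[OF assms(2)] by (simp add: xy_mon_supported)
      also have "\<dots> \<subseteq> supported_on (leads I)"
        unfolding init using supported_on_ideal[OF up_closed_leads[OF assms(1)]]
        by (rule A.genideal_minimal) (auto simp: xy_mon_supported)
      finally show "(i, j) \<in> leads I" by (simp add: xy_mon_supported)
    qed
  qed
qed

end

section \<open>Division with remainder, the maximal ideal, and the order of a square\<close>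

context field_powser
begin

lemma A_zero_app: "\<zero>\<^bsub>A\<^esub> i j = \<zero>"
  by (simp add: A_zero(1))

lemma shift_app: "shift n f j = f (n + j)"
  by (simp add: shift_def)

lemma xy_mon_row: "xy_mon F i j k = (if k = i then ypow j else \<zero>\<^bsub>P\<^esub>)"
  by (auto simp: xy_mon_def ypow_def fun_eq_iff powser_zero)

lemma xy_mon_app: "xy_mon F i j k l = (if k = i \<and> l = j then \<one> else \<zero>)"
  by (simp add: xy_mon_def)

text \<open>Division with remainder, upwards along the monomial order: modulo \<open>x\<^sup>2\<close> the exponent \<open>(i, j)\<close>
  has position \<open>2 * j + i\<close>.\<close>

lemma reduction:
  assumes I: "ideal I A" and sup: "supported_on (- boxes [b, a]) \<subseteq> I" and "a \<le> b"
    and "f \<in> carrier A" "\<And>i j. \<lbrakk>i < 2; f i j \<noteq> \<zero>\<rbrakk> \<Longrightarrow> n \<le> 2 * j + i"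
  shows "\<exists>r\<in>carrier A. f \<ominus>\<^bsub>A\<^esub> r \<in> I \<and>
    (\<forall>i j. r i j \<noteq> \<zero> \<longrightarrow> i < 2 \<and> (i, j) \<notin> leads I \<and> n \<le> 2 * j + i)"
  using assms(4,5)
proof (induction "2 * b - n" arbitrary: n f)
  case 0
  \<comment> \<open>Here n is at least 2 b, while every box of (b, a) has position below 2 b because
    a is at most b.\<close>
  have "f i j = \<zero>" if "(i, j) \<in> boxes [b, a]" for i j
    by (rule ccontr) (use 0(3)[of i j] 0(1) that \<open>a \<le> b\<close> in \<open>auto simp: mem_boxes2\<close>)
  then have "f \<in> I" using sup 0 by (auto simp: supported_on_def)
  then have "f \<ominus>\<^bsub>A\<^esub> \<zero>\<^bsub>A\<^esub> \<in> I" using A_idealD[OF I] by auto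
  then show ?case by (intro bexI[of _ "\<zero>\<^bsub>A\<^esub>"] conjI, assumption) (auto simp: A_zero_app)
next
  case (Suc d)
  define i0 j0 where "i0 = n mod 2" and "j0 = n div 2"
  have n: "n = 2 * j0 + i0" "i0 < 2" by (auto simp: i0_def j0_def)
  have code: "i = i0 \<and> j = j0" if "i < 2" "2 * j + i = n" for i j
    using that by (auto simp: i0_def j0_def)
  note D = A_idealD[OF I]
  have f: "f \<in> carrier A" by fact
  define c where "c = f i0 j0"
  have c: "c \<in> carrier F" using f by (simp add: c_def)
  \<comment> \<open>The term at position n is cancelled by a multiple of an element of I if its
    exponent is a leading one. Otherwise it is moved to the remainder.\<close>
  show ?case
  proof (cases "(i0, j0) \<in> leads I")
    case True
    then obtain p where p: "p \<in> I" "is_lead p (i0, j0)" by (auto simp: leads_def)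
    have pA: "p \<in> carrier A" using p D by auto
    have p0: "p i0 j0 \<noteq> \<zero>" using p by (simp add: is_lead_def)
    define e where "e = c \<otimes> inv (p i0 j0)"
    have pu: "p i0 j0 \<in> Units F" using p0 pA field_Units by auto
    have e: "e \<in> carrier F" "e \<otimes> p i0 j0 = c"
      using c pu pA by (auto simp: e_def m_assoc)
    let ?f = "f \<ominus>\<^bsub>A\<^esub> cst e \<otimes>\<^bsub>A\<^esub> p"
    have val: "?f i j = f i j \<ominus> e \<otimes> p i j" for i j
      using f pA e by (simp add: A_minus P_minus cst_mult)
    have "\<exists>r\<in>carrier A. ?f \<ominus>\<^bsub>A\<^esub> r \<in> I \<and>
        (\<forall>i j. r i j \<noteq> \<zero> \<longrightarrow> i < 2 \<and> (i, j) \<notin> leads I \<and> Suc n \<le> 2 * j + i)"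
    proof (rule Suc.hyps)
      show "d = 2 * b - Suc n" using Suc.hyps by simp
      show "?f \<in> carrier A" using f pA e by simp
      fix i j :: nat assume i: "i < 2" and nz: "?f i j \<noteq> \<zero>"
      have "n \<le> 2 * j + i"
      proof (cases "f i j = \<zero>")
        case True
        then have "p i j \<noteq> \<zero>" using nz e unfolding val by (auto simp: a_minus_def)
        then have "(i, j) = (i0, j0) \<or> mon_less (i0, j0) (i, j)"
          using p(2) unfolding is_lead_def by (metis case_prod_conv)
        then show ?thesis using n i by (auto simp: mon_less_def)
      next
        case False
        then show ?thesis using Suc.prems i by auto
      qed
      moreover have "2 * j + i \<noteq> n"
      proof
        assume "2 * j + i = n"
        then have "?f i j = c \<ominus> c" using code[OF i] e by (auto simp: val c_def)
        then show False using nz c by (simp add: a_minus_def r_neg)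
      qed
      ultimately show "Suc n \<le> 2 * j + i" by linarith
    qed
    then obtain r where r: "r \<in> carrier A" "?f \<ominus>\<^bsub>A\<^esub> r \<in> I"
      "\<And>i j. r i j \<noteq> \<zero> \<Longrightarrow> i < 2 \<and> (i, j) \<notin> leads I \<and> Suc n \<le> 2 * j + i"
      by blast
    have "f \<ominus>\<^bsub>A\<^esub> r = (?f \<ominus>\<^bsub>A\<^esub> r) \<oplus>\<^bsub>A\<^esub> cst e \<otimes>\<^bsub>A\<^esub> p"
      using f r(1) pA cst_closed[OF e(1)] by algebra
    also have "\<dots> \<in> I" using r p e D by auto
    finally show ?thesis using r by (intro bexI[of _ r]) (auto dest: Suc_leD)
  next
    case False
    let ?m = "cst c \<otimes>\<^bsub>A\<^esub> xy_mon F i0 j0"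
    have m: "?m \<in> carrier A" using c by simp
    let ?f = "f \<ominus>\<^bsub>A\<^esub> ?m"
    have mv: "?m i j = (if i = i0 \<and> j = j0 then c else \<zero>)" for i j
      using c by (simp add: cst_mult) (simp add: xy_mon_def)
    have val: "?f i j = (if i = i0 \<and> j = j0 then \<zero> else f i j)" for i j
    proof -
      have "?f i j = f i j \<ominus> ?m i j" using f m by (simp add: A_minus P_minus)
      also have "\<dots> = (if i = i0 \<and> j = j0 then \<zero> else f i j)"
        unfolding mv using f by (auto simp: c_def a_minus_def r_neg)
      finally show ?thesis .
    qed
    have "\<exists>r\<in>carrier A. ?f \<ominus>\<^bsub>A\<^esub> r \<in> I \<and>
        (\<forall>i j. r i j \<noteq> \<zero> \<longrightarrow> i < 2 \<and> (i, j) \<notin> leads I \<and> Suc n \<le> 2 * j + i)"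
    proof (rule Suc.hyps)
      show "d = 2 * b - Suc n" using Suc.hyps by simp
      show "?f \<in> carrier A" using f m by simp
      fix i j :: nat assume i: "i < 2" and nz: "?f i j \<noteq> \<zero>"
      then have "n \<le> 2 * j + i" using Suc.prems by (auto simp: val split: if_splits)
      moreover have "2 * j + i \<noteq> n" using code[OF i] nz by (auto simp: val)
      ultimately show "Suc n \<le> 2 * j + i" by linarith
    qed
    then obtain r where r: "r \<in> carrier A" "?f \<ominus>\<^bsub>A\<^esub> r \<in> I"
      "\<And>i j. r i j \<noteq> \<zero> \<Longrightarrow> i < 2 \<and> (i, j) \<notin> leads I \<and> Suc n \<le> 2 * j + i"
      by blast
    have "f \<ominus>\<^bsub>A\<^esub> (r \<oplus>\<^bsub>A\<^esub> ?m) = ?f \<ominus>\<^bsub>A\<^esub> r"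
      using f r(1) m by algebra
    then have "f \<ominus>\<^bsub>A\<^esub> (r \<oplus>\<^bsub>A\<^esub> ?m) \<in> I" using r by simp
    moreover have "i < 2 \<and> (i, j) \<notin> leads I \<and> n \<le> 2 * j + i"
      if "(r \<oplus>\<^bsub>A\<^esub> ?m) i j \<noteq> \<zero>" for i j
    proof (cases "i = i0 \<and> j = j0")
      case True
      then show ?thesis using False n by auto
    next
      case ne: False
      then have "r i j \<noteq> \<zero>" using that r(1) by (auto simp: A_add powser_add mv)
      then show ?thesis using r(3) by (auto dest: Suc_leD)
    qed
    ultimately show ?thesis using r(1) m by (intro bexI[of _ "r \<oplus>\<^bsub>A\<^esub> ?m"]) auto
  qed
qed

text \<open>The monomial at the given exponent minus its remainder lies in I. The remainder avoids
  all leading exponents, so it cannot touch the leading coefficient, and it has no earlier terms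
  because reduction never goes down in position.\<close>

lemma ex_reduced_generator:
  assumes I: "ideal I A" and "supported_on (- boxes [b, a]) \<subseteq> I" and "a \<le> b"
    and e: "(i0, j0) \<in> leads I" "i0 < 2"
  shows "\<exists>p\<in>I. p i0 j0 = \<one> \<and> (\<forall>i j. p i j \<noteq> \<zero> \<longrightarrow>
    (i, j) = (i0, j0) \<or> i < 2 \<and> (i, j) \<notin> leads I \<and> mon_less (i0, j0) (i, j))"
proof -
  let ?m = "xy_mon F i0 j0"
  have "\<exists>r\<in>carrier A. ?m \<ominus>\<^bsub>A\<^esub> r \<in> I \<and>
    (\<forall>i j. r i j \<noteq> \<zero> \<longrightarrow> i < 2 \<and> (i, j) \<notin> leads I \<and> 2 * j0 + i0 \<le> 2 * j + i)"
    using assms by (intro reduction) (auto simp: xy_mon_app split: if_splits)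
  then obtain r where r: "r \<in> carrier A" "?m \<ominus>\<^bsub>A\<^esub> r \<in> I"
    "\<And>i j. r i j \<noteq> \<zero> \<Longrightarrow> i < 2 \<and> (i, j) \<notin> leads I \<and> 2 * j0 + i0 \<le> 2 * j + i"
    by blast
  have val: "(?m \<ominus>\<^bsub>A\<^esub> r) i j = (if (i, j) = (i0, j0) then \<one> else \<zero>) \<ominus> r i j" for i j
    using r(1) by (simp add: A_minus P_minus) (simp add: xy_mon_def)
  have "r i0 j0 = \<zero>" using r(3) e by auto
  then have "(?m \<ominus>\<^bsub>A\<^esub> r) i0 j0 = \<one>" unfolding val by (simp add: a_minus_def)
  moreover have "i < 2 \<and> (i, j) \<notin> leads I \<and> mon_less (i0, j0) (i, j)"
    if "(?m \<ominus>\<^bsub>A\<^esub> r) i j \<noteq> \<zero>" "(i, j) \<noteq> (i0, j0)" for i j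
  proof -
    have "r i j \<noteq> \<zero>" using that unfolding val by (auto simp: a_minus_def)
    then show ?thesis using r(3)[of i j] that(2) e(2) by (auto simp: mon_less_def)
  qed
  ultimately show ?thesis using r(2) by blast
qed

lemma mem_max_ideal: "h \<in> max_ideal F \<longleftrightarrow> h \<in> carrier A \<and> h 0 0 = \<zero>"
proof
  assume "h \<in> max_ideal F"
  then obtain p q where pq: "p \<in> carrier A" "q \<in> carrier A"
    and h: "h = p \<otimes>\<^bsub>A\<^esub> xy_mon F 1 0 \<oplus>\<^bsub>A\<^esub> q \<otimes>\<^bsub>A\<^esub> xy_mon F 0 1"
    by (auto simp: max_ideal_def cgenideal_def set_add_def')
  have "h = xy_mon F 1 0 \<otimes>\<^bsub>A\<^esub> p \<oplus>\<^bsub>A\<^esub> xy_mon F 0 1 \<otimes>\<^bsub>A\<^esub> q"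
    using pq by (simp add: h A.m_comm)
  then show "h \<in> carrier A \<and> h 0 0 = \<zero>"
    using pq by (simp add: A_add powser_add xy_mon_mult_coeff)
next
  assume h: "h \<in> carrier A \<and> h 0 0 = \<zero>"
  let ?p = "\<lambda>i. h (Suc i)" and ?q = "y_series (shift 1 (h 0))"
  have p: "?p \<in> carrier A" using h unfolding A_carrier by blast
  have q: "?q \<in> carrier A" using h by simp
  have "y_series (h 0) = ?q \<otimes>\<^bsub>A\<^esub> xy_mon F 0 1"
    using h by (intro y_series_eq_ypow_mult) auto
  then have 0: "xy_mon F 0 1 \<otimes>\<^bsub>A\<^esub> ?q = y_series (h 0)" using q by (simp add: A.m_comm)
  have "h = xy_mon F 1 0 \<otimes>\<^bsub>A\<^esub> ?p \<oplus>\<^bsub>A\<^esub> xy_mon F 0 1 \<otimes>\<^bsub>A\<^esub> ?q"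
  proof
    fix i
    show "h i = (xy_mon F 1 0 \<otimes>\<^bsub>A\<^esub> ?p \<oplus>\<^bsub>A\<^esub> xy_mon F 0 1 \<otimes>\<^bsub>A\<^esub> ?q) i"
      unfolding 0 using h p by (cases i) (simp_all add: A_add xy_mon_mult y_series_app ypow_0)
  qed
  then have "h = ?p \<otimes>\<^bsub>A\<^esub> xy_mon F 1 0 \<oplus>\<^bsub>A\<^esub> ?q \<otimes>\<^bsub>A\<^esub> xy_mon F 0 1"
    using p q by (simp add: A.m_comm)
  then show "h \<in> max_ideal F"
    using p q unfolding max_ideal_def cgenideal_def set_add_def' by blast
qed

lemma max_ideal_ideal: "ideal (max_ideal F) A"
  unfolding max_ideal_def by (intro A.add_ideals A.cgenideal_ideal) auto

text \<open>If s is the order of g, the product has no term below degree 2 s - u, and its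
  coefficient there is the single product \<open>g s \<otimes> g s\<close>, which is nonzero since F
  is a field. The case n = v describes the cell, the case n = v + 1 its rank 3 part.\<close>

lemma shift_square_vanishes_iff:
  assumes g: "g \<in> carrier P" and u: "\<And>j. g j \<noteq> \<zero> \<Longrightarrow> u \<le> j"
  shows "(\<forall>j<n. (shift u g \<otimes>\<^bsub>P\<^esub> g) j = \<zero>) \<longleftrightarrow> (\<forall>j. g j \<noteq> \<zero> \<longrightarrow> u + n \<le> 2 * j)"
proof
  assume *: "\<forall>j. g j \<noteq> \<zero> \<longrightarrow> u + n \<le> 2 * j"
  show "\<forall>j<n. (shift u g \<otimes>\<^bsub>P\<^esub> g) j = \<zero>"
  proof (intro allI impI)
    fix j assume j: "j < n"
    have "g (u + k) \<otimes> g (j - k) = \<zero>" if "k \<le> j" for k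
    proof (cases "g (u + k) = \<zero> \<or> g (j - k) = \<zero>")
      case True
      then show ?thesis using g by auto
    next
      case False
      then have "u + n \<le> 2 * (u + k)" "u + n \<le> 2 * (j - k)" using * by auto
      then have False using that j by presburger
      then show ?thesis ..
    qed
    then show "(shift u g \<otimes>\<^bsub>P\<^esub> g) j = \<zero>"
      unfolding powser_mult shift_def by (intro add.finprod_one_eqI) auto
  qed
next
  assume *: "\<forall>j<n. (shift u g \<otimes>\<^bsub>P\<^esub> g) j = \<zero>"
  show "\<forall>j. g j \<noteq> \<zero> \<longrightarrow> u + n \<le> 2 * j"
  proof (intro allI impI)
    fix j assume j: "g j \<noteq> \<zero>"
    define s where "s = (LEAST j. g j \<noteq> \<zero>)"
    have s: "g s \<noteq> \<zero>" unfolding s_def by (rule LeastI) (rule j)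
    have sj: "s \<le> i" if "g i \<noteq> \<zero>" for i unfolding s_def by (rule Least_le) (rule that)
    define t where "t = s - u"
    have st: "s = u + t" using u[OF s] by (simp add: t_def)
    have "(shift u g \<otimes>\<^bsub>P\<^esub> g) (t + s) =
        (\<Oplus>k\<in>{..t + s}. if t = k then g (u + k) \<otimes> g (t + s - k) else \<zero>)"
      unfolding powser_mult shift_def
    proof (rule finsum_cong')
      fix k assume "k \<in> {..t + s}"
      show "g (u + k) \<otimes> g (t + s - k) = (if t = k then g (u + k) \<otimes> g (t + s - k) else \<zero>)"
      proof (cases "t = k")
        case False
        then have "u + k < s \<or> t + s - k < s"
          using \<open>k \<in> {..t + s}\<close> unfolding st by (cases "k < t"; simp; arith)
        then have "g (u + k) = \<zero> \<or> g (t + s - k) = \<zero>" using sj by fastforce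
        then show ?thesis using False g by auto
      qed simp
    qed (use g in auto)
    also have "\<dots> = g s \<otimes> g s" using g by (subst finsum_singleton) (auto simp: st)
    also have "\<dots> \<noteq> \<zero>" using s g integral by auto
    finally have "n \<le> t + s" using * by (metis not_less)
    then show "u + n \<le> 2 * j" using sj[OF j] st by linarith
  qed
qed

end

section \<open>The span of the three generators in coordinates\<close>

locale groebner_pair = field_powser F for F :: "('a, 'm) ring_scheme" (structure) +
  fixes u v :: nat and g :: "nat \<Rightarrow> 'a"
  assumes uv: "u \<le> v" and g_closed [simp]: "g \<in> carrier P"
    and g_supp: "\<And>j. g j \<noteq> \<zero> \<Longrightarrow> u < j \<and> j < v"
begin

text \<open>Subtracting the multiple of \<open>x y\<^sup>u + g\<close> prescribed by the coefficient of \<open>x\<close> turns the span of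
  \<open>x y\<^sup>u + g\<close>, \<open>y\<^sup>v\<close> and \<open>x\<^sup>2\<close> over power series in \<open>y\<close> resp. in \<open>x, y\<close> into a coordinate subspace \<open>M\<close>.\<close>

definition coords :: "(nat \<Rightarrow> nat \<Rightarrow> 'a) \<Rightarrow> nat \<Rightarrow> nat \<Rightarrow> 'a" where
  "coords f = (\<lambda>i. if i = 0 then f 0 \<ominus>\<^bsub>P\<^esub> shift u (f 1) \<otimes>\<^bsub>P\<^esub> g else f i)"

text \<open>Growing the set \<open>B\<close> from the empty set to all boxes leads from the whole
  ring down to \<open>M\<close>; the degree is counted along this chain.\<close>

definition coords_vanish :: "(nat \<times> nat) set \<Rightarrow> (nat \<Rightarrow> nat \<Rightarrow> 'a) set" where
  "coords_vanish B = {f \<in> carrier A. \<forall>i j. (i, j) \<in> B \<longrightarrow> coords f i j = \<zero>}"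

definition M :: "(nat \<Rightarrow> nat \<Rightarrow> 'a) set" where
  "M = coords_vanish (boxes [v, u])"

definition G :: "nat \<Rightarrow> nat \<Rightarrow> 'a" where
  "G = (\<lambda>i. if i = 0 then g else if i = 1 then ypow u else \<zero>\<^bsub>P\<^esub>)"

lemma G_closed [simp]: "G \<in> carrier A"
  by (simp add: G_def A_carrier_P)

lemma G_app: "G i = (if i = 0 then g else if i = 1 then ypow u else \<zero>\<^bsub>P\<^esub>)"
  by (simp add: G_def)

lemma coords_closed [simp]: "f \<in> carrier A \<Longrightarrow> coords f i j \<in> carrier F"
  by (simp add: coords_def P_minus)

lemma shift_add: "shift n (p \<oplus>\<^bsub>P\<^esub> q) = shift n p \<oplus>\<^bsub>P\<^esub> shift n q"
  by (simp add: fun_eq_iff shift_def powser_add)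

lemma coords_linear: "linear_functional (\<lambda>f. coords f i j)"
  unfolding linear_functional_def
proof (intro conjI ballI)
  fix f h assume fh: "f \<in> carrier A" "h \<in> carrier A"
  show "coords (f \<oplus>\<^bsub>A\<^esub> h) i j = coords f i j \<oplus> coords h i j"
  proof (cases "i = 0")
    case True
    have c: "f 0 \<in> carrier P" "h 0 \<in> carrier P" "shift u (f 1) \<in> carrier P" "shift u (h 1) \<in> carrier P"
      using fh by auto
    have "f 0 \<oplus>\<^bsub>P\<^esub> h 0 \<ominus>\<^bsub>P\<^esub> (shift u (f 1) \<oplus>\<^bsub>P\<^esub> shift u (h 1)) \<otimes>\<^bsub>P\<^esub> g =
      (f 0 \<ominus>\<^bsub>P\<^esub> shift u (f 1) \<otimes>\<^bsub>P\<^esub> g) \<oplus>\<^bsub>P\<^esub> (h 0 \<ominus>\<^bsub>P\<^esub> shift u (h 1) \<otimes>\<^bsub>P\<^esub> g)"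
      using c g_closed by algebra
    then have "coords (f \<oplus>\<^bsub>A\<^esub> h) 0 = coords f 0 \<oplus>\<^bsub>P\<^esub> coords h 0"
      by (simp add: coords_def A_add shift_add)
    then show ?thesis using True by (simp add: powser_add)
  next
    case False
    then show ?thesis by (simp add: coords_def A_add powser_add)
  qed
next
  fix c f assume c: "c \<in> carrier F" and f: "f \<in> carrier A"
  let ?c = "cst c 0"
  have cP: "?c \<in> carrier P" using c by auto
  have row: "(cst c \<otimes>\<^bsub>A\<^esub> f) i = ?c \<otimes>\<^bsub>P\<^esub> f i" if "f \<in> carrier A" for f i
  proof -
    have "cst c = y_series ?c" by (auto simp: cst_def y_series_def fun_eq_iff powser_zero)
    then show ?thesis using y_series_mult[OF cP that] by metis
  qed
  have coeff: "(?c \<otimes>\<^bsub>P\<^esub> p) j = c \<otimes> p j" if "p \<in> carrier P" for p j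
    using row[of "y_series p" 0] cst_mult[OF c, of "y_series p" 0 j] that by (simp add: y_series_app)
  show "coords (cst c \<otimes>\<^bsub>A\<^esub> f) i j = c \<otimes> coords f i j"
  proof (cases "i = 0")
    case True
    have 1: "shift u (?c \<otimes>\<^bsub>P\<^esub> f 1) = ?c \<otimes>\<^bsub>P\<^esub> shift u (f 1)"
      using f by (intro ext) (simp add: shift_app coeff)
    have "?c \<otimes>\<^bsub>P\<^esub> f 0 \<ominus>\<^bsub>P\<^esub> (?c \<otimes>\<^bsub>P\<^esub> shift u (f 1)) \<otimes>\<^bsub>P\<^esub> g =
        ?c \<otimes>\<^bsub>P\<^esub> (f 0 \<ominus>\<^bsub>P\<^esub> shift u (f 1) \<otimes>\<^bsub>P\<^esub> g)"
      using cP A_carrierDP[OF f, of 0] shift_closed[OF A_carrierDP[OF f, of 1]] g_closed by algebra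
    then have "coords (cst c \<otimes>\<^bsub>A\<^esub> f) 0 = ?c \<otimes>\<^bsub>P\<^esub> coords f 0"
      by (simp only: coords_def row[OF f] 1 if_True refl)
    moreover have "coords f 0 \<in> carrier P" using f by (simp add: coords_def)
    ultimately show ?thesis using True by (simp add: coeff)
  next
    case False
    then show ?thesis using c f by (simp add: coords_def cst_mult)
  qed
qed simp

lemma coords_add: "\<lbrakk>f \<in> carrier A; h \<in> carrier A\<rbrakk> \<Longrightarrow> coords (f \<oplus>\<^bsub>A\<^esub> h) i j = coords f i j \<oplus> coords h i j"
  and coords_cst_mult: "\<lbrakk>c \<in> carrier F; f \<in> carrier A\<rbrakk> \<Longrightarrow> coords (cst c \<otimes>\<^bsub>A\<^esub> f) i j = c \<otimes> coords f i j"
  using coords_linear[of i j] by (auto simp: linear_functional_def)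

lemma coords_id:
  assumes "f \<in> carrier A" "shift u (f 1) = \<zero>\<^bsub>P\<^esub>"
  shows "coords f = f"
proof
  fix i show "coords f i = f i" using assms by (simp add: coords_def a_minus_def)
qed

lemma coords_vanish_subspace: "is_subspace (coords_vanish B)"
  by (auto simp: is_subspace_def coords_vanish_def coords_add coords_cst_mult)

lemma coords_vanish_insert: "coords_vanish (insert (i, j) B) = {f \<in> coords_vanish B. coords f i j = \<zero>}"
  by (auto simp: coords_vanish_def)

lemma M_carrier: "f \<in> M \<Longrightarrow> f \<in> carrier A"
  by (simp add: M_def coords_vanish_def)

text \<open>Modulo x^2 the right-hand side reads f = q G + s y^v with series q, s in y alone. This
  form suits multiplication, whereas the vanishing of coordinates suits the counting of
  dimensions.\<close>

lemma M_iff: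
  assumes f: "f \<in> carrier A"
  shows "f \<in> M \<longleftrightarrow> (\<exists>q\<in>carrier P. \<exists>s\<in>carrier P. f 1 = ypow u \<otimes>\<^bsub>P\<^esub> q \<and>
    f 0 = q \<otimes>\<^bsub>P\<^esub> g \<oplus>\<^bsub>P\<^esub> ypow v \<otimes>\<^bsub>P\<^esub> s)" (is "_ \<longleftrightarrow> ?R")
proof
  assume M: "f \<in> M"
  let ?q = "shift u (f 1)"
  have T0: "coords f i j = \<zero>" if "(i, j) \<in> boxes [v, u]" for i j
    using M that by (auto simp: M_def coords_vanish_def)
  have "f 1 j = \<zero>" if "j < u" for j
    using T0[of 1 j] that by (auto simp: mem_boxes2 coords_def)
  then have q: "f 1 = ypow u \<otimes>\<^bsub>P\<^esub> ?q"
    using f by (intro ypow_shift[symmetric]) auto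
  have t: "coords f 0 \<in> carrier P" using f by (simp add: coords_def)
  have s: "coords f 0 = ypow v \<otimes>\<^bsub>P\<^esub> shift v (coords f 0)"
    using t T0 by (intro ypow_shift[symmetric]) (auto simp: mem_boxes2)
  have "f 0 = ?q \<otimes>\<^bsub>P\<^esub> g \<oplus>\<^bsub>P\<^esub> (f 0 \<ominus>\<^bsub>P\<^esub> ?q \<otimes>\<^bsub>P\<^esub> g)"
    using shift_closed[OF A_carrierDP[OF f, of 1]] A_carrierDP[OF f, of 0] g_closed by algebra
  then have "f 0 = ?q \<otimes>\<^bsub>P\<^esub> g \<oplus>\<^bsub>P\<^esub> ypow v \<otimes>\<^bsub>P\<^esub> shift v (coords f 0)"
    using s by (simp add: coords_def)
  then show ?R using q t f by (intro bexI[of _ ?q] bexI[of _ "shift v (coords f 0)"]) auto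
next
  assume ?R
  then obtain q s where qs: "q \<in> carrier P" "s \<in> carrier P" "f 1 = ypow u \<otimes>\<^bsub>P\<^esub> q"
    "f 0 = q \<otimes>\<^bsub>P\<^esub> g \<oplus>\<^bsub>P\<^esub> ypow v \<otimes>\<^bsub>P\<^esub> s" by auto
  have "q \<otimes>\<^bsub>P\<^esub> g \<oplus>\<^bsub>P\<^esub> ypow v \<otimes>\<^bsub>P\<^esub> s \<ominus>\<^bsub>P\<^esub> q \<otimes>\<^bsub>P\<^esub> g = ypow v \<otimes>\<^bsub>P\<^esub> s"
    using qs(1,2) ypow_closed[of v] g_closed by algebra
  then have "coords f 0 = ypow v \<otimes>\<^bsub>P\<^esub> s" using qs by (simp add: coords_def)
  moreover have "coords f 1 = ypow u \<otimes>\<^bsub>P\<^esub> q" using qs by (simp add: coords_def)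
  ultimately show "f \<in> M" using f qs(1,2)
    by (auto simp: M_def coords_vanish_def mem_boxes2 ypow_mult simp del: One_nat_def)
qed

text \<open>The constant terms of q and s will be the coefficients of f at G and y^v modulo the
  product of the maximal ideal with \<open>M\<close>.\<close>

lemma coords_eq:
  assumes "f \<in> carrier A" "q \<in> carrier P" "s \<in> carrier P" "f 1 = ypow u \<otimes>\<^bsub>P\<^esub> q"
    "f 0 = q \<otimes>\<^bsub>P\<^esub> g \<oplus>\<^bsub>P\<^esub> ypow v \<otimes>\<^bsub>P\<^esub> s"
  shows "coords f 1 u = q 0" "coords f 0 v = s 0"
proof -
  have "q \<otimes>\<^bsub>P\<^esub> g \<oplus>\<^bsub>P\<^esub> ypow v \<otimes>\<^bsub>P\<^esub> s \<ominus>\<^bsub>P\<^esub> q \<otimes>\<^bsub>P\<^esub> g = ypow v \<otimes>\<^bsub>P\<^esub> s"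
    using assms(2,3) ypow_closed[of v] g_closed by algebra
  then have "coords f 0 = ypow v \<otimes>\<^bsub>P\<^esub> s" using assms by (simp add: coords_def)
  then show "coords f 0 v = s 0" using assms by (simp add: ypow_mult)
  show "coords f 1 u = q 0" using assms by (simp add: coords_def ypow_mult)
qed

lemma decompose:
  assumes f: "f \<in> carrier A" and q: "q \<in> carrier P" and s: "s \<in> carrier P" and "f 1 = ypow u \<otimes>\<^bsub>P\<^esub> q"
    "f 0 = q \<otimes>\<^bsub>P\<^esub> g \<oplus>\<^bsub>P\<^esub> ypow v \<otimes>\<^bsub>P\<^esub> s"
  shows "f = y_series q \<otimes>\<^bsub>A\<^esub> G \<oplus>\<^bsub>A\<^esub> y_series s \<otimes>\<^bsub>A\<^esub> xy_mon F 0 v \<oplus>\<^bsub>A\<^esub> xy_mon F 2 0 \<otimes>\<^bsub>A\<^esub> (\<lambda>i. f (i + 2))"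
proof
  fix i :: nat
  have t: "(\<lambda>i. f (i + 2)) \<in> carrier A" using f unfolding A_carrier by blast
  consider "i = 0" | "i = Suc 0" | k where "i = Suc (Suc k)" by (metis not0_implies_Suc)
  then show "f i = (y_series q \<otimes>\<^bsub>A\<^esub> G \<oplus>\<^bsub>A\<^esub> y_series s \<otimes>\<^bsub>A\<^esub> xy_mon F 0 v \<oplus>\<^bsub>A\<^esub>
      xy_mon F 2 0 \<otimes>\<^bsub>A\<^esub> (\<lambda>i. f (i + 2))) i"
    using assms t
    by cases (simp_all add: A_add xy_mon_mult y_series_mult xy_mon_row G_app ypow_0 P.m_comm)
qed

lemma M_subset_ideal:
  assumes I: "ideal I A" and "G \<in> I" "xy_mon F 0 v \<in> I" "xy_mon F 2 0 \<in> I"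
  shows "M \<subseteq> I"
proof
  fix f assume M: "f \<in> M"
  have f: "f \<in> carrier A" by (rule M_carrier[OF M])
  have t: "(\<lambda>i. f (i + 2)) \<in> carrier A" using f unfolding A_carrier by blast
  obtain q s where "q \<in> carrier P" "s \<in> carrier P" "f 1 = ypow u \<otimes>\<^bsub>P\<^esub> q"
    "f 0 = q \<otimes>\<^bsub>P\<^esub> g \<oplus>\<^bsub>P\<^esub> ypow v \<otimes>\<^bsub>P\<^esub> s" using M M_iff[OF f] by auto
  note dec = decompose[OF f this] and qs = this(1,2)
  show "f \<in> I"
    by (subst dec) (intro A_idealD(3,5,6)[OF I] assms(2-4) t y_series_closed qs)
qed

text \<open>Row 1 of f stays below degree u, so its shift is zero and the coordinates of f are its
  own coefficients. This gives uniqueness of reduced generators.\<close>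

lemma M_supported_zero:
  assumes "f \<in> M" "f \<in> supported_on (boxes [v, u])"
  shows "f = \<zero>\<^bsub>A\<^esub>"
proof -
  have f: "f \<in> carrier A" by (rule M_carrier) fact
  have b: "(i, j) \<in> boxes [v, u]" if "f i j \<noteq> \<zero>" for i j
    using assms(2) that by (auto simp: supported_on_def)
  have T0: "coords f i j = \<zero>" if "(i, j) \<in> boxes [v, u]" for i j
    using assms(1) that by (auto simp: M_def coords_vanish_def)
  have 1: "f 1 j = \<zero>" for j
    using b[of 1 j] T0[of 1 j] by (auto simp: mem_boxes2 coords_def)
  then have "shift u (f 1) = \<zero>\<^bsub>P\<^esub>" by (simp add: fun_eq_iff shift_def powser_zero)
  then have "coords f = f" by (rule coords_id[OF f])
  then have "f i j = \<zero>" for i j using b T0 by metis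
  then show ?thesis by (simp add: fun_eq_iff A_zero(1))
qed

lemma leads_M_subset: "leads M \<subseteq> - boxes [v, u]"
proof (intro subrelI)
  fix i j assume "(i, j) \<in> leads M"
  then obtain f where M: "f \<in> M" and l: "is_lead f (i, j)" by (auto simp: leads_def)
  have f: "f \<in> carrier A" by (rule M_carrier) fact
  have nz: "f i j \<noteq> \<zero>" using l by (simp add: is_lead_def)
  have lt: "k = i \<and> l = j \<or> mon_less (i, j) (k, l)" if "f k l \<noteq> \<zero>" for k l
    using l that by (auto simp: is_lead_def)
  have T0: "coords f i j = \<zero>" if "(i, j) \<in> boxes [v, u]" for i j
    using M that by (auto simp: M_def coords_vanish_def)
  show "(i, j) \<in> - boxes [v, u]"
  proof
    assume b: "(i, j) \<in> boxes [v, u]"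
    then have i: "i = 0" using T0[OF b] nz by (auto simp: mem_boxes2 coords_def)
    have "f 1 (u + k) \<otimes> g (j - k) = \<zero>" if "k \<le> j" for k
    proof (cases "f 1 (u + k) = \<zero> \<or> g (j - k) = \<zero>")
      case True
      then show ?thesis using f by auto
    next
      case False
      then have "j \<le> u + k" "u < j - k" using lt[of 1 "u + k"] g_supp i by (auto simp: mon_less_def)
      then have False by linarith
      then show ?thesis ..
    qed
    then have "(shift u (f 1) \<otimes>\<^bsub>P\<^esub> g) j = \<zero>"
      unfolding powser_mult shift_def by (intro add.finprod_one_eqI) auto
    moreover have "coords f i j = f 0 j \<ominus> (shift u (f 1) \<otimes>\<^bsub>P\<^esub> g) j" using f i by (simp add: coords_def P_minus)
    ultimately have "coords f i j = f i j" using f i by (simp add: a_minus_def)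
    then show False using T0[OF b] nz by simp
  qed
qed

text \<open>For f in I let r carry its coordinates on the boxes. Then f - r lies in
  \<open>M\<close>, hence in I, and so does r. Since r is supported on boxes and no leading exponent
  of I is a box, r vanishes.\<close>

lemma ideal_eq_M:
  assumes I: "ideal I A" and gens: "G \<in> I" "xy_mon F 0 v \<in> I" "xy_mon F 2 0 \<in> I"
    and leads: "leads I = - boxes [v, u]"
  shows "I = M"
proof
  show "M \<subseteq> I" by (rule M_subset_ideal) fact+
  show "I \<subseteq> M"
  proof
    fix f assume f: "f \<in> I"
    have fA: "f \<in> carrier A" using f A_idealD[OF I] by auto
    define r where "r = (\<lambda>i j. if (i, j) \<in> boxes [v, u] then coords f i j else \<zero>)"
    have r: "r \<in> carrier A" using coords_closed[OF fA] unfolding A_carrier r_def by auto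
    have "shift u (r 1) = \<zero>\<^bsub>P\<^esub>" by (auto simp: fun_eq_iff shift_def powser_zero r_def mem_boxes2)
    then have Tr: "coords r = r" by (rule coords_id[OF r])
    have "coords (f \<ominus>\<^bsub>A\<^esub> r) i j = \<zero>" if "(i, j) \<in> boxes [v, u]" for i j
      using linear_functional_minus[OF coords_linear fA r, of i j] that fA
      by (simp add: Tr a_minus_def r_neg) (simp add: r_def r_neg fA)
    then have "f \<ominus>\<^bsub>A\<^esub> r \<in> M" using fA r by (auto simp: M_def coords_vanish_def)
    moreover from this have "f \<ominus>\<^bsub>A\<^esub> r \<in> I" using \<open>M \<subseteq> I\<close> by auto
    then have "f \<ominus>\<^bsub>A\<^esub> (f \<ominus>\<^bsub>A\<^esub> r) \<in> I" using f A_idealD[OF I] by blast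
    moreover have "f \<ominus>\<^bsub>A\<^esub> (f \<ominus>\<^bsub>A\<^esub> r) = r" using fA r by algebra
    ultimately have rI: "r \<in> I" by simp
    have "r = \<zero>\<^bsub>A\<^esub>"
    proof (rule ccontr)
      assume "r \<noteq> \<zero>\<^bsub>A\<^esub>"
      then have l: "is_lead r (lead_exp F r)" by (rule ex_is_lead[OF r])
      then have "lead_exp F r \<in> boxes [v, u]"
        by (cases "lead_exp F r") (auto simp: is_lead_def r_def split: if_splits)
      moreover have "lead_exp F r \<in> leads I" using l rI by (auto simp: leads_def)
      ultimately show False using leads by auto
    qed
    moreover have "f \<ominus>\<^bsub>A\<^esub> \<zero>\<^bsub>A\<^esub> = f" using fA by algebra
    ultimately show "f \<in> M" using \<open>f \<ominus>\<^bsub>A\<^esub> r \<in> M\<close> by simp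
  qed
qed

end

text \<open>The assumption says that y^(u+v) divides g^2. It is kept apart from
  \<open>groebner_pair\<close> because for an ideal of the cell it is derived only after that ideal
  has been identified with \<open>M\<close>.\<close>

locale groebner_ideal = groebner_pair +
  assumes square_vanishes: "\<And>j. j < v \<Longrightarrow> (shift u g \<otimes>\<^bsub>P\<^esub> g) j = \<zero>"
begin

definition g_div :: "nat \<Rightarrow> 'a" where "g_div = shift u g"
text \<open>This is g^2 / y^(u+v). For 0 < u < v its constant term decides between rank 2 and rank
  3.\<close>

definition sq_div :: "nat \<Rightarrow> 'a" where "sq_div = shift v (g_div \<otimes>\<^bsub>P\<^esub> g)"

lemma g_div_closed [simp]: "g_div \<in> carrier P" and sq_div_closed [simp]: "sq_div \<in> carrier P"
  by (simp_all add: g_div_def sq_div_def)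

lemma g_eq: "g = ypow u \<otimes>\<^bsub>P\<^esub> g_div"
  using g_supp unfolding g_div_def by (intro ypow_shift[symmetric]) (auto, metis less_asym)

lemma g_div_g: "g_div \<otimes>\<^bsub>P\<^esub> g = ypow v \<otimes>\<^bsub>P\<^esub> sq_div"
  using square_vanishes unfolding sq_div_def g_div_def by (intro ypow_shift[symmetric]) auto

lemma g_div_0: "g_div 0 = \<zero>"
  using g_supp[of u] by (auto simp: g_div_def shift_app)

text \<open>Modulo x^2, multiplication by x sends G to \<open>g_div\<close> G -
  \<open>sq_div\<close> y^v and y^v to y^(v-u) G - \<open>g_div\<close> y^v. The series Q and S are
  the coefficients of G and y^v in the product with h.\<close>

lemma mult_M:
  assumes h: "h \<in> carrier A" and f: "f \<in> carrier A" and q: "q \<in> carrier P" and s: "s \<in> carrier P"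
    and f1: "f 1 = ypow u \<otimes>\<^bsub>P\<^esub> q" and f0: "f 0 = q \<otimes>\<^bsub>P\<^esub> g \<oplus>\<^bsub>P\<^esub> ypow v \<otimes>\<^bsub>P\<^esub> s"
    and Q: "Q = h 0 \<otimes>\<^bsub>P\<^esub> q \<oplus>\<^bsub>P\<^esub> h 1 \<otimes>\<^bsub>P\<^esub> (q \<otimes>\<^bsub>P\<^esub> g_div \<oplus>\<^bsub>P\<^esub> ypow (v - u) \<otimes>\<^bsub>P\<^esub> s)"
    and S: "S = h 0 \<otimes>\<^bsub>P\<^esub> s \<ominus>\<^bsub>P\<^esub> h 1 \<otimes>\<^bsub>P\<^esub> (q \<otimes>\<^bsub>P\<^esub> sq_div \<oplus>\<^bsub>P\<^esub> s \<otimes>\<^bsub>P\<^esub> g_div)"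
  shows "(h \<otimes>\<^bsub>A\<^esub> f) 1 = ypow u \<otimes>\<^bsub>P\<^esub> Q"
    "(h \<otimes>\<^bsub>A\<^esub> f) 0 = Q \<otimes>\<^bsub>P\<^esub> g \<oplus>\<^bsub>P\<^esub> ypow v \<otimes>\<^bsub>P\<^esub> S"
proof -
  let ?U = "ypow u" and ?V = "ypow v" and ?W = "ypow (v - u)"
  have c: "h 0 \<in> carrier P" "h 1 \<in> carrier P" using h by auto
  have V: "?V = ?U \<otimes>\<^bsub>P\<^esub> ?W" using uv by (simp add: ypow_add)
  note cl = c q s ypow_closed[of u] ypow_closed[of v] ypow_closed[of "v - u"] g_div_closed sq_div_closed g_closed
  have "(h \<otimes>\<^bsub>A\<^esub> f) 1 = h 0 \<otimes>\<^bsub>P\<^esub> (?U \<otimes>\<^bsub>P\<^esub> q) \<oplus>\<^bsub>P\<^esub>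
      h 1 \<otimes>\<^bsub>P\<^esub> (q \<otimes>\<^bsub>P\<^esub> (?U \<otimes>\<^bsub>P\<^esub> g_div) \<oplus>\<^bsub>P\<^esub> ?U \<otimes>\<^bsub>P\<^esub> ?W \<otimes>\<^bsub>P\<^esub> s)"
    using A_mult_1[OF h f] f1 f0 by (simp add: g_eq[symmetric] V[symmetric])
  also have "\<dots> = ?U \<otimes>\<^bsub>P\<^esub> Q" unfolding Q using cl by algebra
  finally show "(h \<otimes>\<^bsub>A\<^esub> f) 1 = ypow u \<otimes>\<^bsub>P\<^esub> Q" .
  have W: "?W \<otimes>\<^bsub>P\<^esub> g = ?V \<otimes>\<^bsub>P\<^esub> g_div"
  proof -
    have "?W \<otimes>\<^bsub>P\<^esub> g = ?W \<otimes>\<^bsub>P\<^esub> (?U \<otimes>\<^bsub>P\<^esub> g_div)" by (simp add: g_eq[symmetric])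
    also have "\<dots> = (?U \<otimes>\<^bsub>P\<^esub> ?W) \<otimes>\<^bsub>P\<^esub> g_div" using cl by algebra
    finally show ?thesis by (simp add: V[symmetric])
  qed
  \<comment> \<open>The terms are grouped so that the relations for \<open>g_div\<close> g and for
    y^(v-u) g appear as differences, both of which vanish.\<close>
  have "Q \<otimes>\<^bsub>P\<^esub> g \<oplus>\<^bsub>P\<^esub> ?V \<otimes>\<^bsub>P\<^esub> S = h 0 \<otimes>\<^bsub>P\<^esub> (q \<otimes>\<^bsub>P\<^esub> g \<oplus>\<^bsub>P\<^esub> ?V \<otimes>\<^bsub>P\<^esub> s) \<oplus>\<^bsub>P\<^esub>
      h 1 \<otimes>\<^bsub>P\<^esub> (q \<otimes>\<^bsub>P\<^esub> (g_div \<otimes>\<^bsub>P\<^esub> g \<ominus>\<^bsub>P\<^esub> ?V \<otimes>\<^bsub>P\<^esub> sq_div) \<oplus>\<^bsub>P\<^esub> s \<otimes>\<^bsub>P\<^esub> (?W \<otimes>\<^bsub>P\<^esub> g \<ominus>\<^bsub>P\<^esub> ?V \<otimes>\<^bsub>P\<^esub> g_div))"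
    unfolding Q S using cl by algebra
  also have "\<dots> = h 0 \<otimes>\<^bsub>P\<^esub> f 0"
    unfolding W g_div_g f0 using cl by (simp add: a_minus_def P.r_neg)
  finally show "(h \<otimes>\<^bsub>A\<^esub> f) 0 = Q \<otimes>\<^bsub>P\<^esub> g \<oplus>\<^bsub>P\<^esub> ?V \<otimes>\<^bsub>P\<^esub> S"
    using A_mult_0[OF h f] by simp
qed

lemma M_ideal: "ideal M A"
proof (rule A_idealI)
  fix f h assume f: "f \<in> M" and h: "h \<in> carrier A"
  have fA: "f \<in> carrier A" by (rule M_carrier) fact
  obtain q s where qs: "q \<in> carrier P" "s \<in> carrier P" "f 1 = ypow u \<otimes>\<^bsub>P\<^esub> q"
    "f 0 = q \<otimes>\<^bsub>P\<^esub> g \<oplus>\<^bsub>P\<^esub> ypow v \<otimes>\<^bsub>P\<^esub> s" using f M_iff[OF fA] by auto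
  have hP: "h 0 \<in> carrier P" "h 1 \<in> carrier P" using h by auto
  have hf: "h \<otimes>\<^bsub>A\<^esub> f \<in> carrier A" using h fA by simp
  show "h \<otimes>\<^bsub>A\<^esub> f \<in> M"
    unfolding M_iff[OF hf]
    by (intro bexI conjI) (rule mult_M[OF h fA qs refl refl], rule mult_M[OF h fA qs refl refl],
        use qs hP in auto)
next
  show "\<zero>\<^bsub>A\<^esub> \<in> M"
    unfolding M_iff[OF A.zero_closed] by (intro bexI[of _ "\<zero>\<^bsub>P\<^esub>"]) (simp_all add: A_zero(2))
qed (use coords_vanish_subspace in \<open>auto simp: M_def is_subspace_def\<close>)

lemma G_in_M: "G \<in> M"
  unfolding M_iff[OF G_closed]
  by (intro bexI[of _ "\<one>\<^bsub>P\<^esub>"] bexI[of _ "\<zero>\<^bsub>P\<^esub>"]) (simp_all add: G_app)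

lemma y_in_M: "xy_mon F 0 v \<in> M"
  unfolding M_iff[OF xy_mon_closed]
  by (intro bexI[of _ "\<zero>\<^bsub>P\<^esub>"] bexI[of _ "\<one>\<^bsub>P\<^esub>"]) (simp_all add: xy_mon_row)

lemma xx_in_M: "xy_mon F 2 0 \<in> M"
  unfolding M_iff[OF xy_mon_closed]
  by (intro bexI[of _ "\<zero>\<^bsub>P\<^esub>"]) (simp_all add: xy_mon_row)

lemma is_lead_xy_mon: "is_lead (xy_mon F i j) (i, j)"
  by (auto simp: is_lead_def xy_mon_app split: if_splits)

lemma is_lead_G: "is_lead G (1, u)"
  unfolding is_lead_def
proof (intro conjI allI impI)
  show "case_prod G (1, u) \<noteq> \<zero>" by (simp add: G_app ypow_def)
  fix e assume *: "case_prod G e \<noteq> \<zero>"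
  obtain i j where e: "e = (i, j)" by (cases e)
  show "e = (1, u) \<or> mon_less (1, u) e"
    using * g_supp[of j] by (auto simp: e G_app ypow_def mon_less_def powser_zero split: if_splits)
qed

lemma leads_M: "leads M = - boxes [v, u]"
proof
  have up: "(i, j) \<in> leads M" if "(k, l) \<in> leads M" "k \<le> i" "l \<le> j" for i j k l
    using up_closed_leads[OF M_ideal] that unfolding up_closed_def by blast
  have "(0, v) \<in> leads M" "(2, 0) \<in> leads M" "(1, u) \<in> leads M"
    using is_lead_xy_mon is_lead_G G_in_M y_in_M xx_in_M unfolding leads_def by blast+
  then show "- boxes [v, u] \<subseteq> leads M"
  proof (intro subrelI)
    fix i j assume b: "(i, j) \<in> - boxes [v, u]"
    consider "i = 0" | "i = 1" | "2 \<le> i" by linarith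
    then show "(i, j) \<in> leads M"
      using b up[OF \<open>(0, v) \<in> leads M\<close>] up[OF \<open>(1, u) \<in> leads M\<close>] up[OF \<open>(2, 0) \<in> leads M\<close>]
      by cases (auto simp: mem_boxes2)
  qed
qed (rule leads_M_subset)

lemma initial_ideal_M: "initial_ideal F M = diagram_ideal F [v, u]"
  using initial_ideal_eq_iff[OF M_ideal uv] leads_M by simp

lemma M_zero_if_supported: "\<lbrakk>f \<in> M; \<And>i j. f i j \<noteq> \<zero> \<Longrightarrow> (i, j) \<in> boxes [v, u]\<rbrakk> \<Longrightarrow> f = \<zero>\<^bsub>A\<^esub>"
  by (rule M_supported_zero) (auto simp: supported_on_def M_carrier)

text \<open>Because x^2 lies in \<open>M\<close>, only y^b and x y^a have to be tested. For a at
  least u, x y^a differs from the multiple y^(a-u) G by y^(a-u) g, so the last condition says that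
  y^v divides y^(a-u) g.\<close>

lemma diagram_in_M_iff:
  assumes "a \<le> b"
  shows "diagram_ideal F [b, a] \<subseteq> M \<longleftrightarrow> v \<le> b \<and> u \<le> a \<and> (\<forall>j. g j \<noteq> \<zero> \<longrightarrow> u + v \<le> a + j)"
proof -
  have mon: "xy_mon F 0 j \<in> M \<longleftrightarrow> v \<le> j" for j
  proof
    assume "xy_mon F 0 j \<in> M"
    then have "(0, j) \<in> leads M" using is_lead_xy_mon unfolding leads_def by blast
    then show "v \<le> j" by (auto simp: leads_M mem_boxes2)
  next
    assume "v \<le> j"
    then have "xy_mon F 0 j = xy_mon F 0 (j - v) \<otimes>\<^bsub>A\<^esub> xy_mon F 0 v" by (simp add: xy_mon_mult_xy_mon)
    then show "xy_mon F 0 j \<in> M" using y_in_M A_idealD(5)[OF M_ideal] by auto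
  qed
  have mon1: "xy_mon F 1 j \<in> M \<longleftrightarrow> u \<le> j \<and> (\<forall>l. g l \<noteq> \<zero> \<longrightarrow> u + v \<le> j + l)" for j
  proof (cases "u \<le> j")
    case False
    have "xy_mon F 1 j \<notin> M"
    proof
      assume "xy_mon F 1 j \<in> M"
      then have "(1, j) \<in> leads M" using is_lead_xy_mon unfolding leads_def by blast
      then show False using False by (auto simp: leads_M mem_boxes2)
    qed
    then show ?thesis using False by simp
  next
    case True
    have coords: "coords (xy_mon F 1 j) 0 l = \<ominus> (ypow (j - u) \<otimes>\<^bsub>P\<^esub> g) l" for l
    proof -
      have "shift u (ypow j) = ypow (j - u)"
        using True by (auto simp: fun_eq_iff shift_app ypow_def)
      then show ?thesis by (simp add: coords_def xy_mon_row P_minus powser_zero a_minus_def powser_a_inv)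
    qed
    have T1: "coords (xy_mon F 1 j) 1 l = \<zero>" if "l < u" for l
      using that True by (simp add: coords_def xy_mon_app)
    have "xy_mon F 1 j \<in> M \<longleftrightarrow> (\<forall>l<v. \<ominus> (ypow (j - u) \<otimes>\<^bsub>P\<^esub> g) l = \<zero>)"
      using T1 by (auto simp: M_def coords_vanish_def mem_boxes2 coords simp del: One_nat_def)
    also have "\<dots> \<longleftrightarrow> (\<forall>l<v. (ypow (j - u) \<otimes>\<^bsub>P\<^esub> g) l = \<zero>)"
    proof -
      have "\<ominus> c = \<zero> \<longleftrightarrow> c = \<zero>" if "c \<in> carrier F" for c
        using that by (metis minus_minus minus_zero)
      moreover have "(ypow (j - u) \<otimes>\<^bsub>P\<^esub> g) l \<in> carrier F" for l by auto
      ultimately show ?thesis by simp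
    qed
    also have "\<dots> \<longleftrightarrow> (\<forall>l. g l \<noteq> \<zero> \<longrightarrow> u + v \<le> j + l)" (is "?L \<longleftrightarrow> ?R")
    proof
      assume L: ?L
      show ?R
      proof (intro allI impI, rule ccontr)
        fix l assume "g l \<noteq> \<zero>" "\<not> u + v \<le> j + l"
        moreover have "(ypow (j - u) \<otimes>\<^bsub>P\<^esub> g) (l + (j - u)) = g l" by (simp add: ypow_mult del: diff_add_assoc diff_add_assoc2)
        moreover have "l + (j - u) < v" using \<open>\<not> u + v \<le> j + l\<close> True by linarith
        ultimately show False using L by metis
      qed
    next
      assume R: ?R
      show ?L
      proof (intro allI impI, rule ccontr)
        fix l assume l: "l < v" "(ypow (j - u) \<otimes>\<^bsub>P\<^esub> g) l \<noteq> \<zero>"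
        then have "\<not> l < j - u" "g (l - (j - u)) \<noteq> \<zero>" by (auto simp: ypow_mult split: if_splits)
        then show False using R[rule_format, of "l - (j - u)"] l(1) True by auto
      qed
    qed
    finally show ?thesis using True by simp
  qed
  have "diagram_ideal F [b, a] \<subseteq> M \<longleftrightarrow> xy_mon F 0 b \<in> M \<and> xy_mon F 1 a \<in> M"
  proof
    assume "diagram_ideal F [b, a] \<subseteq> M"
    then show "xy_mon F 0 b \<in> M \<and> xy_mon F 1 a \<in> M"
      unfolding diagram_ideal_eq[OF assms] by (auto simp: xy_mon_supported mem_boxes2)
  next
    assume *: "xy_mon F 0 b \<in> M \<and> xy_mon F 1 a \<in> M"
    show "diagram_ideal F [b, a] \<subseteq> M"
      unfolding diagram_ideal_def
    proof (rule A.genideal_minimal[OF M_ideal], safe)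
      fix i j assume "(i, j) \<notin> boxes [b, a]"
      then have "\<exists>k l. xy_mon F k l \<in> M \<and> k \<le> i \<and> l \<le> j"
      proof -
        consider "i = 0" | "i = 1" | "2 \<le> i" by linarith
        then show ?thesis
        proof cases
          case 1 then show ?thesis using * \<open>(i, j) \<notin> _\<close>
            by (intro exI[of _ 0] exI[of _ b]) (auto simp: mem_boxes2)
        next
          case 2 then show ?thesis using * \<open>(i, j) \<notin> _\<close>
            by (intro exI[of _ 1] exI[of _ a]) (auto simp: mem_boxes2)
        next
          case 3 then show ?thesis using xx_in_M by (intro exI[of _ 2] exI[of _ 0]) auto
        qed
      qed
      then obtain k l where kl: "xy_mon F k l \<in> M" "k \<le> i" "l \<le> j" by blast
      then have "xy_mon F i j = xy_mon F (i - k) (j - l) \<otimes>\<^bsub>A\<^esub> xy_mon F k l"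
        by (simp add: xy_mon_mult_xy_mon)
      then show "xy_mon F i j \<in> M" using kl(1) A_idealD(5)[OF M_ideal] by auto
    qed
  qed
  then show ?thesis using mon mon1 by auto
qed

subsection \<open>Degree and rank\<close>

lemma coords_mon:
  assumes "(i, j) \<in> boxes [v, u] \<or> i \<noteq> 1"
  shows "coords (xy_mon F i j) = xy_mon F i j"
proof (rule coords_id)
  have "u + l \<noteq> j" if "i = 1" for l using assms that by (auto simp: mem_boxes2)
  then show "shift u (xy_mon F i j 1) = \<zero>\<^bsub>P\<^esub>"
    by (auto simp: fun_eq_iff shift_app xy_mon_app powser_zero)
qed simp

lemma coords_G: "coords G = xy_mon F 1 u"
proof
  fix i
  have "shift u (ypow u) = ypow 0" by (auto simp: fun_eq_iff shift_app ypow_def)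
  then show "coords G i = xy_mon F 1 u i"
    by (simp add: coords_def G_app xy_mon_row ypow_0 a_minus_def P.r_neg)
qed

lemma M_subset_coords_vanish: "B \<subseteq> boxes [v, u] \<Longrightarrow> M \<subseteq> coords_vanish B"
  by (auto simp: M_def coords_vanish_def)

text \<open>Releasing one box raises the dimension by one: the new functional is the coordinate at
  that box, and the monomial of the box has value 1 there and 0 at the other boxes.\<close>

lemma qdim_coords_vanish:
  assumes "finite B" "B \<subseteq> boxes [v, u]"
  shows "qdim M (card B) (coords_vanish (boxes [v, u] - B))"
  using assms
proof (induction B rule: finite_induct)
  case empty
  then show ?case using qdim_0[OF M_ideal] by (simp add: M_def)
next
  case (insert e B)
  obtain i j where e: "e = (i, j)" by (cases e)
  have b: "(i, j) \<in> boxes [v, u]" using insert e by auto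
  let ?V = "coords_vanish (boxes [v, u] - insert e B)"
  have 1: "coords_vanish (boxes [v, u] - B) = {f \<in> ?V. coords f i j = \<zero>}"
  proof -
    have "boxes [v, u] - B = insert (i, j) (boxes [v, u] - insert e B)"
      using b insert.hyps e by auto
    then show ?thesis by (simp only: coords_vanish_insert)
  qed
  have "qdim M (Suc (card B)) ?V"
  proof (rule qdim_Suc[OF M_ideal coords_vanish_subspace coords_linear[of i j]])
    show "xy_mon F i j \<in> ?V"
      using coords_mon[of i j] b e by (auto simp: coords_vanish_def xy_mon_app)
    show "coords (xy_mon F i j) i j = \<one>" using coords_mon[of i j] b by (simp add: xy_mon_app)
    show "qdim M (card B) {f \<in> ?V. coords f i j = \<zero>}" using insert 1 by auto
    show "M \<subseteq> {f \<in> ?V. coords f i j = \<zero>}" unfolding 1[symmetric] by (intro M_subset_coords_vanish) auto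
  qed
  then show ?case using insert by simp
qed

lemma boxes_eq: "boxes [v, u] = {0} \<times> {..<v} \<union> {1} \<times> {..<u}"
  by (auto simp: mem_boxes2)

lemma card_boxes: "finite (boxes [v, u])" "card (boxes [v, u]) = u + v"
  unfolding boxes_eq by (simp, subst card_Un_disjoint) auto

lemma M_eq_carrier_iff: "M = carrier A \<longleftrightarrow> v = 0"
proof
  assume "M = carrier A"
  then have "xy_mon F 0 0 \<in> M" by simp
  then have "(0, 0) \<in> leads M" using is_lead_xy_mon unfolding leads_def by blast
  then show "v = 0" by (auto simp: leads_M mem_boxes2)
next
  assume "v = 0"
  then show "M = carrier A" unfolding M_def coords_vanish_def using uv by (auto simp: mem_boxes2)
qed

lemma ideal_deg_M: "ideal_deg F M = u + v"
proof (cases "v = 0")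
  case True
  then show ?thesis using ideal_deg_carrier M_eq_carrier_iff uv by simp
next
  case False
  have "qdim M (u + v) (carrier A)"
    using qdim_coords_vanish[OF card_boxes(1) subset_refl] by (simp add: card_boxes coords_vanish_def)
  then show ?thesis
    unfolding ideal_deg_def using quot_dim_eq[OF M_ideal] False M_eq_carrier_iff by auto
qed

end

section \<open>The quotient of \<open>M\<close> by its product with the maximal ideal\<close>

context groebner_ideal
begin

definition N :: "(nat \<Rightarrow> nat \<Rightarrow> 'a) set" where
  "N = max_ideal F \<cdot>\<^bsub>A\<^esub> M"

lemma N_ideal: "ideal N A"
  unfolding N_def by (rule A.ideal_prod_is_ideal[OF max_ideal_ideal M_ideal])

lemma N_subset: "N \<subseteq> M" "N \<subseteq> max_ideal F"
  using A.ideal_prod_inter[OF max_ideal_ideal M_ideal] by (auto simp: N_def)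

lemma N_neq_carrier: "N \<noteq> carrier A"
proof
  assume "N = carrier A"
  then have "cst \<one> \<in> max_ideal F" using N_subset(2) by auto
  then show False by (simp add: mem_max_ideal cst_def)
qed

lemma functional_N:
  assumes "linear_functional \<phi>" "\<And>h f. \<lbrakk>h \<in> max_ideal F; f \<in> M\<rbrakk> \<Longrightarrow> \<phi> (h \<otimes>\<^bsub>A\<^esub> f) = \<zero>" "x \<in> N"
  shows "\<phi> x = \<zero>"
  using assms(3) unfolding N_def
proof (induction rule: ideal_prod.induct)
  case (prod i j)
  then show ?case by (rule assms(2))
next
  case (sum x y)
  then have "x \<in> carrier A" "y \<in> carrier A"
    using A_idealD(1)[OF N_ideal] by (auto simp: N_def)
  then show ?case using sum assms(1) by (auto simp: linear_functional_def)
qed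

text \<open>The first two values are the constant terms of Q and S from \<open>mult_M\<close>.
  Neither h nor \<open>g_div\<close> has a constant term, so only the coefficient of x in h
  survives, and y^(v-u) contributes only if u = v.\<close>

lemma coords_mult_max:
  assumes h: "h \<in> max_ideal F" and f: "f \<in> M"
  shows "coords (h \<otimes>\<^bsub>A\<^esub> f) 1 u = (if u = v then h 1 0 \<otimes> coords f 0 v else \<zero>)"
    and "coords (h \<otimes>\<^bsub>A\<^esub> f) 0 v = \<ominus> (h 1 0 \<otimes> (coords f 1 u \<otimes> sq_div 0))"
    and "coords (h \<otimes>\<^bsub>A\<^esub> f) 2 0 = h 1 0 \<otimes> f 1 0 \<oplus> h 2 0 \<otimes> f 0 0"
proof -
  have hA: "h \<in> carrier A" and h00: "h 0 0 = \<zero>" using h by (auto simp: mem_max_ideal)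
  have fA: "f \<in> carrier A" by (rule M_carrier) fact
  obtain q s where q: "q \<in> carrier P" and s: "s \<in> carrier P" and f1: "f 1 = ypow u \<otimes>\<^bsub>P\<^esub> q"
    and f0: "f 0 = q \<otimes>\<^bsub>P\<^esub> g \<oplus>\<^bsub>P\<^esub> ypow v \<otimes>\<^bsub>P\<^esub> s" using f M_iff[OF fA] by auto
  define Q where "Q = h 0 \<otimes>\<^bsub>P\<^esub> q \<oplus>\<^bsub>P\<^esub> h 1 \<otimes>\<^bsub>P\<^esub> (q \<otimes>\<^bsub>P\<^esub> g_div \<oplus>\<^bsub>P\<^esub> ypow (v - u) \<otimes>\<^bsub>P\<^esub> s)"
  define S where "S = h 0 \<otimes>\<^bsub>P\<^esub> s \<ominus>\<^bsub>P\<^esub> h 1 \<otimes>\<^bsub>P\<^esub> (q \<otimes>\<^bsub>P\<^esub> sq_div \<oplus>\<^bsub>P\<^esub> s \<otimes>\<^bsub>P\<^esub> g_div)"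
  have hP: "h 0 \<in> carrier P" "h 1 \<in> carrier P" using hA by auto
  have QS: "Q \<in> carrier P" "S \<in> carrier P" using hP q s by (auto simp: Q_def S_def)
  have hf: "h \<otimes>\<^bsub>A\<^esub> f \<in> carrier A" using hA fA by simp
  note Thf = coords_eq[OF hf QS mult_M[OF hA fA q s f1 f0 Q_def S_def]]
  note Tf = coords_eq[OF fA q s f1 f0]
  have "Q 0 = h 1 0 \<otimes> (ypow (v - u) 0 \<otimes> s 0)"
    using hP q s h00 by (simp add: Q_def powser_add powser_mult_0 g_div_0)
  then show "coords (h \<otimes>\<^bsub>A\<^esub> f) 1 u = (if u = v then h 1 0 \<otimes> coords f 0 v else \<zero>)"
    using Thf Tf uv hP s by (auto simp: ypow_def)
  have "S 0 = \<ominus> (h 1 0 \<otimes> (q 0 \<otimes> sq_div 0))"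
    using hP q s h00 by (simp add: S_def powser_add P_minus powser_mult_0 g_div_0, simp add: a_minus_def)
  then show "coords (h \<otimes>\<^bsub>A\<^esub> f) 0 v = \<ominus> (h 1 0 \<otimes> (coords f 1 u \<otimes> sq_div 0))"
    using Thf Tf by simp
  show "coords (h \<otimes>\<^bsub>A\<^esub> f) 2 0 = h 1 0 \<otimes> f 1 0 \<oplus> h 2 0 \<otimes> f 0 0"
    using hA fA h00 by (simp add: coords_def A_mult_2 powser_add powser_mult_0)
qed

lemma M_0_0: "f \<in> M \<Longrightarrow> 0 < v \<Longrightarrow> f 0 0 = \<zero>"
proof -
  assume f: "f \<in> M" and v: "0 < v"
  have fA: "f \<in> carrier A" by (rule M_carrier) fact
  have "coords f 0 0 = f 0 0 \<ominus> shift u (f 1) 0 \<otimes> g 0"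
    using fA by (simp add: coords_def P_minus powser_mult_0)
  moreover have "g 0 = \<zero>" using g_supp[of 0] by auto
  moreover have "coords f 0 0 = \<zero>" using f v by (auto simp: M_def coords_vanish_def mem_boxes2)
  ultimately show "f 0 0 = \<zero>" using fA by (simp add: a_minus_def)
qed

lemma M_1_0: "f \<in> M \<Longrightarrow> 0 < u \<Longrightarrow> f 1 0 = \<zero>"
proof -
  assume f: "f \<in> M" and u: "0 < u"
  have "coords f 1 0 = \<zero>" using f u by (auto simp: M_def coords_vanish_def mem_boxes2)
  then show "f 1 0 = \<zero>" by (simp add: coords_def)
qed

lemma coords_mult_max_zero:
  assumes h: "h \<in> max_ideal F" and f: "f \<in> M"
  shows "u < v \<Longrightarrow> coords (h \<otimes>\<^bsub>A\<^esub> f) 1 u = \<zero>"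
    and "sq_div 0 = \<zero> \<Longrightarrow> coords (h \<otimes>\<^bsub>A\<^esub> f) 0 v = \<zero>"
    and "0 < u \<Longrightarrow> coords (h \<otimes>\<^bsub>A\<^esub> f) 2 0 = \<zero>"
proof -
  have c: "h 1 0 \<in> carrier F" "h 2 0 \<in> carrier F" using h by (simp_all add: mem_max_ideal)
  have Tc: "coords f 1 u \<in> carrier F" using M_carrier[OF f] by simp
  show "u < v \<Longrightarrow> coords (h \<otimes>\<^bsub>A\<^esub> f) 1 u = \<zero>"
    unfolding coords_mult_max[OF h f] by simp
  show "sq_div 0 = \<zero> \<Longrightarrow> coords (h \<otimes>\<^bsub>A\<^esub> f) 0 v = \<zero>"
    unfolding coords_mult_max[OF h f] using Tc c by simp
  show "0 < u \<Longrightarrow> coords (h \<otimes>\<^bsub>A\<^esub> f) 2 0 = \<zero>"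
    unfolding coords_mult_max[OF h f] using M_0_0[OF f] M_1_0[OF f] c uv by simp
qed

lemma prod_in_N: "\<lbrakk>h \<in> max_ideal F; f \<in> M\<rbrakk> \<Longrightarrow> h \<otimes>\<^bsub>A\<^esub> f \<in> N"
  unfolding N_def by (rule ideal_prod.prod)

text \<open>The ring acts on the quotient of \<open>M\<close> by \<open>N\<close> through constant
  terms, because r minus its constant term lies in the maximal ideal.\<close>

lemma mult_cong_N:
  assumes r: "r \<in> carrier A" and f: "f \<in> M"
  shows "r \<otimes>\<^bsub>A\<^esub> f \<ominus>\<^bsub>A\<^esub> cst (r 0 0) \<otimes>\<^bsub>A\<^esub> f \<in> N"
proof -
  have fA: "f \<in> carrier A" by (rule M_carrier) fact
  have c: "cst (r 0 0) \<in> carrier A" using r by simp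
  have "r \<ominus>\<^bsub>A\<^esub> cst (r 0 0) \<in> max_ideal F"
    using r c by (simp add: mem_max_ideal A_minus P_minus) (simp add: cst_def a_minus_def r_neg)
  from prod_in_N[OF this f] show ?thesis
    using r c fA by (simp add: A.minus_eq A.l_distr A.l_minus)
qed

text \<open>In f = q G + s y^v + r x^2 each coefficient may be replaced by its constant term modulo
  \<open>N\<close>. So the three generators span the quotient, and the coordinates provide the
  coefficients.\<close>

lemma M_mod_N:
  assumes f: "f \<in> M"
  shows "f \<ominus>\<^bsub>A\<^esub> (cst (coords f 1 u) \<otimes>\<^bsub>A\<^esub> G \<oplus>\<^bsub>A\<^esub> cst (coords f 0 v) \<otimes>\<^bsub>A\<^esub> xy_mon F 0 v \<oplus>\<^bsub>A\<^esub>
    cst (coords f 2 0) \<otimes>\<^bsub>A\<^esub> xy_mon F 2 0) \<in> N"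
proof -
  have fA: "f \<in> carrier A" by (rule M_carrier) fact
  obtain q s where q: "q \<in> carrier P" and s: "s \<in> carrier P" and f1: "f 1 = ypow u \<otimes>\<^bsub>P\<^esub> q"
    and f0: "f 0 = q \<otimes>\<^bsub>P\<^esub> g \<oplus>\<^bsub>P\<^esub> ypow v \<otimes>\<^bsub>P\<^esub> s" using f M_iff[OF fA] by auto
  note Tf = coords_eq[OF fA q s f1 f0]
  define r where "r = (\<lambda>i. f (i + 2))"
  have r: "r \<in> carrier A" using fA unfolding A_carrier r_def by blast
  let ?y = "xy_mon F 0 v" and ?x = "xy_mon F 2 0"
  have 1: "y_series q \<otimes>\<^bsub>A\<^esub> G \<ominus>\<^bsub>A\<^esub> cst (coords f 1 u) \<otimes>\<^bsub>A\<^esub> G \<in> N"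
    using mult_cong_N[OF y_series_closed[OF q] G_in_M] by (simp only: y_series_app Tf if_True refl)
  have 2: "y_series s \<otimes>\<^bsub>A\<^esub> ?y \<ominus>\<^bsub>A\<^esub> cst (coords f 0 v) \<otimes>\<^bsub>A\<^esub> ?y \<in> N"
    using mult_cong_N[OF y_series_closed[OF s] y_in_M] by (simp only: y_series_app Tf if_True refl)
  have 3: "r \<otimes>\<^bsub>A\<^esub> ?x \<ominus>\<^bsub>A\<^esub> cst (coords f 2 0) \<otimes>\<^bsub>A\<^esub> ?x \<in> N"
    using mult_cong_N[OF r xx_in_M] by (simp add: coords_def r_def numeral_2_eq_2)
  have c: "cst (coords f 1 u) \<in> carrier A" "cst (coords f 0 v) \<in> carrier A" "cst (coords f 2 0) \<in> carrier A"
    using fA by auto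
  note cl = c r y_series_closed[OF q] y_series_closed[OF s] G_closed xy_mon_closed[of 0 v] xy_mon_closed[of 2 0]
  have f_eq: "f = y_series q \<otimes>\<^bsub>A\<^esub> G \<oplus>\<^bsub>A\<^esub> y_series s \<otimes>\<^bsub>A\<^esub> ?y \<oplus>\<^bsub>A\<^esub> ?x \<otimes>\<^bsub>A\<^esub> r"
    unfolding r_def by (rule decompose[OF fA q s f1 f0])
  have "(y_series q \<otimes>\<^bsub>A\<^esub> G \<oplus>\<^bsub>A\<^esub> y_series s \<otimes>\<^bsub>A\<^esub> ?y \<oplus>\<^bsub>A\<^esub> ?x \<otimes>\<^bsub>A\<^esub> r) \<ominus>\<^bsub>A\<^esub> (cst (coords f 1 u) \<otimes>\<^bsub>A\<^esub> G \<oplus>\<^bsub>A\<^esub> cst (coords f 0 v) \<otimes>\<^bsub>A\<^esub> ?y \<oplus>\<^bsub>A\<^esub> cst (coords f 2 0) \<otimes>\<^bsub>A\<^esub> ?x) =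
    (y_series q \<otimes>\<^bsub>A\<^esub> G \<ominus>\<^bsub>A\<^esub> cst (coords f 1 u) \<otimes>\<^bsub>A\<^esub> G) \<oplus>\<^bsub>A\<^esub> (y_series s \<otimes>\<^bsub>A\<^esub> ?y \<ominus>\<^bsub>A\<^esub> cst (coords f 0 v) \<otimes>\<^bsub>A\<^esub> ?y) \<oplus>\<^bsub>A\<^esub>
    (r \<otimes>\<^bsub>A\<^esub> ?x \<ominus>\<^bsub>A\<^esub> cst (coords f 2 0) \<otimes>\<^bsub>A\<^esub> ?x)"
    using cl by algebra
  then show ?thesis using 1 2 3 A_idealD(3)[OF N_ideal] f_eq by simp
qed

lemma x_in_max: "xy_mon F 1 0 \<in> max_ideal F"
  by (simp add: mem_max_ideal xy_mon_app)

text \<open>The syzygy \<open>x G = (g / y\<^sup>u) G + y\<^sup>u x\<^sup>2 - sq_div y\<^sup>v\<close>, in which the constant term of \<open>g / y\<^sup>u\<close> vanishes.\<close>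

lemma relation_N:
  "cst (sq_div 0) \<otimes>\<^bsub>A\<^esub> xy_mon F 0 v \<ominus>\<^bsub>A\<^esub> cst (if u = 0 then \<one> else \<zero>) \<otimes>\<^bsub>A\<^esub> xy_mon F 2 0 \<in> N"
proof -
  let ?y = "xy_mon F 0 v" and ?x = "xy_mon F 2 0"
  let ?K = "y_series sq_div" and ?Y = "y_series (ypow u)" and ?H = "y_series g_div" and ?X = "xy_mon F 1 0"
  have g_div_ypow: "g_div \<otimes>\<^bsub>P\<^esub> ypow u = g"
    using g_eq by (simp add: P.m_comm)
  define U where "U = cst (if u = 0 then \<one> else \<zero>)"
  have syz: "?K \<otimes>\<^bsub>A\<^esub> ?y \<oplus>\<^bsub>A\<^esub> ?X \<otimes>\<^bsub>A\<^esub> G = ?H \<otimes>\<^bsub>A\<^esub> G \<oplus>\<^bsub>A\<^esub> ?Y \<otimes>\<^bsub>A\<^esub> ?x"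
  proof
    fix i :: nat
    consider "i = 0" | "i = Suc 0" | l where "i = Suc (Suc l)" by (metis not0_implies_Suc)
    then show "(?K \<otimes>\<^bsub>A\<^esub> ?y \<oplus>\<^bsub>A\<^esub> ?X \<otimes>\<^bsub>A\<^esub> G) i = (?H \<otimes>\<^bsub>A\<^esub> G \<oplus>\<^bsub>A\<^esub> ?Y \<otimes>\<^bsub>A\<^esub> ?x) i"
    proof cases
      case 1
      then show ?thesis
        by (simp add: A_add xy_mon_mult y_series_mult xy_mon_row G_app g_div_g P.m_comm)
    next
      case 2
      then show ?thesis
        by (simp add: A_add xy_mon_mult y_series_mult xy_mon_row G_app ypow_0 g_div_ypow)
    next
      case 3
      then show ?thesis
        by (auto simp add: A_add xy_mon_mult y_series_mult xy_mon_row G_app ypow_0)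
    qed
  qed
  have Hm: "?H \<in> max_ideal F" by (simp add: mem_max_ideal y_series_app g_div_0)
  have 1: "?H \<otimes>\<^bsub>A\<^esub> G \<ominus>\<^bsub>A\<^esub> ?X \<otimes>\<^bsub>A\<^esub> G \<in> N"
    using prod_in_N[OF Hm G_in_M] prod_in_N[OF x_in_max G_in_M] A_idealD(4)[OF N_ideal] by blast
  have 2: "?K \<otimes>\<^bsub>A\<^esub> ?y \<ominus>\<^bsub>A\<^esub> cst (sq_div 0) \<otimes>\<^bsub>A\<^esub> ?y \<in> N"
    using mult_cong_N[OF y_series_closed[OF sq_div_closed] y_in_M] by (simp add: y_series_app)
  have 3: "?Y \<otimes>\<^bsub>A\<^esub> ?x \<ominus>\<^bsub>A\<^esub> U \<otimes>\<^bsub>A\<^esub> ?x \<in> N"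
  proof -
    have "y_series (ypow u) 0 0 = (if u = 0 then \<one> else \<zero>)" by (auto simp: y_series_app ypow_def)
    then show ?thesis using mult_cong_N[OF y_series_closed[OF ypow_closed[of u]] xx_in_M] by (simp only: U_def)
  qed
  have c: "cst (sq_div 0) \<in> carrier A" "U \<in> carrier A" by (auto simp: U_def)
  note cl = c y_series_closed[OF sq_div_closed] y_series_closed[OF ypow_closed[of u]] y_series_closed[OF g_div_closed] G_closed
    xy_mon_closed[of 0 v] xy_mon_closed[of 2 0] xy_mon_closed[of 1 0]
  have "?K \<otimes>\<^bsub>A\<^esub> ?y = (?K \<otimes>\<^bsub>A\<^esub> ?y \<oplus>\<^bsub>A\<^esub> ?X \<otimes>\<^bsub>A\<^esub> G) \<ominus>\<^bsub>A\<^esub> ?X \<otimes>\<^bsub>A\<^esub> G" using cl by algebra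
  then have K: "?K \<otimes>\<^bsub>A\<^esub> ?y = (?H \<otimes>\<^bsub>A\<^esub> G \<oplus>\<^bsub>A\<^esub> ?Y \<otimes>\<^bsub>A\<^esub> ?x) \<ominus>\<^bsub>A\<^esub> ?X \<otimes>\<^bsub>A\<^esub> G" by (simp only: syz)
  have "cst (sq_div 0) \<otimes>\<^bsub>A\<^esub> ?y \<ominus>\<^bsub>A\<^esub> U \<otimes>\<^bsub>A\<^esub> ?x =
      ?K \<otimes>\<^bsub>A\<^esub> ?y \<ominus>\<^bsub>A\<^esub> (?K \<otimes>\<^bsub>A\<^esub> ?y \<ominus>\<^bsub>A\<^esub> cst (sq_div 0) \<otimes>\<^bsub>A\<^esub> ?y) \<ominus>\<^bsub>A\<^esub> U \<otimes>\<^bsub>A\<^esub> ?x"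
    using cl by algebra
  also have "\<dots> = ((?H \<otimes>\<^bsub>A\<^esub> G \<oplus>\<^bsub>A\<^esub> ?Y \<otimes>\<^bsub>A\<^esub> ?x) \<ominus>\<^bsub>A\<^esub> ?X \<otimes>\<^bsub>A\<^esub> G) \<ominus>\<^bsub>A\<^esub> (?K \<otimes>\<^bsub>A\<^esub> ?y \<ominus>\<^bsub>A\<^esub> cst (sq_div 0) \<otimes>\<^bsub>A\<^esub> ?y) \<ominus>\<^bsub>A\<^esub> U \<otimes>\<^bsub>A\<^esub> ?x"
    by (subst K) simp
  also have "\<dots> = (?H \<otimes>\<^bsub>A\<^esub> G \<ominus>\<^bsub>A\<^esub> ?X \<otimes>\<^bsub>A\<^esub> G) \<oplus>\<^bsub>A\<^esub> (?Y \<otimes>\<^bsub>A\<^esub> ?x \<ominus>\<^bsub>A\<^esub> U \<otimes>\<^bsub>A\<^esub> ?x) \<ominus>\<^bsub>A\<^esub>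
      (?K \<otimes>\<^bsub>A\<^esub> ?y \<ominus>\<^bsub>A\<^esub> cst (sq_div 0) \<otimes>\<^bsub>A\<^esub> ?y)"
    using cl by algebra
  also have "\<dots> \<in> N" using 1 2 3 A_idealD(3,4)[OF N_ideal] by blast
  finally show ?thesis by (simp only: U_def)
qed

lemma N_I:
  assumes f: "f \<in> M" and "cst (coords f 1 u) \<otimes>\<^bsub>A\<^esub> G \<oplus>\<^bsub>A\<^esub> cst (coords f 0 v) \<otimes>\<^bsub>A\<^esub> xy_mon F 0 v \<oplus>\<^bsub>A\<^esub>
    cst (coords f 2 0) \<otimes>\<^bsub>A\<^esub> xy_mon F 2 0 \<in> N" (is "?e \<in> N")
  shows "f \<in> N"
proof -
  have "f \<in> carrier A" "?e \<in> carrier A" using M_carrier[OF f] by auto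
  then have "f = (f \<ominus>\<^bsub>A\<^esub> ?e) \<oplus>\<^bsub>A\<^esub> ?e" by algebra
  then show ?thesis using A_idealD(3)[OF N_ideal M_mod_N[OF f] assms(2)] by simp
qed

lemma cst_0_mult: "f \<in> carrier A \<Longrightarrow> cst \<zero> \<otimes>\<^bsub>A\<^esub> f = \<zero>\<^bsub>A\<^esub>"
  by (auto simp: fun_eq_iff cst_mult A_zero_app)

lemma N_I3:
  assumes "f \<in> M" "cst (coords f 1 u) \<otimes>\<^bsub>A\<^esub> G \<in> N" "cst (coords f 0 v) \<otimes>\<^bsub>A\<^esub> xy_mon F 0 v \<in> N"
    "cst (coords f 2 0) \<otimes>\<^bsub>A\<^esub> xy_mon F 2 0 \<in> N"
  shows "f \<in> N"
  by (rule N_I[OF assms(1)]) (rule A_idealD(3)[OF N_ideal A_idealD(3)[OF N_ideal assms(2,3)] assms(4)])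

lemma cst_zero_N: "\<lbrakk>c = \<zero>; w \<in> carrier A\<rbrakk> \<Longrightarrow> cst c \<otimes>\<^bsub>A\<^esub> w \<in> N"
  using A_idealD(2)[OF N_ideal] by (simp only: cst_0_mult)

lemma coords_gens: "coords G 1 u = \<one>" "coords (xy_mon F 0 v) 0 v = \<one>" "coords (xy_mon F 2 0) 2 0 = \<one>"
  "coords (xy_mon F 0 v) 1 u = \<zero>" "coords (xy_mon F 2 0) 1 u = \<zero>" "coords (xy_mon F 2 0) 0 v = \<zero>"
  "coords (xy_mon F 0 v) 2 0 = \<zero>"
  using coords_mon[of 0 v] coords_mon[of 2 0] coords_G by (simp_all add: xy_mon_app)

lemma rho_eqI: "qdim N n M \<Longrightarrow> rho F M = n"
  unfolding rho_def N_def[symmetric] by (rule quot_dim_eq[OF N_ideal N_neq_carrier])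

text \<open>Here all three coordinates vanish on \<open>N\<close>, and by \<open>M_mod_N\<close>
  their common kernel in \<open>M\<close> is no larger than \<open>N\<close>.\<close>

lemma rho_3:
  assumes "0 < u" "u < v" "sq_div 0 = \<zero>"
  shows "rho F M = 3"
proof -
  let ?V1 = "{f \<in> M. coords f 1 u = \<zero>}"
  let ?V2 = "{f \<in> ?V1. coords f 0 v = \<zero>}"
  let ?V3 = "{f \<in> ?V2. coords f 2 0 = \<zero>}"
  have N: "N = ?V3"
  proof (intro equalityI subsetI)
    fix f assume f: "f \<in> N"
    have "coords f 1 u = \<zero>" "coords f 0 v = \<zero>" "coords f 2 0 = \<zero>"
      by (rule functional_N[OF coords_linear _ f]; rule coords_mult_max_zero; use assms in simp)+
    then show "f \<in> ?V3" using f N_subset by auto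
  next
    fix f assume "f \<in> ?V3"
    then have f: "f \<in> M" "coords f 1 u = \<zero>" "coords f 0 v = \<zero>" "coords f 2 0 = \<zero>" by auto
    from N_I3[OF f(1) cst_zero_N[OF f(2) G_closed] cst_zero_N[OF f(3) xy_mon_closed]
        cst_zero_N[OF f(4) xy_mon_closed]]
    show "f \<in> N" .
  qed
  have M: "is_subspace M" by (rule is_subspace_ideal[OF M_ideal])
  have s1: "is_subspace ?V1" by (rule is_subspace_ker[OF M coords_linear])
  have s2: "is_subspace ?V2" by (rule is_subspace_ker[OF s1 coords_linear])
  have W0: "qdim N 0 ?V3" using qdim_0[OF N_ideal] N by simp
  have W1: "qdim N (Suc 0) ?V2"
    by (rule qdim_Suc[OF N_ideal s2 coords_linear _ _ W0, of "xy_mon F 2 0"]) (use N coords_gens xx_in_M in auto)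
  have W2: "qdim N (Suc (Suc 0)) ?V1"
    by (rule qdim_Suc[OF N_ideal s1 coords_linear _ _ W1, of "xy_mon F 0 v"]) (use N coords_gens y_in_M in auto)
  have "qdim N (Suc (Suc (Suc 0))) M"
    by (rule qdim_Suc[OF N_ideal M coords_linear _ _ W2, of G]) (use N coords_gens G_in_M in auto)
  then show ?thesis using rho_eqI by (simp add: numeral_3_eq_3)
qed

lemma rho_2_by_functionals:
  assumes "linear_functional \<phi>" "linear_functional \<psi>"
    and "\<And>h f. \<lbrakk>h \<in> max_ideal F; f \<in> M\<rbrakk> \<Longrightarrow> \<phi> (h \<otimes>\<^bsub>A\<^esub> f) = \<zero> \<and> \<psi> (h \<otimes>\<^bsub>A\<^esub> f) = \<zero>"
    and "\<And>f. \<lbrakk>f \<in> M; \<phi> f = \<zero>; \<psi> f = \<zero>\<rbrakk> \<Longrightarrow> f \<in> N"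
    and "w \<in> M" "\<phi> w = \<one>" "z \<in> M" "\<phi> z = \<zero>" "\<psi> z = \<one>"
  shows "rho F M = 2"
proof -
  let ?V1 = "{f \<in> M. \<phi> f = \<zero>}"
  let ?V2 = "{f \<in> ?V1. \<psi> f = \<zero>}"
  have N: "N = ?V2"
  proof (intro equalityI subsetI)
    fix f assume f: "f \<in> N"
    have "\<phi> f = \<zero>" by (rule functional_N[OF assms(1) _ f]) (use assms(3) in blast)
    moreover have "\<psi> f = \<zero>" by (rule functional_N[OF assms(2) _ f]) (use assms(3) in blast)
    ultimately show "f \<in> ?V2" using f N_subset by auto
  qed (use assms(4) in auto)
  have M: "is_subspace M" by (rule is_subspace_ideal[OF M_ideal])
  have s1: "is_subspace ?V1" by (rule is_subspace_ker[OF M assms(1)])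
  have W0: "qdim N 0 ?V2" using qdim_0[OF N_ideal] N by simp
  have W1: "qdim N (Suc 0) ?V1"
    by (rule qdim_Suc[OF N_ideal s1 assms(2) _ _ W0, of z]) (use N assms in auto)
  have "qdim N (Suc (Suc 0)) M"
    by (rule qdim_Suc[OF N_ideal M assms(1) _ _ W1, of w]) (use N assms in auto)
  then show ?thesis using rho_eqI by (simp add: numeral_2_eq_2)
qed

text \<open>The relation has a unit as its coefficient at y^v and 0 at x^2. Hence y^v lies in
  \<open>N\<close>, and G and x^2 remain.\<close>

lemma rho_2_square:
  assumes "0 < u" "u < v" "sq_div 0 \<noteq> \<zero>"
  shows "rho F M = 2"
proof (rule rho_2_by_functionals[OF coords_linear coords_linear, of 1 u 2 0 G "xy_mon F 2 0"])
  have ku: "sq_div 0 \<in> Units F" using assms(3) field_Units by auto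
  have "cst (sq_div 0) \<otimes>\<^bsub>A\<^esub> xy_mon F 0 v \<in> N"
  proof -
    have c: "cst (sq_div 0) \<otimes>\<^bsub>A\<^esub> xy_mon F 0 v \<in> carrier A" by auto
    have "(if u = 0 then \<one> else \<zero>) = \<zero>" using assms(1) by simp
    then have "cst (sq_div 0) \<otimes>\<^bsub>A\<^esub> xy_mon F 0 v \<ominus>\<^bsub>A\<^esub> \<zero>\<^bsub>A\<^esub> \<in> N"
      using relation_N by (simp only: cst_0_mult[OF xy_mon_closed])
    moreover have "cst (sq_div 0) \<otimes>\<^bsub>A\<^esub> xy_mon F 0 v \<ominus>\<^bsub>A\<^esub> \<zero>\<^bsub>A\<^esub> = cst (sq_div 0) \<otimes>\<^bsub>A\<^esub> xy_mon F 0 v"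
      using c by algebra
    ultimately show ?thesis by (simp only:)
  qed
  then have "cst (inv (sq_div 0)) \<otimes>\<^bsub>A\<^esub> (cst (sq_div 0) \<otimes>\<^bsub>A\<^esub> xy_mon F 0 v) \<in> N"
    using A_idealD(5)[OF N_ideal _ cst_closed[OF Units_inv_closed[OF ku]]] by (simp only:)
  moreover have "cst (inv (sq_div 0)) \<otimes>\<^bsub>A\<^esub> (cst (sq_div 0) \<otimes>\<^bsub>A\<^esub> xy_mon F 0 v) = xy_mon F 0 v"
  proof (intro ext)
    fix i j
    have y: "xy_mon F 0 v i j \<in> carrier F" by simp
    have "(cst (inv (sq_div 0)) \<otimes>\<^bsub>A\<^esub> (cst (sq_div 0) \<otimes>\<^bsub>A\<^esub> xy_mon F 0 v)) i j = inv (sq_div 0) \<otimes> (sq_div 0 \<otimes> xy_mon F 0 v i j)"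
      using Units_inv_closed[OF ku] Units_closed[OF ku] by (simp add: cst_mult)
    also have "\<dots> = xy_mon F 0 v i j"
      using m_assoc[OF Units_inv_closed[OF ku] Units_closed[OF ku] y] Units_l_inv[OF ku] y by simp
    finally show "(cst (inv (sq_div 0)) \<otimes>\<^bsub>A\<^esub> (cst (sq_div 0) \<otimes>\<^bsub>A\<^esub> xy_mon F 0 v)) i j = xy_mon F 0 v i j" .
  qed
  ultimately have y: "xy_mon F 0 v \<in> N" by simp
  fix f assume f: "f \<in> M" "coords f 1 u = \<zero>" "coords f 2 0 = \<zero>"
  have "cst (coords f 0 v) \<otimes>\<^bsub>A\<^esub> xy_mon F 0 v \<in> N"
    by (rule A_idealD(5)[OF N_ideal y cst_closed[OF coords_closed[OF M_carrier[OF f(1)]]]])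
  from N_I3[OF f(1) cst_zero_N[OF f(2) G_closed] this cst_zero_N[OF f(3) xy_mon_closed]]
  show "f \<in> N" .
next
  show "coords (h \<otimes>\<^bsub>A\<^esub> f) 1 u = \<zero> \<and> coords (h \<otimes>\<^bsub>A\<^esub> f) 2 0 = \<zero>"
    if "h \<in> max_ideal F" "f \<in> M" for h f
    using coords_mult_max_zero[OF that] assms by blast
qed (use coords_gens G_in_M xx_in_M in auto)

text \<open>For u = 0 the relation identifies x^2 with \<open>sq_div 0\<close> times y^v. The
  coordinates at y^v and x^2 therefore enter only through the combination that vanishes on this
  relation.\<close>

lemma rho_2_one_row:
  assumes "u = 0" "0 < v"
  shows "rho F M = 2"
proof (rule rho_2_by_functionals[OF coords_linear, of "\<lambda>f. coords f 0 v \<oplus> sq_div 0 \<otimes> coords f 2 0" 1 u G "xy_mon F 0 v"])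
  show "linear_functional (\<lambda>f. coords f 0 v \<oplus> sq_div 0 \<otimes> coords f 2 0)"
    by (auto simp: linear_functional_def coords_add coords_cst_mult r_distr m_lcomm a_ac)
next
  fix h f assume h: "h \<in> max_ideal F" and f: "f \<in> M"
  have hA: "h \<in> carrier A" using h by (simp add: mem_max_ideal)
  have fA: "f \<in> carrier A" by (rule M_carrier) fact
  have "coords f 1 u = f 1 u" by (simp add: coords_def)
  also have "\<dots> = f 1 0" using assms(1) by simp
  finally have Tf: "coords f 1 u = f 1 0" .
  show "coords (h \<otimes>\<^bsub>A\<^esub> f) 1 u = \<zero> \<and> coords (h \<otimes>\<^bsub>A\<^esub> f) 0 v \<oplus> sq_div 0 \<otimes> coords (h \<otimes>\<^bsub>A\<^esub> f) 2 0 = \<zero>"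
  proof -
    have c: "h 1 0 \<in> carrier F" "h 2 0 \<in> carrier F" "f 1 0 \<in> carrier F" "sq_div 0 \<in> carrier F"
      using hA fA by auto
    have "\<ominus> (h 1 0 \<otimes> (f 1 0 \<otimes> sq_div 0)) \<oplus> sq_div 0 \<otimes> (h 1 0 \<otimes> f 1 0 \<oplus> h 2 0 \<otimes> \<zero>) = \<zero>"
      using c by algebra
    moreover have "u \<noteq> v" using assms by simp
    ultimately show ?thesis
      unfolding coords_mult_max[OF h f] Tf M_0_0[OF f assms(2)] by (simp only: if_False simp_thms)
  qed
next
  fix f assume f: "f \<in> M" "coords f 1 u = \<zero>" "coords f 0 v \<oplus> sq_div 0 \<otimes> coords f 2 0 = \<zero>"
  let ?c = "coords f 2 0" and ?y = "xy_mon F 0 v" and ?x = "xy_mon F 2 0"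
  have fA: "f \<in> carrier A" by (rule M_carrier) fact
  have c: "?c \<in> carrier F" using fA by simp
  have b: "coords f 0 v = \<ominus> (sq_div 0 \<otimes> ?c)" using c fA by (intro minus_equality[OF f(3), symmetric]) auto
  have "cst (\<ominus> ?c) \<otimes>\<^bsub>A\<^esub> (cst (sq_div 0) \<otimes>\<^bsub>A\<^esub> ?y \<ominus>\<^bsub>A\<^esub> cst (if u = 0 then \<one> else \<zero>) \<otimes>\<^bsub>A\<^esub> ?x) \<in> N"
    by (rule A_idealD(5)[OF N_ideal relation_N cst_closed[OF a_inv_closed[OF c]]])
  moreover have "cst (\<ominus> ?c) \<otimes>\<^bsub>A\<^esub> (cst (sq_div 0) \<otimes>\<^bsub>A\<^esub> ?y \<ominus>\<^bsub>A\<^esub> cst (if u = 0 then \<one> else \<zero>) \<otimes>\<^bsub>A\<^esub> ?x) =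
      cst (coords f 1 u) \<otimes>\<^bsub>A\<^esub> G \<oplus>\<^bsub>A\<^esub> cst (coords f 0 v) \<otimes>\<^bsub>A\<^esub> ?y \<oplus>\<^bsub>A\<^esub> cst ?c \<otimes>\<^bsub>A\<^esub> ?x"
  proof (intro ext)
    fix i j
    have m: "?y i j \<in> carrier F" "?x i j \<in> carrier F" by simp_all
    have kc: "sq_div 0 \<in> carrier F" by simp
    have Gm: "G i j \<in> carrier F" by simp
    have 1: "(cst (\<ominus> ?c) \<otimes>\<^bsub>A\<^esub> (cst p \<otimes>\<^bsub>A\<^esub> ?y \<ominus>\<^bsub>A\<^esub> cst d \<otimes>\<^bsub>A\<^esub> ?x)) i j =
        \<ominus> ?c \<otimes> (p \<otimes> ?y i j \<ominus> d \<otimes> ?x i j)" if "p \<in> carrier F" "d \<in> carrier F" for p d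
      using that c by (simp add: cst_mult A_minus P_minus)
    have 2: "(cst p \<otimes>\<^bsub>A\<^esub> G \<oplus>\<^bsub>A\<^esub> cst d \<otimes>\<^bsub>A\<^esub> ?y \<oplus>\<^bsub>A\<^esub> cst ?c \<otimes>\<^bsub>A\<^esub> ?x) i j =
        p \<otimes> G i j \<oplus> d \<otimes> ?y i j \<oplus> ?c \<otimes> ?x i j" if "p \<in> carrier F" "d \<in> carrier F" for p d
      using that c by (simp add: cst_mult A_add powser_add)
    have "\<ominus> ?c \<otimes> (sq_div 0 \<otimes> ?y i j \<ominus> \<one> \<otimes> ?x i j) =
        \<zero> \<otimes> G i j \<oplus> \<ominus> (sq_div 0 \<otimes> ?c) \<otimes> ?y i j \<oplus> ?c \<otimes> ?x i j"
      using m kc c Gm by algebra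
    then show "(cst (\<ominus> ?c) \<otimes>\<^bsub>A\<^esub> (cst (sq_div 0) \<otimes>\<^bsub>A\<^esub> ?y \<ominus>\<^bsub>A\<^esub> cst (if u = 0 then \<one> else \<zero>) \<otimes>\<^bsub>A\<^esub> ?x)) i j =
      (cst (coords f 1 u) \<otimes>\<^bsub>A\<^esub> G \<oplus>\<^bsub>A\<^esub> cst (coords f 0 v) \<otimes>\<^bsub>A\<^esub> ?y \<oplus>\<^bsub>A\<^esub> cst ?c \<otimes>\<^bsub>A\<^esub> ?x) i j"
      unfolding b f(2) if_P[OF assms(1)] 1[OF kc one_closed] 2[OF zero_closed a_inv_closed[OF m_closed[OF kc c]]] .
  qed
  ultimately have "cst (coords f 1 u) \<otimes>\<^bsub>A\<^esub> G \<oplus>\<^bsub>A\<^esub> cst (coords f 0 v) \<otimes>\<^bsub>A\<^esub> ?y \<oplus>\<^bsub>A\<^esub> cst ?c \<otimes>\<^bsub>A\<^esub> ?x \<in> N"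
    by (simp only:)
  then show "f \<in> N" by (rule N_I[OF f(1)])
next
  show "coords (xy_mon F 0 v) 0 v \<oplus> sq_div 0 \<otimes> coords (xy_mon F 0 v) 2 0 = \<one>" by (simp add: coords_gens)
qed (rule G_in_M y_in_M coords_gens)+

text \<open>For u = v no degree is left for g, so G = x y^v is a product with an element of the
  maximal ideal, and y^v and x^2 remain.\<close>

lemma rho_2_rectangle:
  assumes "0 < u" "u = v"
  shows "rho F M = 2"
proof (rule rho_2_by_functionals[OF coords_linear coords_linear, of 0 v 2 0 "xy_mon F 0 v" "xy_mon F 2 0"])
  have "g j = \<zero>" for j using g_supp[of j] assms(2) less_asym by blast
  then have g0: "g = \<zero>\<^bsub>P\<^esub>" by (simp add: fun_eq_iff powser_zero)
  then have "p \<otimes>\<^bsub>P\<^esub> g = \<zero>\<^bsub>P\<^esub>" if "p \<in> carrier P" for p using that by simp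
  from this[OF g_div_closed] have k0: "sq_div 0 = \<zero>" by (simp add: sq_div_def shift_app powser_zero)
  show "coords (h \<otimes>\<^bsub>A\<^esub> f) 0 v = \<zero> \<and> coords (h \<otimes>\<^bsub>A\<^esub> f) 2 0 = \<zero>" if "h \<in> max_ideal F" "f \<in> M" for h f
    using coords_mult_max_zero[OF that] assms k0 by blast
  have "xy_mon F 1 0 \<otimes>\<^bsub>A\<^esub> xy_mon F 0 v = G"
  proof -
    have "xy_mon F 1 u i = G i" for i unfolding G_app xy_mon_row by (auto simp: g0)
    then have "xy_mon F 1 u = G" by blast
    then show ?thesis using assms(2) xy_mon_mult_xy_mon[of 1 0 0 v] by (simp only: add_0 add_0_right)
  qed
  then have G: "G \<in> N" using prod_in_N[OF x_in_max y_in_M] by simp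
  fix f assume f: "f \<in> M" "coords f 0 v = \<zero>" "coords f 2 0 = \<zero>"
  have "cst (coords f 1 u) \<otimes>\<^bsub>A\<^esub> G \<in> N"
    by (rule A_idealD(5)[OF N_ideal G cst_closed[OF coords_closed[OF M_carrier[OF f(1)]]]])
  from N_I3[OF f(1) this cst_zero_N[OF f(2) xy_mon_closed] cst_zero_N[OF f(3) xy_mon_closed]]
  show "f \<in> N" .
qed (use assms coords_gens y_in_M xx_in_M in auto)

lemma rho_M:
  assumes "0 < v"
  shows "rho F M = (if 0 < u \<and> (shift u g \<otimes>\<^bsub>P\<^esub> g) v = \<zero> \<and> u < v then 3 else 2)"
proof -
  have "sq_div 0 = (shift u g \<otimes>\<^bsub>P\<^esub> g) v" by (simp add: sq_div_def g_div_def shift_app)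
  then show ?thesis
    using rho_3 rho_2_square rho_2_one_row rho_2_rectangle uv assms by force
qed

end

text \<open>The product of the maximal ideal with the whole ring is the maximal ideal, and taking
  constant terms identifies the quotient with F.\<close>

lemma (in field_powser) rho_carrier: "rho F (carrier A) = 1"
proof -
  let ?N = "max_ideal F \<cdot>\<^bsub>A\<^esub> carrier A"
  have N: "?N = max_ideal F"
  proof
    show "?N \<subseteq> max_ideal F" using A.ideal_prod_inter[OF max_ideal_ideal A.oneideal] by auto
    show "max_ideal F \<subseteq> ?N"
    proof
      fix f assume f: "f \<in> max_ideal F"
      then have "f \<otimes>\<^bsub>A\<^esub> \<one>\<^bsub>A\<^esub> \<in> ?N" by (intro ideal_prod.prod) auto
      then show "f \<in> ?N" using f by (simp add: mem_max_ideal)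
    qed
  qed
  have l: "linear_functional (\<lambda>f. f 0 0)"
    by (auto simp: linear_functional_def A_add powser_add cst_mult)
  have sq_div: "{f \<in> carrier A. f 0 0 = \<zero>} = max_ideal F" by (auto simp: mem_max_ideal)
  have c: "cst \<one> \<in> carrier A" and c1: "cst \<one> 0 0 = \<one>" by (simp, simp add: cst_def)
  have "qdim (max_ideal F) 0 {f \<in> carrier A. f 0 0 = \<zero>}"
    unfolding sq_div by (rule qdim_0[OF max_ideal_ideal])
  from qdim_Suc[OF max_ideal_ideal is_subspace_ideal[OF A.oneideal] l c c1 this]
  have "qdim (max_ideal F) (Suc 0) (carrier A)" by (simp add: sq_div)
  moreover have "max_ideal F \<noteq> carrier A"
    using c c1 mem_max_ideal[of "cst \<one>"] by auto
  ultimately show ?thesis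
    unfolding rho_def N using quot_dim_eq[OF max_ideal_ideal] by auto
qed

section \<open>Reduced Groebner generators and their coefficients\<close>

context groebner_ideal
begin

text \<open>The difference of two candidates lies in \<open>M\<close>, and their leading terms
  cancel. What is left is supported on boxes and therefore zero.\<close>

lemma groebner_gen_eq:
  assumes p: "p \<in> M" and e: "is_lead p e" "case_prod p e = \<one>"
    and sup: "\<And>e'. case_prod p e' \<noteq> \<zero> \<Longrightarrow> e' = e \<or> e' \<in> boxes [v, u]"
  shows "groebner_gen F [v, u] M e = p"
  unfolding groebner_gen_def
proof (rule the_equality)
  show "p \<in> M \<and> lead_exp F p = e \<and> case_prod p e = \<one> \<and>
      (\<forall>e'. case_prod p e' \<noteq> \<zero> \<longrightarrow> e' = e \<or> e' \<in> boxes [v, u])"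
    using assms by (auto simp: lead_exp_eq)
next
  fix f assume f: "f \<in> M \<and> lead_exp F f = e \<and> case_prod f e = \<one> \<and>
      (\<forall>e'. case_prod f e' \<noteq> \<zero> \<longrightarrow> e' = e \<or> e' \<in> boxes [v, u])"
  have fA: "f \<in> carrier A" and pA: "p \<in> carrier A" using f p M_carrier by auto
  have "f \<ominus>\<^bsub>A\<^esub> p = \<zero>\<^bsub>A\<^esub>"
  proof (rule M_zero_if_supported)
    show "f \<ominus>\<^bsub>A\<^esub> p \<in> M" using A_idealD(4)[OF M_ideal] f p by auto
    fix i j assume nz: "(f \<ominus>\<^bsub>A\<^esub> p) i j \<noteq> \<zero>"
    have val: "(f \<ominus>\<^bsub>A\<^esub> p) i j = f i j \<ominus> p i j" using fA pA by (simp add: A_minus P_minus)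
    show "(i, j) \<in> boxes [v, u]"
    proof (rule ccontr)
      assume n: "(i, j) \<notin> boxes [v, u]"
      show False
      proof (cases "(i, j) = e")
        case True
        then have "f i j = \<one>" "p i j = \<one>" using f e by auto
        then show False using nz unfolding val by (simp add: a_minus_def r_neg)
      next
        case False
        then have "f i j = \<zero>" "p i j = \<zero>" using f sup[of "(i, j)"] n by auto
        then show False using nz unfolding val by (simp add: a_minus_def)
      qed
    qed
  qed
  moreover have "f = (f \<ominus>\<^bsub>A\<^esub> p) \<oplus>\<^bsub>A\<^esub> p" using fA pA by algebra
  ultimately show "f = p" using pA by simp
qed

text \<open>Only an inclusion holds in general: (1, u) is not minimal if u = v, and (2, 0) is not
  minimal if u = 0.\<close>

lemma corners_cases:
  assumes "e \<in> corners [v, u]"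
  shows "e = (0, v) \<or> e = (1, u) \<or> e = (2, 0)"
proof -
  obtain i j where e: "e = (i, j)" by (cases e)
  have n: "(i, j) \<notin> boxes [v, u]"
    and m: "\<And>k l. (k, l) \<notin> boxes [v, u] \<Longrightarrow> k \<le> i \<Longrightarrow> l \<le> j \<Longrightarrow> (k, l) = (i, j)"
    using assms by (auto simp: corners_def e)
  consider "i = 0" | "i = 1" | "2 \<le> i" by linarith
  then show ?thesis
    using n m[of 0 v] m[of 1 u] m[of 2 0] by cases (auto simp: e mem_boxes2)
qed

text \<open>The reduced generators at (0, v) and (2, 0) are monomials, so nonzero coefficients can
  occur at the corner (1, u) only.\<close>

definition coeff_fun :: "(nat \<times> nat) \<times> (nat \<times> nat) \<Rightarrow> 'a" where
  "coeff_fun = (\<lambda>(e, e')\<in>coeff_positions [v, u]. if e = (1, u) then g (snd e') else \<zero>)"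

lemma groebner_coeffs_M: "groebner_coeffs F [v, u] M = coeff_fun"
  unfolding groebner_coeffs_def coeff_fun_def
proof (rule restrict_ext, clarify, goal_cases)
  case (1 i0 j0 i j)
  have b: "(i, j) \<in> boxes [v, u]" and l: "mon_less (i0, j0) (i, j)" and c: "(i0, j0) \<in> corners [v, u]"
    using 1 by (auto simp: coeff_positions_def)
  have gen: "groebner_gen F [v, u] M e = xy_mon F (fst e) (snd e)"
    if "e = (0, v) \<or> e = (2, 0)" for e
    using that y_in_M xx_in_M
    by (intro groebner_gen_eq) (auto simp: is_lead_xy_mon xy_mon_app split: if_splits prod.splits)
  from corners_cases[OF c] consider "(i0, j0) = (0, v)" | "(i0, j0) = (1, u)" | "(i0, j0) = (2, 0)" by blast
  then show ?case
  proof cases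
    case 2
    have "groebner_gen F [v, u] M (1, u) = G"
    proof (rule groebner_gen_eq[OF G_in_M is_lead_G])
      show "case_prod G (1, u) = \<one>" by (simp add: G_app ypow_def)
      fix e' assume *: "case_prod G e' \<noteq> \<zero>"
      obtain k l where e': "e' = (k, l)" by (cases e')
      show "e' = (1, u) \<or> e' \<in> boxes [v, u]"
        using * g_supp[of l] by (auto simp: e' G_app ypow_def mem_boxes2 powser_zero split: if_splits)
    qed
    moreover have "i = 0" using b l 2 uv by (auto simp: mem_boxes2 mon_less_def)
    ultimately show ?thesis using 2 by (simp add: G_app)
  qed (use gen b uv in \<open>auto simp: xy_mon_app mem_boxes2\<close>)
qed

end

section \<open>Cells parametrized by the tail of the middle generator\<close>

context field_powser
begin

abbreviation ideal_of_tail where "ideal_of_tail u v g \<equiv> groebner_pair.M F u v g"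

definition tails :: "nat \<Rightarrow> nat \<Rightarrow> (nat \<Rightarrow> 'a) set" where
  "tails m v = {g \<in> carrier P. \<forall>j. g j \<noteq> \<zero> \<longrightarrow> m \<le> j \<and> j < v}"

definition tail_of :: "nat \<Rightarrow> nat \<Rightarrow> (nat \<Rightarrow> 'a) \<Rightarrow> nat \<Rightarrow> 'a" where
  "tail_of m v s = (\<lambda>j. if m \<le> j \<and> j < v then s (j - m) else \<zero>)"

lemma tails_bij: "bij_betw (tail_of m v) ({..<v - m} \<rightarrow>\<^sub>E carrier F) (tails m v)"
proof (rule bij_betwI[where g = "\<lambda>g. \<lambda>i\<in>{..<v - m}. g (m + i)"])
  show "tail_of m v \<in> ({..<v - m} \<rightarrow>\<^sub>E carrier F) \<rightarrow> tails m v"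
    by (auto simp: tails_def tail_of_def powser_carrier PiE_def Pi_def split: if_splits)
  show "(\<lambda>g. \<lambda>i\<in>{..<v - m}. g (m + i)) \<in> tails m v \<rightarrow> {..<v - m} \<rightarrow>\<^sub>E carrier F"
    by (auto simp: tails_def powser_carrier)
  show "(\<lambda>i\<in>{..<v - m}. tail_of m v s (m + i)) = s" if "s \<in> {..<v - m} \<rightarrow>\<^sub>E carrier F" for s
    using that by (auto simp: tail_of_def fun_eq_iff PiE_def extensional_def)
  show "tail_of m v (\<lambda>i\<in>{..<v - m}. g (m + i)) = g" if "g \<in> tails m v" for g
    using that by (auto simp: tail_of_def fun_eq_iff tails_def) metis+
qed

lemma card_tails: "card (tails m v) = card (carrier F) ^ (v - m)"
  using bij_betw_same_card[OF tails_bij[of m v]] by (simp add: card_PiE)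

lemma finite_tails: "finite (carrier F) \<Longrightarrow> finite (tails m v)"
  using bij_betw_finite[OF tails_bij[of m v]] by (simp add: finite_PiE)

lemma groebner_pairI:
  "\<lbrakk>u \<le> v; g \<in> carrier P; \<And>j. g j \<noteq> \<zero> \<Longrightarrow> u < j \<and> j < v\<rbrakk> \<Longrightarrow> groebner_pair F u v g"
  by unfold_locales auto

lemma groebner_idealI:
  assumes "u \<le> v" "g \<in> carrier P" "\<And>j. g j \<noteq> \<zero> \<Longrightarrow> j < v \<and> u + v \<le> 2 * j"
  shows "groebner_ideal F u v g"
proof -
  have s: "u < j \<and> j < v" if "g j \<noteq> \<zero>" for j using assms(3)[OF that] by linarith
  interpret groebner_pair F u v g using assms s by (intro groebner_pairI) auto
  show ?thesis
    by unfold_locales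
      (use shift_square_vanishes_iff[of g u v] assms s in \<open>auto dest: less_imp_le\<close>)
qed

text \<open>The least order allowed for g: the rounded-up half encodes 2 ord g >= u + v, the other
  entry encodes that x y^a lies in the ideal.\<close>

definition cell_bound :: "nat \<Rightarrow> nat \<Rightarrow> nat \<Rightarrow> nat" where
  "cell_bound a u v = max ((u + v + 1) div 2) (u + v - a)"

text \<open>The same with the strict inequality 2 ord g > u + v, so that y^(u+v+1) divides
  g^2.\<close>

definition rank3_bound :: "nat \<Rightarrow> nat \<Rightarrow> nat \<Rightarrow> nat" where
  "rank3_bound a u v = max ((u + v) div 2 + 1) (u + v - a)"

lemma groebner_ideal_tails:
  assumes "u \<le> v" "g \<in> tails m v" "u + v \<le> 2 * m"
  shows "groebner_ideal F u v g"
proof (rule groebner_idealI)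
  show "j < v \<and> u + v \<le> 2 * j" if "g j \<noteq> \<zero>" for j
    using assms that unfolding tails_def by fastforce
qed (use assms in \<open>auto simp: tails_def\<close>)

lemma groebner_cell_eq:
  assumes "u \<le> v" "v \<le> b" "u \<le> a" "a \<le> b"
  shows "groebner_cell F [v, u] [b, a] = ideal_of_tail u v ` tails (cell_bound a u v) v"
proof (intro equalityI subsetI)
  fix I assume "I \<in> groebner_cell F [v, u] [b, a]"
  then have I: "ideal I A" and Z: "supported_on (- boxes [b, a]) \<subseteq> I"
    and "initial_ideal F I = diagram_ideal F [v, u]"
    by (auto simp: groebner_cell_def ideals_above_def diagram_ideal_eq[OF assms(4)])
  then have L: "leads I = - boxes [v, u]" using initial_ideal_eq_iff[OF I assms(1)] by simp
  have "(0, v) \<in> leads I" "(1, u) \<in> leads I" by (auto simp: L mem_boxes2)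
  note gens = this[THEN ex_reduced_generator[OF I Z assms(4)]]
  obtain p where p: "p \<in> I" "p 0 v = \<one>"
    "\<And>i j. p i j \<noteq> \<zero> \<Longrightarrow> (i, j) = (0, v) \<or> (i, j) \<in> boxes [v, u] \<and> mon_less (0, v) (i, j)"
    using gens(1) unfolding L by auto
  \<comment> \<open>Every box has a power of y below v, so no box comes after (0, v) in the monomial
    order.\<close>
  have "p = xy_mon F 0 v"
  proof (intro ext)
    fix i j
    show "p i j = xy_mon F 0 v i j"
    proof (cases "(i, j) = (0, v)")
      case False
      then have "p i j = \<zero>" using p(3)[of i j] assms(1) by (fastforce simp: mem_boxes2 mon_less_def)
      then show ?thesis using False by (auto simp: xy_mon_app)
    qed (use p(2) in \<open>simp add: xy_mon_app\<close>)
  qed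
  then have y: "xy_mon F 0 v \<in> I" using p by simp
  have x: "xy_mon F 2 0 \<in> I" using Z by (auto simp: xy_mon_supported mem_boxes2)
  obtain q where q: "q \<in> I" "q 1 u = \<one>"
    "\<And>i j. q i j \<noteq> \<zero> \<Longrightarrow> (i, j) = (1, u) \<or> (i, j) \<in> boxes [v, u] \<and> mon_less (1, u) (i, j)"
    using gens(2) unfolding L by auto
  have qA: "q \<in> carrier A" using q A_idealD[OF I] by auto
  define g where "g = q 0"
  have g: "g \<in> carrier P" using qA by (simp add: g_def)
  have gs: "u < j \<and> j < v" if "g j \<noteq> \<zero>" for j
    using q(3)[of 0 j] that by (auto simp: g_def mem_boxes2 mon_less_def)
  interpret groebner_pair F u v g using assms(1) g gs by (rule groebner_pairI)
  \<comment> \<open>The boxes after (1, u) have a power of y above u and hence lie in row 0.\<close>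
  have "q = G"
  proof (intro ext)
    fix i j
    have "q i j = \<zero>" if "i \<noteq> 0" "(i, j) \<noteq> (1, u)"
      by (rule ccontr) (use q(3)[of i j] that in \<open>auto simp: mem_boxes2 mon_less_def\<close>)
    then show "q i j = G i j"
      unfolding G_app using q(2) by (cases "i = 0"; cases "(i, j) = (1, u)") (auto simp: g_def ypow_def powser_zero)
  qed
  then have GI: "G \<in> I" using q by simp
  have IM: "I = M" by (rule ideal_eq_M[OF I GI y x L])
  \<comment> \<open>Row 1 of x G is g and its row 0 is zero, so membership in \<open>M\<close>
    forces \<open>shift u g\<close> times g to vanish below degree v.\<close>
  have xG: "xy_mon F 1 0 \<otimes>\<^bsub>A\<^esub> G \<in> M"
    using A_idealD(5)[OF I GI xy_mon_closed] IM by simp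
  have sq: "(shift u g \<otimes>\<^bsub>P\<^esub> g) j = \<zero>" if "j < v" for j
  proof -
    have "coords (xy_mon F 1 0 \<otimes>\<^bsub>A\<^esub> G) 0 j = \<zero>" using xG that by (auto simp: M_def coords_vanish_def mem_boxes2)
    moreover have "(xy_mon F 1 0 \<otimes>\<^bsub>A\<^esub> G) 1 = g" "(xy_mon F 1 0 \<otimes>\<^bsub>A\<^esub> G) 0 = \<zero>\<^bsub>P\<^esub>"
      by (simp_all add: xy_mon_mult G_app ypow_0)
    ultimately have 0: "(\<zero>\<^bsub>P\<^esub> \<ominus>\<^bsub>P\<^esub> shift u g \<otimes>\<^bsub>P\<^esub> g) j = \<zero>" by (simp add: coords_def)
    have z: "\<zero> \<ominus> (shift u g \<otimes>\<^bsub>P\<^esub> g) j = \<zero>"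
    proof -
      have "(\<zero>\<^bsub>P\<^esub> \<ominus>\<^bsub>P\<^esub> shift u g \<otimes>\<^bsub>P\<^esub> g) j = \<zero>\<^bsub>P\<^esub> j \<ominus> (shift u g \<otimes>\<^bsub>P\<^esub> g) j"
        using g by (intro P_minus) auto
      then show ?thesis using 0 by (simp only: powser_zero)
    qed
    have c: "(shift u g \<otimes>\<^bsub>P\<^esub> g) j \<in> carrier F" by auto
    have "(shift u g \<otimes>\<^bsub>P\<^esub> g) j = \<ominus> (\<zero> \<ominus> (shift u g \<otimes>\<^bsub>P\<^esub> g) j)" using c by algebra
    then show ?thesis unfolding z by simp
  qed
  interpret groebner_ideal F u v g by unfold_locales (rule sq)
  have "diagram_ideal F [b, a] \<subseteq> M" using Z IM by (simp add: diagram_ideal_eq[OF assms(4)])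
  then have 1: "\<And>j. g j \<noteq> \<zero> \<Longrightarrow> u + v \<le> a + j" using diagram_in_M_iff[OF assms(4)] by auto
  have 2: "\<And>j. g j \<noteq> \<zero> \<Longrightarrow> u + v \<le> 2 * j"
    using shift_square_vanishes_iff[OF g, of u v] gs sq by (meson less_imp_le)
  have "g \<in> tails (cell_bound a u v) v"
    unfolding tails_def cell_bound_def using g 1 2 gs by fastforce
  then show "I \<in> ideal_of_tail u v ` tails (cell_bound a u v) v" using IM by blast
next
  fix I assume "I \<in> ideal_of_tail u v ` tails (cell_bound a u v) v"
  then obtain g where g: "g \<in> tails (cell_bound a u v) v" and I: "I = ideal_of_tail u v g" by auto
  interpret groebner_ideal F u v g
    by (rule groebner_ideal_tails[OF assms(1) g]) (simp add: cell_bound_def)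
  have "diagram_ideal F [b, a] \<subseteq> M"
    unfolding diagram_in_M_iff[OF assms(4)] using assms g by (fastforce simp: tails_def cell_bound_def)
  then show "I \<in> groebner_cell F [v, u] [b, a]"
    by (simp add: I groebner_cell_def ideals_above_def M_ideal initial_ideal_M)
qed

lemma rho_tails:
  assumes "u \<le> v" "0 < v" "u \<le> a" and g: "g \<in> tails (cell_bound a u v) v"
  shows "rho F (ideal_of_tail u v g) = (if 0 < u \<and> u < v \<and> g \<in> tails (rank3_bound a u v) v then 3 else 2)"
proof -
  interpret groebner_ideal F u v g
    by (rule groebner_ideal_tails[OF assms(1) g]) (simp add: cell_bound_def)
  have gs: "m \<le> j" if "g j \<noteq> \<zero>" "m = cell_bound a u v" for j m using g that by (auto simp: tails_def)
  \<comment> \<open>The coefficients below v vanish already in the cell, so the extra condition at v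
    is the vanishing criterion for n = v + 1.\<close>
  have "(shift u g \<otimes>\<^bsub>P\<^esub> g) v = \<zero> \<longleftrightarrow> (\<forall>j<Suc v. (shift u g \<otimes>\<^bsub>P\<^esub> g) j = \<zero>)"
    using square_vanishes by (auto simp: less_Suc_eq)
  also have "\<dots> \<longleftrightarrow> (\<forall>j. g j \<noteq> \<zero> \<longrightarrow> u + Suc v \<le> 2 * j)"
    using g_supp by (intro shift_square_vanishes_iff) (auto dest: less_imp_le)
  also have "\<dots> \<longleftrightarrow> g \<in> tails (rank3_bound a u v) v"
  proof
    assume *: "\<forall>j. g j \<noteq> \<zero> \<longrightarrow> u + Suc v \<le> 2 * j"
    have "rank3_bound a u v \<le> j" if "g j \<noteq> \<zero>" for j
    proof -
      have "u + Suc v \<le> 2 * j" "u + v - a \<le> j" using * gs[OF that refl] that by (auto simp: cell_bound_def)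
      then show ?thesis unfolding rank3_bound_def by (intro max.boundedI) linarith+
    qed
    then show "g \<in> tails (rank3_bound a u v) v" using g by (auto simp: tails_def)
  next
    assume *: "g \<in> tails (rank3_bound a u v) v"
    show "\<forall>j. g j \<noteq> \<zero> \<longrightarrow> u + Suc v \<le> 2 * j"
    proof (intro allI impI)
      fix j assume "g j \<noteq> \<zero>"
      then have "(u + v) div 2 + 1 \<le> j" using * by (auto simp: tails_def rank3_bound_def)
      then show "u + Suc v \<le> 2 * j" by linarith
    qed
  qed
  finally show ?thesis using rho_M[OF assms(2)] by auto
qed

lemma tails_mono: "m \<le> m' \<Longrightarrow> tails m' v \<subseteq> tails m v"
  by (auto simp: tails_def)

lemma groebner_cell_rank3_eq:
  assumes "u \<le> v" "v \<le> b" "u \<le> a" "a \<le> b" "0 < v"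
  shows "groebner_cell_rank F 3 [v, u] [b, a] =
    (if 0 < u \<and> u < v then ideal_of_tail u v ` tails (rank3_bound a u v) v else {})"
proof -
  have "tails (rank3_bound a u v) v \<subseteq> tails (cell_bound a u v) v"
    by (rule tails_mono) (auto simp: rank3_bound_def cell_bound_def)
  then show ?thesis
    unfolding groebner_cell_rank_def groebner_cell_eq[OF assms(1-4)]
    using rho_tails[OF assms(1,5,3)] by (auto split: if_splits)
qed

lemma ideal_deg_tails:
  assumes "u \<le> v" "g \<in> tails (cell_bound a u v) v"
  shows "ideal_deg F (ideal_of_tail u v g) = u + v"
proof -
  interpret groebner_ideal F u v g
    by (rule groebner_ideal_tails[OF assms]) (simp add: cell_bound_def)
  show ?thesis by (rule ideal_deg_M)
qed

definition coeffs_of_tail :: "nat \<Rightarrow> nat \<Rightarrow> (nat \<Rightarrow> 'a) \<Rightarrow> (nat \<times> nat) \<times> (nat \<times> nat) \<Rightarrow> 'a" where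
  "coeffs_of_tail u v g = (\<lambda>(e, e')\<in>coeff_positions [v, u]. if e = (1, u) then g (snd e') else \<zero>)"

lemma groebner_coeffs_tails:
  assumes "u \<le> v" "g \<in> tails m v" "u + v \<le> 2 * m"
  shows "groebner_coeffs F [v, u] (ideal_of_tail u v g) = coeffs_of_tail u v g"
proof -
  interpret groebner_ideal F u v g by (rule groebner_ideal_tails) fact+
  show ?thesis using groebner_coeffs_M by (simp add: coeffs_of_tail_def coeff_fun_def)
qed

lemma mem_coeff_positions: "u < j \<Longrightarrow> j < v \<Longrightarrow> ((1, u), (0, j)) \<in> coeff_positions [v, u]"
  by (auto simp: coeff_positions_def corners_def mem_boxes2 mon_less_def)

lemma coeff_positions_middle:
  "((1, u), e') \<in> coeff_positions [v, u] \<Longrightarrow> e' = (0, snd e')"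
  by (cases e') (auto simp: coeff_positions_def mem_boxes2 mon_less_def)

lemma inj_coeffs_of_tail:
  assumes "u \<le> v" "u + v \<le> 2 * m"
  shows "inj_on (coeffs_of_tail u v) (tails m v)"
proof (rule inj_onI, rule ext)
  fix g h j assume g: "g \<in> tails m v" and h: "h \<in> tails m v" and eq: "coeffs_of_tail u v g = coeffs_of_tail u v h"
  show "g j = h j"
  proof (cases "m \<le> j \<and> j < v")
    case True
    then have "((1, u), (0, j)) \<in> coeff_positions [v, u]" using assms by (intro mem_coeff_positions) linarith+
    then show ?thesis using fun_cong[OF eq, of "((1, u), (0, j))"] by (simp add: coeffs_of_tail_def)
  next
    case False
    then have "g j = \<zero>" "h j = \<zero>" using g h by (auto simp: tails_def)
    then show ?thesis by simp
  qed
qed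

lemma affine_cell_tails:
  assumes "u \<le> v" "u + v \<le> 2 * m" "m \<le> v"
  shows "affine_cell F [v, u] (int (v - m)) (ideal_of_tail u v ` tails m v)"
proof -
  let ?E = "coeff_positions [v, u]" and ?d = "v - m" and ?S = "ideal_of_tail u v ` tails m v"
  note gc = groebner_coeffs_tails[OF assms(1) _ assms(2)]
  have inj: "inj_on (groebner_coeffs F [v, u]) ?S"
    using inj_coeffs_of_tail[OF assms(1,2)] by (auto simp: inj_on_def gc)
  have img: "groebner_coeffs F [v, u] ` ?S = coeffs_of_tail u v ` tails m v"
    unfolding image_image by (rule image_cong) (auto simp: gc)
  let ?A = "\<lambda>e i. if e = ((1, u), (0, m + i)) then \<one> else \<zero>"
  have bij: "bij_betw (coeffs_of_tail u v \<circ> tail_of m v) ({..<?d} \<rightarrow>\<^sub>E carrier F) (coeffs_of_tail u v ` tails m v)"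
    using tails_bij inj_on_imp_bij_betw[OF inj_coeffs_of_tail[OF assms(1,2)]] by (rule bij_betw_trans)
  have eq: "(\<lambda>e\<in>?E. \<zero> \<oplus> (\<Oplus>i\<in>{..<?d}. ?A e i \<otimes> s i)) = (coeffs_of_tail u v \<circ> tail_of m v) s"
    if s: "s \<in> {..<?d} \<rightarrow>\<^sub>E carrier F" for s
  proof (unfold coeffs_of_tail_def o_apply, rule restrict_ext, clarify, goal_cases)
    case (1 i0 j0 i j)
    have sF: "s i \<in> carrier F" if "i < ?d" for i using s that by (auto simp: PiE_def Pi_def)
    have "(\<Oplus>l\<in>{..<?d}. ?A ((i0, j0), (i, j)) l \<otimes> s l) = (if (i0, j0) = (1, u) then tail_of m v s j else \<zero>)"
    proof (cases "(i0, j0) = (1, u) \<and> m \<le> j \<and> j < v")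
      case True
      have i: "i = 0" using coeff_positions_middle 1 True by fastforce
      have "(\<Oplus>l\<in>{..<?d}. ?A ((i0, j0), (i, j)) l \<otimes> s l) = (\<Oplus>l\<in>{..<?d}. if j - m = l then s l else \<zero>)"
        using sF True i by (intro finsum_cong') auto
      also have "\<dots> = s (j - m)" using sF True by (intro finsum_singleton) auto
      finally show ?thesis using True by (simp add: tail_of_def)
    next
      case False
      have "(\<Oplus>l\<in>{..<?d}. ?A ((i0, j0), (i, j)) l \<otimes> s l) = \<zero>"
        using False sF by (intro add.finprod_one_eqI) auto
      then show ?thesis using False by (auto simp: tail_of_def)
    qed
    moreover have "tail_of m v s j \<in> carrier F" using sF by (auto simp: tail_of_def)
    ultimately show ?case by auto
  qed
  have "bij_betw (\<lambda>s. \<lambda>e\<in>?E. \<zero> \<oplus> (\<Oplus>i\<in>{..<?d}. ?A e i \<otimes> s i)) ({..<?d} \<rightarrow>\<^sub>E carrier F)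
      (coeffs_of_tail u v ` tails m v)"
    by (rule iffD2[OF bij_betw_cong bij]) (rule eq)
  then have "affine_subspace F ?E ?d (groebner_coeffs F [v, u] ` ?S)"
    unfolding affine_subspace_def img
    by (intro exI[of _ "\<lambda>_. \<zero>"] exI[of _ ?A]) auto
  then show ?thesis using inj by (simp add: affine_cell_def)
qed

lemma inj_ideal_of_tail:
  assumes "u \<le> v" "u + v \<le> 2 * m"
  shows "inj_on (ideal_of_tail u v) (tails m v)"
proof (rule inj_onI)
  fix g h assume gh: "g \<in> tails m v" "h \<in> tails m v" and "ideal_of_tail u v g = ideal_of_tail u v h"
  then have "coeffs_of_tail u v g = coeffs_of_tail u v h"
    using groebner_coeffs_tails[OF assms(1) _ assms(2)] by metis
  then show "g = h" using inj_coeffs_of_tail[OF assms] gh by (auto simp: inj_on_def)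
qed

text \<open>The leading exponents are closed upwards and contain all exponents outside (b, a). They
  are thus determined by the least ones in rows 0 and 1, which give v and u.\<close>

lemma ideals_above_cases:
  assumes "a \<le> b" "I \<in> ideals_above F [b, a]"
  obtains u v where "u \<le> v" "v \<le> b" "u \<le> a" "I \<in> groebner_cell F [v, u] [b, a]"
proof -
  have I: "ideal I A" and Z: "supported_on (- boxes [b, a]) \<subseteq> I"
    using assms by (auto simp: ideals_above_def diagram_ideal_eq[OF assms(1)])
  have mon: "(i, j) \<in> leads I" if "(i, j) \<notin> boxes [b, a]" for i j
  proof -
    have "xy_mon F i j \<in> I" using Z that xy_mon_supported by blast
    moreover have "is_lead (xy_mon F i j) (i, j)" by (auto simp: is_lead_def xy_mon_app split: if_splits)
    ultimately show ?thesis by (auto simp: leads_def)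
  qed
  have up: "(k, l) \<in> leads I" if "(i, j) \<in> leads I" "i \<le> k" "j \<le> l" for i j k l
    using up_closed_leads[OF I] that unfolding up_closed_def by blast
  have b: "(0, b) \<in> leads I" and a: "(1, a) \<in> leads I" and xx: "(2, 0) \<in> leads I"
    by (intro mon; simp add: mem_boxes2)+
  define v where "v = (LEAST j. (0, j) \<in> leads I)"
  define u where "u = (LEAST j. (1, j) \<in> leads I)"
  have v: "(0, v) \<in> leads I" unfolding v_def by (rule LeastI) (rule b)
  have u: "(1, u) \<in> leads I" unfolding u_def by (rule LeastI) (rule a)
  have vj: "v \<le> j" if "(0, j) \<in> leads I" for j unfolding v_def by (rule Least_le) (rule that)
  have uj: "u \<le> j" if "(1, j) \<in> leads I" for j unfolding u_def by (rule Least_le) (rule that)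
  have uv: "u \<le> v" by (rule uj) (rule up[OF v]; simp)
  have "leads I = - boxes [v, u]"
  proof (intro equalityI subrelI)
    fix i j assume "(i, j) \<in> leads I"
    then show "(i, j) \<in> - boxes [v, u]" using vj[of j] uj[of j] by (auto simp: mem_boxes2)
  next
    fix i j assume n: "(i, j) \<in> - boxes [v, u]"
    consider "i = 0" | "i = 1" | "2 \<le> i" by linarith
    then show "(i, j) \<in> leads I"
      using n up[OF v] up[OF u] up[OF xx] by cases (auto simp: mem_boxes2)
  qed
  then have "I \<in> groebner_cell F [v, u] [b, a]"
    using assms(2) initial_ideal_eq_iff[OF I uv] by (simp add: groebner_cell_def)
  then show ?thesis using that uv vj[OF b] uj[OF a] by blast
qed

lemma cell_bound_le:
  assumes "u \<le> v" "u \<le> a"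
  shows "cell_bound a u v \<le> v" "u + v \<le> 2 * cell_bound a u v"
    "v - cell_bound a u v = min ((v - u) div 2) (a - u)"
  using assms by (auto simp: cell_bound_def min_def max_def)

lemma rank3_bound_le:
  assumes "u < v" "u \<le> a"
  shows "rank3_bound a u v \<le> v" "u + v \<le> 2 * rank3_bound a u v"
    "v - rank3_bound a u v = min ((v - u + 1) div 2 - 1) (a - u)"
proof -
  obtain w where w: "v = Suc (u + w)" using assms(1) by (auto simp: less_iff_Suc_add)
  obtain c where c: "a = u + c" using assms(2) by (auto simp: le_iff_add)
  have half: "(u + v) div 2 = u + Suc w div 2" by (simp add: w)
  show "rank3_bound a u v \<le> v" "u + v \<le> 2 * rank3_bound a u v"
    "v - rank3_bound a u v = min ((v - u + 1) div 2 - 1) (a - u)"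
    unfolding rank3_bound_def half by (auto simp: min_def max_def w c)
qed

lemma groebner_cell_0:
  assumes "a \<le> b"
  shows "groebner_cell F [0, 0] [b, a] = {carrier A}"
proof -
  have z: "\<zero>\<^bsub>P\<^esub> \<in> tails (cell_bound a 0 0) 0" by (auto simp: tails_def powser_zero)
  interpret groebner_ideal F 0 0 "\<zero>\<^bsub>P\<^esub>"
    by (rule groebner_ideal_tails[OF _ z]) auto
  have "tails (cell_bound a 0 0) 0 = {\<zero>\<^bsub>P\<^esub>}"
    using z by (auto simp: tails_def fun_eq_iff powser_zero)
  then show ?thesis using groebner_cell_eq[of 0 0 b a] assms M_eq_carrier_iff by simp
qed

lemma groebner_cell_disjoint:
  assumes "I \<in> groebner_cell F [v, u] la" "I \<in> groebner_cell F [v', u'] la" "u \<le> v" "u' \<le> v'"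
  shows "u = u' \<and> v = v'"
proof -
  have I: "ideal I A" using assms(1) by (auto simp: groebner_cell_def ideals_above_def)
  have "boxes [v, u] = boxes [v', u']"
    using assms initial_ideal_eq_iff[OF I] by (auto simp: groebner_cell_def)
  then have e: "(i, j) \<in> boxes [v, u] \<longleftrightarrow> (i, j) \<in> boxes [v', u']" for i j by simp
  have "j < v \<longleftrightarrow> j < v'" "j < u \<longleftrightarrow> j < u'" for j
    using e[of 0 j] e[of 1 j] by (auto simp: mem_boxes2)
  then show ?thesis by (metis linorder_neqE_nat less_irrefl)
qed

lemma rho_cases:
  assumes "a \<le> b" "I \<in> ideals_above F [b, a]" "I \<noteq> carrier A"
  shows "rho F I = 2 \<or> rho F I = 3"
proof -
  obtain u v where uv: "u \<le> v" "v \<le> b" "u \<le> a" and I: "I \<in> groebner_cell F [v, u] [b, a]"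
    using ideals_above_cases[OF assms(1,2)] .
  have "0 < v" using groebner_cell_0[OF assms(1)] I uv(1) assms(3) by (cases "v = 0") auto
  then show ?thesis
    using I rho_tails[OF uv(1) _ uv(3)] unfolding groebner_cell_eq[OF uv assms(1)] by auto
qed

end

text \<open>The pair is (u, v), in the opposite order to the list \<open>[v, u]\<close>. The empty
  diagram is left out because its only ideal is the whole ring, of rank 1.\<close>

definition nonempty_subdiagrams :: "nat \<Rightarrow> nat \<Rightarrow> (nat \<times> nat) set" where
  "nonempty_subdiagrams a b = {(u, v). u \<le> v \<and> v \<le> b \<and> u \<le> a \<and> 0 < v}"

definition cell_dim :: "nat \<Rightarrow> nat \<Rightarrow> nat \<Rightarrow> nat" where
  "cell_dim a u v = min ((v - u) div 2) (a - u)"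

text \<open>For u < v the rounded-up half is at least 1, so the subtraction of 1 does not
  truncate.\<close>

definition rank3_dim :: "nat \<Rightarrow> nat \<Rightarrow> nat \<Rightarrow> nat" where
  "rank3_dim a u v = min ((v - u + 1) div 2 - 1) (a - u)"

lemma finite_nonempty_subdiagrams: "finite (nonempty_subdiagrams a b)"
  by (rule finite_subset[of _ "{..a} \<times> {..b}"]) (auto simp: nonempty_subdiagrams_def)

section \<open>Summation over the ideals for a finite field\<close>

context field_powser
begin

lemma finite_cell:
  assumes "finite (carrier F)" "u \<le> v" "v \<le> b" "u \<le> a" "a \<le> b"
  shows "finite (groebner_cell F [v, u] [b, a])"
  unfolding groebner_cell_eq[OF assms(2-5)] using finite_tails[OF assms(1)] by simp

text \<open>Every ideal of the cell contributes t^(u+v) (1 + x q), and one of rank 3 contributes x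
  q^2 times this in addition. So only the numbers of points of the cell and of its rank 3 part
  enter.\<close>

lemma sum_over_cell:
  fixes t x :: real
  assumes fin: "finite (carrier F)" and uv: "u \<le> v" "v \<le> b" "u \<le> a" "a \<le> b" "0 < v"
  defines "q \<equiv> real (card (carrier F))"
  shows "(\<Sum>I\<in>groebner_cell F [v, u] [b, a]. t ^ ideal_deg F I * (\<Prod>i\<in>{1..<rho F I}. 1 + x * q ^ i)) =
    t ^ (u + v) * (1 + x * q) * (q ^ cell_dim a u v +
      (if 0 < u \<and> u < v then x * q\<^sup>2 * q ^ rank3_dim a u v else 0))"
proof -
  let ?m = "cell_bound a u v" and ?m3 = "rank3_bound a u v"
  note le = cell_bound_le[OF uv(1,3)]
  let ?c = "\<lambda>g. 0 < u \<and> u < v \<and> g \<in> tails ?m3 v"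
  have prod: "(\<Prod>i\<in>{1..<n}. 1 + x * q ^ i) = (1 + x * q) * (if n = 3 then 1 + x * q\<^sup>2 else 1)"
    if "n = 2 \<or> n = 3" for n :: nat
  proof -
    have sets: "{1..<3::nat} = {1, 2}" "{1..<2::nat} = {1}" by auto
    from that show ?thesis
    proof
      assume n: "n = 2" show ?thesis unfolding n sets by simp
    next
      assume n: "n = 3" show ?thesis unfolding n sets by simp
    qed
  qed
  have "(\<Sum>I\<in>groebner_cell F [v, u] [b, a]. t ^ ideal_deg F I * (\<Prod>i\<in>{1..<rho F I}. 1 + x * q ^ i)) =
      (\<Sum>g\<in>tails ?m v. t ^ ideal_deg F (ideal_of_tail u v g) * (\<Prod>i\<in>{1..<rho F (ideal_of_tail u v g)}. 1 + x * q ^ i))"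
    unfolding groebner_cell_eq[OF uv(1-4)] by (simp add: sum.reindex[OF inj_ideal_of_tail[OF uv(1) le(2)]])
  also have "\<dots> = (\<Sum>g\<in>tails ?m v. t ^ (u + v) * (1 + x * q) * (1 + (if ?c g then x * q\<^sup>2 else 0)))"
  proof (rule sum.cong[OF refl])
    fix g assume g: "g \<in> tails ?m v"
    note rho = rho_tails[OF uv(1,5,3) g]
    show "t ^ ideal_deg F (ideal_of_tail u v g) * (\<Prod>i\<in>{1..<rho F (ideal_of_tail u v g)}. 1 + x * q ^ i) =
        t ^ (u + v) * (1 + x * q) * (1 + (if ?c g then x * q\<^sup>2 else 0))"
      unfolding ideal_deg_tails[OF uv(1) g] rho by (subst prod) auto
  qed
  also have "\<dots> = t ^ (u + v) * (1 + x * q) * (real (card (tails ?m v)) +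
      (if 0 < u \<and> u < v then x * q\<^sup>2 * real (card (tails ?m3 v)) else 0))"
  proof -
    have "tails ?m3 v \<subseteq> tails ?m v"
      by (rule tails_mono) (auto simp: rank3_bound_def cell_bound_def)
    then have "tails ?m v \<inter> tails ?m3 v = tails ?m3 v" by auto
    then have "(\<Sum>g\<in>tails ?m v. if g \<in> tails ?m3 v then x * q\<^sup>2 else 0) = x * q\<^sup>2 * real (card (tails ?m3 v))"
      using sum.inter_restrict[OF finite_tails[OF fin], of "\<lambda>_. x * q\<^sup>2" ?m v "tails ?m3 v"]
      by (simp add: mult.commute[of "x * q\<^sup>2"])
    then have "(\<Sum>g\<in>tails ?m v. if ?c g then x * q\<^sup>2 else 0) =
        (if 0 < u \<and> u < v then x * q\<^sup>2 * real (card (tails ?m3 v)) else 0)"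
      by (cases "0 < u \<and> u < v") auto
    then show ?thesis
      by (simp add: sum_distrib_left[symmetric] sum.distrib)
  qed
  also have "real (card (tails ?m v)) = q ^ cell_dim a u v"
    by (simp add: card_tails q_def cell_dim_def le(3))
  also have "(if 0 < u \<and> u < v then x * q\<^sup>2 * real (card (tails ?m3 v)) else 0) =
      (if 0 < u \<and> u < v then x * q\<^sup>2 * q ^ rank3_dim a u v else 0)"
    using rank3_bound_le(3)[OF _ uv(3)] by (auto simp: card_tails q_def rank3_dim_def)
  finally show ?thesis .
qed

lemma ideals_above_partition:
  assumes "a \<le> b"
  shows "ideals_above F [b, a] = insert (carrier A)
    (\<Union>(u, v)\<in>nonempty_subdiagrams a b. groebner_cell F [v, u] [b, a])"
    "carrier A \<notin> (\<Union>(u, v)\<in>nonempty_subdiagrams a b. groebner_cell F [v, u] [b, a])"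
proof -
  note c0 = groebner_cell_0[OF assms]
  show "ideals_above F [b, a] = insert (carrier A)
    (\<Union>(u, v)\<in>nonempty_subdiagrams a b. groebner_cell F [v, u] [b, a])" (is "_ = ?R")
  proof (intro equalityI subsetI)
    fix I assume I: "I \<in> ideals_above F [b, a]"
    obtain u v where uv: "u \<le> v" "v \<le> b" "u \<le> a" "I \<in> groebner_cell F [v, u] [b, a]"
      using ideals_above_cases[OF assms I] .
    then show "I \<in> ?R" using c0 by (cases "v = 0") (auto simp: nonempty_subdiagrams_def)
  next
    fix I assume "I \<in> ?R"
    moreover have "carrier A \<in> groebner_cell F [0, 0] [b, a]" by (simp add: c0)
    ultimately show "I \<in> ideals_above F [b, a]" by (auto simp: groebner_cell_def)
  qed
  show "carrier A \<notin> (\<Union>(u, v)\<in>nonempty_subdiagrams a b. groebner_cell F [v, u] [b, a])"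
    using groebner_cell_disjoint[of "carrier A" 0 0 "[b, a]"] c0
    by (fastforce simp: nonempty_subdiagrams_def)
qed

lemma ideal_sum_eq:
  fixes t x :: real
  assumes fin: "finite (carrier F)" and ab: "a \<le> b"
  defines "q \<equiv> real (card (carrier F))"
  shows "ideal_sum F [b, a] t x = 1 + (\<Sum>(u, v)\<in>nonempty_subdiagrams a b.
    t ^ (u + v) * (1 + x * q) * (q ^ cell_dim a u v +
      (if 0 < u \<and> u < v then x * q\<^sup>2 * q ^ rank3_dim a u v else 0)))"
proof -
  let ?D = "nonempty_subdiagrams a b" and ?C = "\<lambda>(u, v). groebner_cell F [v, u] [b, a]"
  let ?f = "\<lambda>I. t ^ ideal_deg F I * (\<Prod>i\<in>{1..<rho F I}. 1 + x * q ^ i)"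
  have fC: "\<forall>p\<in>?D. finite (?C p)"
    using finite_cell[OF fin] ab by (auto simp: nonempty_subdiagrams_def)
  have fU: "finite (\<Union>p\<in>?D. ?C p)" using finite_nonempty_subdiagrams fC by blast
  have dj: "\<forall>p\<in>?D. \<forall>p'\<in>?D. p \<noteq> p' \<longrightarrow> ?C p \<inter> ?C p' = {}"
    using groebner_cell_disjoint by (fastforce simp: nonempty_subdiagrams_def)
  have "ideal_sum F [b, a] t x = ?f (carrier A) + sum ?f (\<Union>p\<in>?D. ?C p)"
    unfolding ideal_sum_def q_def[symmetric] ideals_above_partition(1)[OF ab]
    using ideals_above_partition(2)[OF ab] by (subst sum.insert[OF fU]) auto
  also have "?f (carrier A) = 1" by (simp add: ideal_deg_carrier rho_carrier)
  also have "sum ?f (\<Union>p\<in>?D. ?C p) = (\<Sum>p\<in>?D. sum ?f (?C p))"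
    by (rule sum.UNION_disjoint[OF finite_nonempty_subdiagrams fC dj])
  also have "\<dots> = (\<Sum>(u, v)\<in>?D. t ^ (u + v) * (1 + x * q) * (q ^ cell_dim a u v +
      (if 0 < u \<and> u < v then x * q\<^sup>2 * q ^ rank3_dim a u v else 0)))"
    using sum_over_cell[OF fin _ _ _ ab] unfolding q_def
    by (intro sum.cong) (auto simp: nonempty_subdiagrams_def)
  finally show ?thesis .
qed

end

subsection \<open>The superpolynomial\<close>

lemma eval_qta_simps:
  "eval_qta 1 q t x = 1" "eval_qta 0 q t x = 0"
  "eval_qta (G + H) q t x = eval_qta G q t x + eval_qta H q t x"
  "eval_qta (G * H) q t x = eval_qta G q t x * eval_qta H q t x"
  "eval_qta (H ^ n) q t x = eval_qta H q t x ^ n"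
  by (simp_all add: eval_qta_def)

lemma eval_qta_sum: "eval_qta (sum f S) q t x = (\<Sum>i\<in>S. eval_qta (f i) q t x)"
  by (simp add: eval_qta_def poly_sum)

definition q_var :: "real poly poly poly" where "q_var = [:[:[:0, 1:]:]:]"
definition t_var :: "real poly poly poly" where "t_var = [:[:0, 1:]:]"
definition a_var :: "real poly poly poly" where "a_var = [:0, 1:]"

lemma eval_qta_vars:
  "eval_qta q_var q t x = q" "eval_qta t_var q t x = t" "eval_qta a_var q t x = x"
  by (simp_all add: eval_qta_def q_var_def t_var_def a_var_def)

definition superpoly :: "nat \<Rightarrow> nat \<Rightarrow> real poly poly poly" where
  "superpoly a b = 1 + (\<Sum>(u, v)\<in>nonempty_subdiagrams a b.
    t_var ^ (u + v) * (1 + a_var * q_var) * (q_var ^ cell_dim a u v +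
      (if 0 < u \<and> u < v then a_var * q_var\<^sup>2 * q_var ^ rank3_dim a u v else 0)))"

lemma eval_superpoly:
  "eval_qta (superpoly a b) q t x = 1 + (\<Sum>(u, v)\<in>nonempty_subdiagrams a b.
    t ^ (u + v) * (1 + x * q) * (q ^ cell_dim a u v +
      (if 0 < u \<and> u < v then x * q\<^sup>2 * q ^ rank3_dim a u v else 0)))"
  unfolding superpoly_def eval_qta_simps eval_qta_sum
  by (intro arg_cong2[where f = "(+)"] refl sum.cong) (auto simp: eval_qta_simps eval_qta_vars)

lemma is_superpolynomial_superpoly:
  assumes "a \<le> b"
  shows "is_superpolynomial [b, a] (superpoly a b)"
  unfolding is_superpolynomial_def
proof (intro allI impI, elim conjE)
  fix K :: "nat ring" and t x :: real
  assume K: "field K" "finite (carrier K)"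
  interpret field_powser K using K(1) by (rule field_powser.intro)
  show "eval_qta (superpoly a b) (real (card (carrier K))) t x = ideal_sum K [b, a] t x"
    by (simp add: eval_superpoly ideal_sum_eq[OF K(2) assms])
qed

text \<open>Prime fields already supply infinitely many values of q. The function \<open>nat\<close>
  is injective on the residues 0 to p - 1 and carries the field structure over.\<close>

lemma ex_nat_prime_field:
  assumes "prime p"
  shows "\<exists>K :: nat ring. field K \<and> finite (carrier K) \<and> card (carrier K) = p"
proof -
  interpret residues_prime p "residue_ring (int p)" by unfold_locales (use assms in simp_all)
  have c: "carrier (residue_ring (int p)) = {0..int p - 1}" by (simp add: residue_ring_def)
  have inj: "inj_on nat (carrier (residue_ring (int p)))" unfolding c by (auto simp: inj_on_def)
  have "field (image_ring nat (residue_ring (int p)))"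
    by (rule field.inj_imp_image_ring_is_field[OF is_field inj])
  moreover have "carrier (image_ring nat (residue_ring (int p))) = nat ` {0..int p - 1}"
    by (simp add: image_ring_carrier c)
  moreover have "card (nat ` {0..int p - 1}) = p"
    using card_image[OF inj] unfolding c by simp
  ultimately show ?thesis by (intro exI[of _ "image_ring nat (residue_ring (int p))"]) auto
qed

lemma poly_eq_if_infinitely_many:
  fixes p q :: "'a :: idom poly"
  assumes "infinite S" "\<And>x. x \<in> S \<Longrightarrow> poly p x = poly q x"
  shows "p = q"
proof (rule ccontr)
  assume "p \<noteq> q"
  then have "finite {x. poly (p - q) x = 0}" by (intro poly_roots_finite) simp
  moreover have "S \<subseteq> {x. poly (p - q) x = 0}" using assms(2) by auto
  ultimately show False using assms(1) finite_subset by blast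
qed

text \<open>The variables are removed one at a time, q by the primes and then t and the third
  variable by the reals, each time because a polynomial over a domain is determined by infinitely
  many values.\<close>

lemma superpolynomial_unique:
  assumes "is_superpolynomial la G" "is_superpolynomial la H"
  shows "G = H"
proof -
  let ?Q = "(\<lambda>p. real p) ` {p :: nat. prime p}"
  have Q: "infinite ?Q" using primes_infinite by (subst finite_image_iff) (auto simp: inj_on_def)
  have "eval_qta G q t x = eval_qta H q t x" if q: "q \<in> ?Q" for q t x
  proof -
    obtain p where "prime p" "q = real p" using q by auto
    then obtain K :: "nat ring" where "field K" "finite (carrier K)" "q = real (card (carrier K))"
      using ex_nat_prime_field by blast
    then show ?thesis using assms by (simp add: is_superpolynomial_def)
  qed
  then have 1: "poly (poly G [:[:x:]:]) [:t:] = poly (poly H [:[:x:]:]) [:t:]" for x t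
    by (intro poly_eq_if_infinitely_many[OF Q]) (simp add: eval_qta_def)
  have inf1: "infinite (range (\<lambda>t :: real. [:t:]))"
    by (subst finite_image_iff) (auto simp: inj_on_def infinite_UNIV_char_0)
  have inf2: "infinite (range (\<lambda>x :: real. [:[:x:]:]))"
    by (subst finite_image_iff) (auto simp: inj_on_def infinite_UNIV_char_0)
  have "poly G [:[:x:]:] = poly H [:[:x:]:]" for x
    by (rule poly_eq_if_infinitely_many[OF inf1]) (auto simp: 1)
  then show ?thesis by (intro poly_eq_if_infinitely_many[OF inf2]) auto
qed

subsection \<open>Superduality\<close>

text \<open>The cells of dimension \<open>m\<close> have the degrees from \<open>2 * m\<close> to \<open>strand_top a b m\<close>.\<close>

definition strand_top :: "nat \<Rightarrow> nat \<Rightarrow> nat \<Rightarrow> nat" where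
  "strand_top a b m = b - m + min a (b - m)"

definition strand :: "nat \<Rightarrow> nat \<Rightarrow> real \<Rightarrow> nat \<Rightarrow> real" where
  "strand a b t m = (\<Sum>l\<in>{2 * m..strand_top a b m}. t ^ l)"

text \<open>With \<open>l = u + v\<close> and \<open>m\<close> the dimension of the cell, one has \<open>u = min (l div 2) a - m\<close>.\<close>

lemma sum_cells:
  fixes f :: "nat \<Rightarrow> nat \<Rightarrow> real"
  assumes ab: "a \<le> b"
  shows "f 0 0 + (\<Sum>(u, v)\<in>nonempty_subdiagrams a b. f (cell_dim a u v) (u + v)) =
    (\<Sum>m\<le>min a (b div 2). \<Sum>l\<in>{2 * m..strand_top a b m}. f m l)"
proof -
  let ?D = "{(u, v). u \<le> v \<and> v \<le> b \<and> u \<le> a}"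
  let ?R = "SIGMA m:{..min a (b div 2)}. {2 * m..strand_top a b m}"
  have D: "?D = insert (0, 0) (nonempty_subdiagrams a b)" "(0, 0) \<notin> nonempty_subdiagrams a b"
    by (auto simp: nonempty_subdiagrams_def)
  \<comment> \<open>The empty diagram has cell dimension 0 and degree 0, so \<open>f 0 0\<close> is
    its missing term.\<close>
  have "f 0 0 + (\<Sum>(u, v)\<in>nonempty_subdiagrams a b. f (cell_dim a u v) (u + v)) =
      (\<Sum>(u, v)\<in>?D. f (cell_dim a u v) (u + v))"
    unfolding D(1) using D(2) by (subst sum.insert[OF finite_nonempty_subdiagrams]) (auto simp: cell_dim_def)
  also have "\<dots> = (\<Sum>(m, l)\<in>?R. f m l)"
  proof (rule sum.reindex_bij_witness[where
        i = "\<lambda>(m, l). (min (l div 2) a - m, l - (min (l div 2) a - m))" and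
        j = "\<lambda>(u, v). (cell_dim a u v, u + v)"])
    fix p assume p: "p \<in> ?D"
    obtain u v where uv: "p = (u, v)" by (cases p)
    then have le: "u \<le> v" "v \<le> b" "u \<le> a" using p by auto
    obtain w where w: "v = u + w" using le by (auto simp: le_iff_add)
    obtain c where c: "a = u + c" using le by (auto simp: le_iff_add)
    have l: "(u + v) div 2 = u + w div 2" by (simp add: w)
    have d: "cell_dim a u v = min (w div 2) c" by (simp add: cell_dim_def w c)
    show "(case case p of (u, v) \<Rightarrow> (cell_dim a u v, u + v) of (m, l) \<Rightarrow>
        (min (l div 2) a - m, l - (min (l div 2) a - m))) = p"
      using l by (simp add: uv d) (auto simp: w c min_def)
    show "(case p of (u, v) \<Rightarrow> (cell_dim a u v, u + v)) \<in> ?R"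
      using le ab by (simp add: uv d) (auto simp: strand_top_def min_def w c)
  next
    fix p assume p: "p \<in> ?R"
    obtain m l where ml: "p = (m, l)" by (cases p)
    then have R: "m \<le> a" "m \<le> b div 2" "2 * m \<le> l" "l \<le> b - m + min a (b - m)"
      using p by (auto simp: strand_top_def)
    define u where "u = min (l div 2) a - m"
    have u: "u + m = min (l div 2) a" using R by (auto simp: u_def)
    \<comment> \<open>The bound l - u <= b unfolds to l <= b - m + min (l div 2) a. This means l <=
      b - m + a and l <= 2 (b - m), which together are the bound by
      \<open>strand_top\<close>.\<close>
    have le: "u \<le> a" "2 * u \<le> l" "l - u \<le> b" using R u by (auto simp: min_def split: if_splits)
    obtain e where e: "l = 2 * u + e" using le(2) le_Suc_ex by blast
    \<comment> \<open>With v = l - u this is (v - u) div 2, so u is subtracted from both entries of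
      the minimum.\<close>
    have "(l - u - u) div 2 = l div 2 - u" by (simp add: e)
    then have "cell_dim a u (l - u) = min (l div 2) a - u" by (simp only: cell_dim_def min_diff)
    then have d: "cell_dim a u (l - u) = m" using u by (metis diff_add_inverse)
    show "(case case p of (m, l) \<Rightarrow> (min (l div 2) a - m, l - (min (l div 2) a - m)) of
        (u, v) \<Rightarrow> (cell_dim a u v, u + v)) = p"
      using d le by (simp add: ml u_def[symmetric])
    show "(case p of (m, l) \<Rightarrow> (min (l div 2) a - m, l - (min (l div 2) a - m))) \<in> ?D"
      using le by (simp add: ml u_def[symmetric])
  qed auto
  also have "\<dots> = (\<Sum>m\<le>min a (b div 2). \<Sum>l\<in>{2 * m..strand_top a b m}. f m l)"
    by (rule sum.Sigma[symmetric]) auto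
  finally show ?thesis .
qed

text \<open>For 0 < u < v one has \<open>Suc (rank3_dim a u v) = cell_dim a (u - 1) v\<close>.
  Passing from (v, u) to (v, u - 1) lowers the degree by one and reaches each cell of positive
  dimension once. The witnesses are therefore those of \<open>sum_cells\<close> with u increased by
  one.\<close>

lemma sum_rank3_cells:
  fixes f :: "nat \<Rightarrow> nat \<Rightarrow> real"
  assumes ab: "a \<le> b"
  shows "(\<Sum>(u, v)\<in>nonempty_subdiagrams a b. if 0 < u \<and> u < v then f (Suc (rank3_dim a u v)) (u + v) else 0) =
    (\<Sum>m\<in>{1..min a (b div 2)}. \<Sum>l\<in>{2 * m..strand_top a b m}. f m (Suc l))"
proof -
  let ?D = "{(u, v). 0 < u \<and> u < v \<and> v \<le> b \<and> u \<le> a}"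
  let ?R = "SIGMA m:{1..min a (b div 2)}. {2 * m..strand_top a b m}"
  have "(\<Sum>(u, v)\<in>nonempty_subdiagrams a b. if 0 < u \<and> u < v then f (Suc (rank3_dim a u v)) (u + v) else 0) =
      (\<Sum>(u, v)\<in>?D. f (Suc (rank3_dim a u v)) (u + v))"
    using finite_nonempty_subdiagrams[of a b]
    by (intro sum.mono_neutral_cong_right) (auto simp: nonempty_subdiagrams_def split: if_splits)
  also have "\<dots> = (\<Sum>(m, l)\<in>?R. f m (Suc l))"
  proof (rule sum.reindex_bij_witness[where
        i = "\<lambda>(m, l). (Suc (min (l div 2) a) - m, Suc l - (Suc (min (l div 2) a) - m))" and
        j = "\<lambda>(u, v). (Suc (rank3_dim a u v), u + v - 1)"])
    fix p assume p: "p \<in> ?D"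
    obtain u v where uv: "p = (u, v)" by (cases p)
    then have le: "0 < u" "u < v" "v \<le> b" "u \<le> a" using p by auto
    obtain w where w: "v = u + Suc w" using le by (auto simp: less_iff_Suc_add)
    obtain c where c: "a = u + c" using le by (auto simp: le_iff_add)
    have l: "(u + v - 1) div 2 = u + w div 2" by (simp add: w)
    have d: "rank3_dim a u v = min (w div 2) c" by (simp add: rank3_dim_def w c)
    show "(case case p of (u, v) \<Rightarrow> (Suc (rank3_dim a u v), u + v - 1) of (m, l) \<Rightarrow>
        (Suc (min (l div 2) a) - m, Suc l - (Suc (min (l div 2) a) - m))) = p"
      using l le by (simp add: uv d) (auto simp: w c min_def)
    show "(case p of (u, v) \<Rightarrow> (Suc (rank3_dim a u v), u + v - 1)) \<in> ?R"
      using le ab by (simp add: uv d) (auto simp: strand_top_def min_def w c)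
    show "(case case p of (u, v) \<Rightarrow> (Suc (rank3_dim a u v), u + v - 1) of (m, l) \<Rightarrow> f m (Suc l)) =
        (case p of (u, v) \<Rightarrow> f (Suc (rank3_dim a u v)) (u + v))"
      using le by (simp add: uv)
  next
    fix p assume p: "p \<in> ?R"
    obtain m l where ml: "p = (m, l)" by (cases p)
    then have R: "1 \<le> m" "m \<le> a" "m \<le> b div 2" "2 * m \<le> l" "l \<le> b - m + min a (b - m)"
      using p by (auto simp: strand_top_def)
    define u where "u = Suc (min (l div 2) a) - m"
    have u: "u + m = min (l div 2) a + 1" using R by (auto simp: u_def)
    have le: "0 < u" "u \<le> a" "2 * u \<le> l" "Suc l - u \<le> b" using R u by (auto simp: min_def split: if_splits)
    obtain e where e: "l = 2 * u + e" using le(3) le_Suc_ex by blast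
    have "Suc l - u - u + 1 = Suc (Suc e)" by (simp add: e)
    then have "(Suc l - u - u + 1) div 2 - 1 = l div 2 - u" by (simp add: e)
    then have "rank3_dim a u (Suc l - u) = min (l div 2) a - u" by (simp only: rank3_dim_def min_diff)
    moreover obtain z where "min (l div 2) a = z" by blast
    ultimately have d: "Suc (rank3_dim a u (Suc l - u)) = m" using u R(1) by simp
    show "(case case p of (m, l) \<Rightarrow> (Suc (min (l div 2) a) - m, Suc l - (Suc (min (l div 2) a) - m)) of
        (u, v) \<Rightarrow> (Suc (rank3_dim a u v), u + v - 1)) = p"
      using d le by (simp add: ml u_def[symmetric])
    show "(case p of (m, l) \<Rightarrow> (Suc (min (l div 2) a) - m, Suc l - (Suc (min (l div 2) a) - m))) \<in> ?D"
      using le by (simp add: ml u_def[symmetric])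
  qed
  also have "\<dots> = (\<Sum>m\<in>{1..min a (b div 2)}. \<Sum>l\<in>{2 * m..strand_top a b m}. f m (Suc l))"
    by (rule sum.Sigma[symmetric]) auto
  finally show ?thesis .
qed

text \<open>The whole ring lacks the factor 1 + x q, so its term 1 is taken out of the strand m = 0
  and added in front. In the rank 3 part, x q^2 meets q^(m-1), which leaves x q times q^m, and the
  shift of degrees gives the factor t.\<close>

lemma eval_superpoly_strands:
  assumes "a \<le> b"
  shows "eval_qta (superpoly a b) q t x = 1 + (1 + x * q) *
    ((\<Sum>m\<le>min a (b div 2). q ^ m * strand a b t m) - 1 +
      x * q * t * (\<Sum>m\<in>{1..min a (b div 2)}. q ^ m * strand a b t m))"
proof -
  let ?D = "nonempty_subdiagrams a b"
  have 1: "1 + (\<Sum>(u, v)\<in>?D. q ^ cell_dim a u v * t ^ (u + v)) = (\<Sum>m\<le>min a (b div 2). q ^ m * strand a b t m)"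
    using sum_cells[OF assms, of "\<lambda>m l. q ^ m * t ^ l"] by (simp add: strand_def sum_distrib_left)
  have 2: "(\<Sum>(u, v)\<in>?D. if 0 < u \<and> u < v then q ^ Suc (rank3_dim a u v) * t ^ (u + v) else 0) =
      t * (\<Sum>m\<in>{1..min a (b div 2)}. q ^ m * strand a b t m)"
    using sum_rank3_cells[OF assms, of "\<lambda>m l. q ^ m * t ^ l"]
    by (simp add: strand_def sum_distrib_left algebra_simps)
  have 3: "(\<Sum>(u, v)\<in>?D. t ^ (u + v) * (1 + x * q) * (q ^ cell_dim a u v +
      (if 0 < u \<and> u < v then x * q\<^sup>2 * q ^ rank3_dim a u v else 0))) =
    (1 + x * q) * ((\<Sum>(u, v)\<in>?D. q ^ cell_dim a u v * t ^ (u + v)) + x * q *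
      (\<Sum>(u, v)\<in>?D. if 0 < u \<and> u < v then q ^ Suc (rank3_dim a u v) * t ^ (u + v) else 0))"
    unfolding sum_distrib_left sum.distrib[symmetric]
    by (intro sum.cong) (auto simp: algebra_simps power2_eq_square)
  have 1: "(\<Sum>(u, v)\<in>?D. q ^ cell_dim a u v * t ^ (u + v)) = (\<Sum>m\<le>min a (b div 2). q ^ m * strand a b t m) - 1"
    using 1 by simp
  show ?thesis unfolding eval_superpoly 3 2 1 by (simp only: mult.assoc)
qed

lemma sum_powers_reflect:
  fixes t :: real
  assumes "t \<noteq> 0"
  shows "t ^ (lo + hi) * (\<Sum>l\<in>{lo..hi}. (1 / t) ^ l) = (\<Sum>l\<in>{lo..hi}. t ^ l)"
  unfolding sum_distrib_left
  by (rule sum.reindex_bij_witness[where i = "\<lambda>l. lo + hi - l" and j = "\<lambda>l. lo + hi - l"])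
    (use assms in \<open>auto simp: power_diff power_one_over divide_simps\<close>)

text \<open>The lowest and highest degrees of strand m add up to a + b + m, and the surplus t^m is
  supplied by (q t)^m. So each q^m times its strand is self-dual, and only the interplay of the
  strand m = 0 with the term of the whole ring needs an extra identity.\<close>

lemma superdual_superpoly:
  assumes ab: "a \<le> b" and *: "2 * a \<le> b + 1"
  shows "superdual (a + b) (superpoly a b)"
  unfolding superdual_def
proof (intro allI impI)
  fix q t x :: real assume t: "t \<noteq> 0"
  let ?M = "min a (b div 2)" and ?d = "a + b"
  have S: "t ^ ?d * ((q * t) ^ m * strand a b (1 / t) m) = q ^ m * strand a b t m" if "m \<le> ?M" for m
  proof -
    \<comment> \<open>The hypothesis says a <= b - b div 2, so the minimum in
      \<open>strand_top\<close> is a for every m that occurs.\<close>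
    have top: "strand_top a b m + 2 * m = ?d + m" using that ab * by (auto simp: strand_top_def min_def split: if_splits)
    have "t ^ (?d + m) * strand a b (1 / t) m = strand a b t m"
      using sum_powers_reflect[OF t, of "2 * m" "strand_top a b m"] top by (simp add: strand_def add.commute)
    then show ?thesis by (simp add: power_mult_distrib power_add algebra_simps)
  qed
  let ?W = "\<Sum>m\<in>{1..?M}. q ^ m * strand a b t m"
  let ?W' = "\<Sum>m\<in>{1..?M}. (q * t) ^ m * strand a b (1 / t) m"
  have W: "t ^ ?d * ?W' = ?W" unfolding sum_distrib_left by (intro sum.cong) (auto simp: S)
  have S0: "t ^ ?d * strand a b (1 / t) 0 = strand a b t 0" using S[of 0] by simp
  have split: "(\<Sum>m\<le>?M. h m) = h 0 + (\<Sum>m\<in>{1..?M}. h m)" for h :: "nat \<Rightarrow> real"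
    by (simp add: sum.atLeast_Suc_atMost atMost_atLeast0)
  \<comment> \<open>Strand 0 is the full geometric sum from degree 0 to a + b. Dropping its lowest
    term is the same as dropping its highest and multiplying by t.\<close>
  have geo: "strand a b t 0 - 1 = t * (strand a b t 0 - t ^ ?d)"
  proof -
    have top: "strand_top a b 0 = ?d" using ab by (simp add: strand_top_def)
    have "strand a b t 0 = 1 + (\<Sum>l\<in>{1..?d}. t ^ l)"
      by (simp add: strand_def top sum.atLeast_Suc_atMost)
    moreover have "strand a b t 0 = (\<Sum>l<?d. t ^ l) + t ^ ?d"
      by (simp add: strand_def top lessThan_Suc_atMost[symmetric] atMost_atLeast0[symmetric])
    moreover have "(\<Sum>l\<in>{1..?d}. t ^ l) = t * (\<Sum>l<?d. t ^ l)"
      by (simp add: sum_distrib_left sum.atLeast1_atMost_eq)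
    ultimately show ?thesis by simp
  qed
  define S0' where "S0' = strand a b (1 / t) 0"
  have "t ^ ?d * eval_qta (superpoly a b) (q * t) (1 / t) x =
      t ^ ?d + (1 + x * (q * t)) * (t ^ ?d * S0' - t ^ ?d + (1 + x * q) * (t ^ ?d * ?W'))"
    unfolding eval_superpoly_strands[OF ab] split S0'_def using t by (simp add: algebra_simps)
  also have "\<dots> = t ^ ?d + (1 + x * (q * t)) * (strand a b t 0 - t ^ ?d + (1 + x * q) * ?W)"
    unfolding S0'_def S0 W ..
  also have "\<dots> = strand a b t 0 + x * q * (t * (strand a b t 0 - t ^ ?d)) + (1 + x * q * t) * (1 + x * q) * ?W"
    by (simp add: algebra_simps)
  also have "\<dots> = eval_qta (superpoly a b) q t x"
    unfolding geo[symmetric] eval_superpoly_strands[OF ab] split by (simp add: algebra_simps)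
  finally show "eval_qta (superpoly a b) q t x = t ^ ?d * eval_qta (superpoly a b) (q * t) (1 / t) x" ..
qed

text \<open>The strand of highest cell dimension \<open>M = b div 2\<close> is symmetric about degree \<open>b\<close>, whereas
  superduality requires its centre to be \<open>(a + b + M) / 2\<close>.\<close>

lemma not_superdual_superpoly:
  assumes ab: "a \<le> b" and *: "b + 2 \<le> 2 * a"
  shows "\<not> superdual (a + b) (superpoly a b)"
proof
  assume sd: "superdual (a + b) (superpoly a b)"
  let ?M = "b div 2" and ?S = "strand a b"
  have M: "min a (b div 2) = ?M" using * by auto
  \<comment> \<open>Setting the third variable to 0 leaves the sum of q^m times the strands. At t =
    2 both sides are polynomials in q whose coefficients can be compared, and distinct powers of 2
    stay distinct.\<close>
  have "(\<Sum>m\<le>?M. ?S 2 m * q ^ m) = (\<Sum>m\<le>?M. (2 ^ (a + b + m) * ?S (1 / 2) m) * q ^ m)" for q :: real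
  proof -
    have "eval_qta (superpoly a b) q 2 0 = 2 ^ (a + b) * eval_qta (superpoly a b) (q * 2) (1 / 2) 0"
      using sd unfolding superdual_def by (metis zero_neq_numeral)
    then show ?thesis
      unfolding eval_superpoly_strands[OF ab] M
      by (simp add: sum_distrib_left power_add power_mult_distrib algebra_simps)
  qed
  then have "?S 2 ?M = 2 ^ (a + b + ?M) * ?S (1 / 2) ?M"
    using polyfun_eq_coeffs[of "?S 2" ?M "\<lambda>m. 2 ^ (a + b + m) * ?S (1 / 2) m"] by auto
  moreover have "2 ^ (2 * b) * ?S (1 / 2) ?M = ?S 2 ?M"
  proof -
    \<comment> \<open>Now b - b div 2 is at most a, so the top degree of this strand is 2 (b - b div
      2).\<close>
    have "2 * ?M + strand_top a b ?M = 2 * b" using * by (auto simp: strand_top_def min_def)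
    then show ?thesis using sum_powers_reflect[of 2 "2 * ?M" "strand_top a b ?M"] by (simp add: strand_def)
  qed
  ultimately have "(2 :: real) ^ (2 * b) * ?S (1 / 2) ?M = 2 ^ (a + b + ?M) * ?S (1 / 2) ?M" by simp
  moreover have "?S (1 / 2) ?M > 0"
  proof -
    have "2 * ?M \<le> strand_top a b ?M" using * by (auto simp: strand_top_def min_def)
    then show ?thesis unfolding strand_def by (intro sum_pos) auto
  qed
  ultimately have "(2 :: real) ^ (2 * b) = 2 ^ (a + b + ?M)" by simp
  \<comment> \<open>This would force a = b - b div 2, whereas the hypothesis makes a strictly
    larger.\<close>
  then have "2 * b = a + b + ?M" by (subst (asm) power_inject_exp) auto
  then show False using * by presburger
qed

theorem theorem6p3:
  fixes F :: "'a ring" and a b :: nat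
  assumes "field F" and "finite (carrier F)" and "a \<le> b"
  shows
    "(\<forall>u v :: nat. u \<le> v \<and> v \<le> b \<and> u \<le> a \<and> v > 0 \<longrightarrow>
        affine_cell F [v, u] (min \<lfloor>(real v - real u) / 2\<rfloor> (int a - int u))
          (groebner_cell F [v, u] [b, a]) \<and>
        (int a \<ge> \<lfloor>(real v + real u) / 2\<rfloor> \<longrightarrow>
          min \<lfloor>(real v - real u) / 2\<rfloor> (int a - int u) = \<lfloor>(real v - real u) / 2\<rfloor>) \<and>
        (int a \<le> \<lfloor>(real v + real u) / 2\<rfloor> \<longrightarrow>
          min \<lfloor>(real v - real u) / 2\<rfloor> (int a - int u) = int a - int u)) \<and>
     (\<forall>I \<in> ideals_above F [b, a]. I \<noteq> carrier (powser2 F) \<longrightarrow> rho F I = 2 \<or> rho F I = 3) \<and>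
     (\<forall>u v :: nat. u \<le> v \<and> v \<le> b \<and> u \<le> a \<and> v > 0 \<longrightarrow>
        (u > 0 \<longrightarrow>
          affine_cell F [v, u] (min (\<lceil>(real v - real u) / 2\<rceil> - 1) (int a - int u))
            (groebner_cell_rank F 3 [v, u] [b, a])) \<and>
        (u = 0 \<longrightarrow> groebner_cell_rank F 3 [v, u] [b, a] = {})) \<and>
     (\<exists>!H. is_superpolynomial [b, a] H) \<and>
     (\<forall>H. is_superpolynomial [b, a] H \<longrightarrow>
        (superdual (a + b) H \<longleftrightarrow> int b \<ge> 2 * int a - 1))"
proof (intro conjI allI ballI impI; (elim conjE)?)
  interpret field_powser F using assms(1) by (rule field_powser.intro)
  have fl: "\<lfloor>(real v - real u) / 2\<rfloor> = int ((v - u) div 2)" if "u \<le> v" for u v :: nat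
    using that floor_divide_of_nat_eq[of "v - u" 2, where 'a = real] by (simp add: of_nat_diff)
  have fl2: "\<lfloor>(real v + real u) / 2\<rfloor> = int ((v + u) div 2)" for u v :: nat
    using floor_divide_of_nat_eq[of "v + u" 2, where 'a = real] by simp
  have ce: "\<lceil>(real v - real u) / 2\<rceil> = int ((v - u + 1) div 2)" if "u \<le> v" for u v :: nat
  proof -
    obtain w where w: "v = u + w" using \<open>u \<le> v\<close> le_Suc_ex by blast
    show ?thesis unfolding w by (simp add: ceiling_eq_iff) linarith
  qed
  {
    fix u v :: nat assume uv: "u \<le> v" "v \<le> b" "u \<le> a" "0 < v"
    note le = cell_bound_le[OF uv(1,3)]
    have "min \<lfloor>(real v - real u) / 2\<rfloor> (int a - int u) = int (v - cell_bound a u v)"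
      using uv by (simp add: fl le(3) of_nat_diff)
    then show "affine_cell F [v, u] (min \<lfloor>(real v - real u) / 2\<rfloor> (int a - int u)) (groebner_cell F [v, u] [b, a])"
      unfolding groebner_cell_eq[OF uv(1-3) assms(3)] using affine_cell_tails[OF uv(1) le(2,1)] by simp
    show "min \<lfloor>(real v - real u) / 2\<rfloor> (int a - int u) = \<lfloor>(real v - real u) / 2\<rfloor>"
      if "\<lfloor>(real v + real u) / 2\<rfloor> \<le> int a"
      using that uv(1) unfolding fl[OF uv(1)] fl2 by linarith
    show "min \<lfloor>(real v - real u) / 2\<rfloor> (int a - int u) = int a - int u"
      if "int a \<le> \<lfloor>(real v + real u) / 2\<rfloor>"
      using that uv(1) unfolding fl[OF uv(1)] fl2 by linarith
    note r3 = groebner_cell_rank3_eq[OF uv(1-3) assms(3) uv(4)]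
    show "groebner_cell_rank F 3 [v, u] [b, a] = {}" if "u = 0" using r3 that by simp
    show "affine_cell F [v, u] (min (\<lceil>(real v - real u) / 2\<rceil> - 1) (int a - int u)) (groebner_cell_rank F 3 [v, u] [b, a])"
      if "0 < u"
    proof (cases "u = v")
      \<comment> \<open>The dimension formula gives -1 here, which by convention means that the rank
        3 part is empty.\<close>
      case True
      then show ?thesis using r3 uv by (simp add: affine_cell_def)
    next
      case False
      then have lt: "u < v" using uv by simp
      note le = rank3_bound_le[OF lt uv(3)]
      have "min (\<lceil>(real v - real u) / 2\<rceil> - 1) (int a - int u) = int (v - rank3_bound a u v)"
      proof -
        have "1 \<le> (v - u + 1) div 2" using lt by simp
        then show ?thesis
          unfolding ce[OF uv(1)] le(3) of_nat_min using uv by (simp add: of_nat_diff del: One_nat_def)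
      qed
      then show ?thesis using r3 that lt affine_cell_tails[OF uv(1) le(2,1)] by simp
    qed
  }
  show "rho F I = 2 \<or> rho F I = 3" if "I \<in> ideals_above F [b, a]" "I \<noteq> carrier (powser2 F)" for I
    using rho_cases[OF assms(3) that] .
  show "\<exists>!H. is_superpolynomial [b, a] H"
    using is_superpolynomial_superpoly[OF assms(3)] superpolynomial_unique by blast
  fix H assume "is_superpolynomial [b, a] H"
  then have "H = superpoly a b" using is_superpolynomial_superpoly[OF assms(3)] superpolynomial_unique by blast
  then show "superdual (a + b) H \<longleftrightarrow> 2 * int a - 1 \<le> int b"
    using superdual_superpoly[OF assms(3)] not_superdual_superpoly[OF assms(3)]
    by (cases "2 * a \<le> b + 1") auto
qed

end
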